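(* Let $G$ be a generalized Halin graph such that $\kappa_{LLY}(u,v)>0$ for every edge $\{u,v\}$ of $G$. Then $|V(G)|\le 12$, and $G$ is isomorphic to one of the following graphs: $W_n$ with $4\le n\le 12$; $W_n'$ with $5\le n\le 9$; $W_n''$ with $6\le n\le 10$; or $H_i$ with $1\le i\le 8$.
   Context: All graphs are finite, simple, undirected and connected; $d(\cdot,\cdot)$ is the combinatorial (shortest-path) distance and $d_v$ the degree of $v$. Lin-Lu-Yau curvature: for a vertex $v$ and $\alpha\in[0,1]$ let $m_v^\alpha$ be the probability measure with $m_v^\alpha(v)=\alpha$, $m_v^\alpha(u)=(1-\alpha)/d_v$ for each neighbor $u$ of $v$, and $0$ elsewhere. For probability measures $m_1,m_2$ on $V$, $W(m_1,m_2)=\inf_\pi\sum_{u,w}\pi(u,w)d(u,w)$, the infimum over all $\pi:V\times V\to[0,1]$ with $\sum_w\pi(u,w)=m_1(u)$ for all $u$ and $\sum_u\pi(u,w)=m_2(w)$ for all $w$. For an edge $\{u,v\}$, $\kappa_\alpha(u,v)=1-W(m_u^\alpha,m_v^\alpha)$ and $\kappa_{LLY}(u,v)=\lim_{\alpha\to1}\kappa_\alpha(u,v)/(1-\alpha)$. Generalized Halin graph: take a tree $T$ with maximum degree $D(T)\ge 3$ together with a planar embedding, and add a cycle $C$ through all leaves of $T$, visiting them in the cyclic order in which they appear in the embedding; the resulting graph $H(T,C)$ is a generalized Halin graph (vertices of degree $2$ are allowed). $W_n$ is the wheel on $n$ vertices: a vertex $v_0$ joined to every vertex of a cycle $v_1v_2\cdots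 v_{n-1}$. $W_n'$ is obtained from $W_{n-1}$ by subdividing the edge $v_0v_1$ once. $W_n''$ is obtained from $W_{n-2}$ (with rim cycle $v_1\cdots v_{n-3}$) by subdividing each of the two edges $v_0v_1$ and $v_0v_{\lceil (n-2)/2\rceil}$ once. The graphs $H_1,\dots,H_8$ are: $H_1$: vertices $x,a_1,a_2,a_3,p_1,p_2,p_3$; edges $xa_i, a_ip_i$ ($i=1,2,3$), $p_1p_2,p_2p_3,p_3p_1$. $H_2$: vertices $x,a,b,p,q_1,q_2$; edges $xa,ab,bp,xq_1,xq_2,pq_1,q_1q_2,q_2p$. $H_3$: the triangular prism: vertices $x,q,r,y,p_1,p_2$; edges $xq,qr,rx,yp_1,p_1p_2,p_2y,xy,qp_2,rp_1$. $H_4$: the prism $H_3$ with the triangle edge $xq$ subdivided once: vertices $x,w,q,r,y,p_1,p_2$; edges $xw,wq,qr,rx,yp_1,p_1p_2,p_2y,xy,qp_2,rp_1$. $H_5$: the prism $H_3$ with the non-triangle edge $xy$ subdivided once: vertices $x,z,y,q,r,p_1,p_2$; edges $xq,qr,rx,yp_1,p_1p_2,p_2y,xz,zy,qp_2,rp_1$. $H_6$: vertices $x,a_1,a_2,q_1,q_2,q_3,q_4$; edges $xa_1,a_1q_1,xa_2,a_2q_2,xq_3,xq_4,q_1q_2,q_2q_3,q_3q_4,q_4q_1$ (i.e. $W_5$ with the spokes to two adjacent rim vertices each subdivided once). $H_7$: vertices $x,y,y_1,y_2,x_1,x_2,x_3$; edges $xy,xx_1,xx_2,xx_3,yy_1,yy_2,y_1y_2,y_2x_1,x_1x_2,x_2x_3,x_3y_1$.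 $H_8$: $H_7$ with the edge $xx_2$ subdivided once by a new vertex. *)

theory Defs
  imports Complex_Main
begin

definition simple_graph :: "'a set \<Rightarrow> 'a set set \<Rightarrow> bool" where
  "simple_graph V E \<longleftrightarrow> finite V \<and>
     (\<forall>e\<in>E. \<exists>u v. u \<noteq> v \<and> u \<in> V \<and> v \<in> V \<and> e = {u, v})"

definition nbrs :: "'a set set \<Rightarrow> 'a \<Rightarrow> 'a set" where
  "nbrs E v = {u. {u, v} \<in> E}"

definition deg :: "'a set set \<Rightarrow> 'a \<Rightarrow> nat" where
  "deg E v = card (nbrs E v)"

definition is_walk :: "'a set set \<Rightarrow> 'a list \<Rightarrow> bool" where
  "is_walk E xs \<longleftrightarrow> xs \<noteq> [] \<and> (\<forall>i. Suc i < length xs \<longrightarrow> {xs ! i, xs ! Suc i} \<in> E)"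

definition connected_graph :: "'a set \<Rightarrow> 'a set set \<Rightarrow> bool" where
  "connected_graph V E \<longleftrightarrow> V \<noteq> {} \<and>
     (\<forall>u\<in>V. \<forall>v\<in>V. \<exists>xs. is_walk E xs \<and> hd xs = u \<and> last xs = v)"

definition gdist :: "'a set set \<Rightarrow> 'a \<Rightarrow> 'a \<Rightarrow> nat" where
  "gdist E u v = (LEAST n. \<exists>xs. is_walk E xs \<and> length xs = Suc n \<and> hd xs = u \<and> last xs = v)"

definition graph_iso :: "'a set \<Rightarrow> 'a set set \<Rightarrow> 'b set \<Rightarrow> 'b set set \<Rightarrow> bool" where
  "graph_iso V E V' E' \<longleftrightarrow> (\<exists>f. bij_betw f V V' \<and>
     (\<forall>u\<in>V. \<forall>v\<in>V. {u, v} \<in> E \<longleftrightarrow> {f u, f v} \<in> E'))"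

definition lazy_measure :: "'a set set \<Rightarrow> real \<Rightarrow> 'a \<Rightarrow> 'a \<Rightarrow> real" where
  "lazy_measure E \<alpha> v u =
     (if u = v then \<alpha> else if u \<in> nbrs E v then (1 - \<alpha>) / real (deg E v) else 0)"

definition is_coupling :: "'a set \<Rightarrow> ('a \<Rightarrow> real) \<Rightarrow> ('a \<Rightarrow> real) \<Rightarrow> ('a \<Rightarrow> 'a \<Rightarrow> real) \<Rightarrow> bool" where
  "is_coupling V m1 m2 \<pi> \<longleftrightarrow>
     (\<forall>u w. 0 \<le> \<pi> u w \<and> \<pi> u w \<le> 1) \<and>
     (\<forall>u w. (u \<notin> V \<or> w \<notin> V) \<longrightarrow> \<pi> u w = 0) \<and>
     (\<forall>u\<in>V. (\<Sum>w\<in>V. \<pi> u w) = m1 u) \<and>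
     (\<forall>w\<in>V. (\<Sum>u\<in>V. \<pi> u w) = m2 w)"

definition wasserstein :: "'a set \<Rightarrow> 'a set set \<Rightarrow> ('a \<Rightarrow> real) \<Rightarrow> ('a \<Rightarrow> real) \<Rightarrow> real" where
  "wasserstein V E m1 m2 =
     Inf {(\<Sum>u\<in>V. \<Sum>w\<in>V. \<pi> u w * real (gdist E u w)) | \<pi>. is_coupling V m1 m2 \<pi>}"

definition kappa_alpha :: "'a set \<Rightarrow> 'a set set \<Rightarrow> real \<Rightarrow> 'a \<Rightarrow> 'a \<Rightarrow> real" where
  "kappa_alpha V E \<alpha> u v = 1 - wasserstein V E (lazy_measure E \<alpha> u) (lazy_measure E \<alpha> v)"

definition kappa_LLY :: "'a set \<Rightarrow> 'a set set \<Rightarrow> 'a \<Rightarrow> 'a \<Rightarrow> real" where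
  "kappa_LLY V E u v = Lim (at_left 1) (\<lambda>\<alpha>. kappa_alpha V E \<alpha> u v / (1 - \<alpha>))"

definition is_tree :: "'a set \<Rightarrow> 'a set set \<Rightarrow> bool" where
  "is_tree V E \<longleftrightarrow> simple_graph V E \<and> connected_graph V E \<and> card E + 1 = card V"

definition is_leaf :: "'a set set \<Rightarrow> 'a \<Rightarrow> bool" where
  "is_leaf E v \<longleftrightarrow> deg E v = 1"

text \<open>A combinatorial planar embedding (rotation system) of a tree: at every vertex v,
  a cyclic permutation \<rho> v of the neighbours of v.\<close>
definition rotation_system :: "'a set \<Rightarrow> 'a set set \<Rightarrow> ('a \<Rightarrow> 'a \<Rightarrow> 'a) \<Rightarrow> bool" where
  "rotation_system V E \<rho> \<longleftrightarrow> (\<forall>v\<in>V. bij_betw (\<rho> v) (nbrs E v) (nbrs E v) \<and>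
      (\<forall>u\<in>nbrs E v. \<forall>w\<in>nbrs E v. \<exists>n. (\<rho> v ^^ n) u = w))"

text \<open>One step of the boundary walk of the (unique) face: the dart u\<rightarrow>v is followed by
  the dart v\<rightarrow>\<rho> v u.\<close>
definition face_step :: "('a \<Rightarrow> 'a \<Rightarrow> 'a) \<Rightarrow> 'a \<times> 'a \<Rightarrow> 'a \<times> 'a" where
  "face_step \<rho> d = (snd d, \<rho> (snd d) (fst d))"

definition next_leaf :: "'a set set \<Rightarrow> ('a \<Rightarrow> 'a \<Rightarrow> 'a) \<Rightarrow> 'a \<Rightarrow> 'a \<Rightarrow> bool" where
  "next_leaf E \<rho> l l' \<longleftrightarrow> (\<exists>p n. nbrs E l = {p} \<and>
      snd ((face_step \<rho> ^^ n) (l, p)) = l' \<and> is_leaf E l' \<and>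
      (\<forall>m<n. \<not> is_leaf E (snd ((face_step \<rho> ^^ m) (l, p)))))"

definition gen_halin :: "'a set \<Rightarrow> 'a set set \<Rightarrow> bool" where
  "gen_halin V E \<longleftrightarrow> (\<exists>T \<rho> ls.
      is_tree V T \<and> (\<exists>v\<in>V. deg T v \<ge> 3) \<and> rotation_system V T \<rho> \<and>
      distinct ls \<and> set ls = {v\<in>V. is_leaf T v} \<and>
      (\<forall>i<length ls. next_leaf T \<rho> (ls ! i) (ls ! ((i + 1) mod length ls))) \<and>
      E = T \<union> {{ls ! i, ls ! ((i + 1) mod length ls)} | i. i < length ls})"

definition mkE :: "(nat \<times> nat) list \<Rightarrow> nat set set" where
  "mkE es = set (map (\<lambda>(a, b). {a, b}) es)"

definition subdiv :: "'a set set \<Rightarrow> 'a \<Rightarrow> 'a \<Rightarrow> 'a \<Rightarrow> 'a set set" where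
  "subdiv E a b w = (E - {{a, b}}) \<union> {{a, w}, {w, b}}"

definition wheelV :: "nat \<Rightarrow> nat set" where "wheelV n = {0..<n}"
definition wheelE :: "nat \<Rightarrow> nat set set" where
  "wheelE n = {{0, i} | i. 1 \<le> i \<and> i < n} \<union> {{i, i + 1} | i. 1 \<le> i \<and> i + 1 < n} \<union> {{n - 1, 1}}"

definition wheel1V :: "nat \<Rightarrow> nat set" where "wheel1V n = {0..<n}"
definition wheel1E :: "nat \<Rightarrow> nat set set" where
  "wheel1E n = subdiv (wheelE (n - 1)) 0 1 (n - 1)"

definition wheel2V :: "nat \<Rightarrow> nat set" where "wheel2V n = {0..<n}"
definition wheel2E :: "nat \<Rightarrow> nat set set" where
  "wheel2E n = subdiv (subdiv (wheelE (n - 2)) 0 1 (n - 2)) 0 (nat \<lceil>real (n - 2) / 2\<rceil>) (n - 1)"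

definition HV :: "nat \<Rightarrow> nat set" where
  "HV i = (if i = 2 \<or> i = 3 then {0..<6} else if i = 8 then {0..<8} else {0..<7})"

definition H7E :: "nat set set" where
  "H7E = mkE [(0,1),(0,4),(0,5),(0,6),(1,2),(1,3),(2,3),(3,4),(4,5),(5,6),(6,2)]"

definition HE :: "nat \<Rightarrow> nat set set" where
  "HE i = (if i = 1 then mkE [(0,1),(0,2),(0,3),(1,4),(2,5),(3,6),(4,5),(5,6),(6,4)]
    else if i = 2 then mkE [(0,1),(1,2),(2,3),(0,4),(0,5),(3,4),(4,5),(5,3)]
    else if i = 3 then mkE [(0,1),(1,2),(2,0),(3,4),(4,5),(5,3),(0,3),(1,5),(2,4)]
    else if i = 4 then mkE [(0,1),(1,2),(2,3),(3,0),(4,5),(5,6),(6,4),(0,4),(2,6),(3,5)]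
    else if i = 5 then mkE [(0,3),(3,4),(4,0),(2,5),(5,6),(6,2),(0,1),(1,2),(3,6),(4,5)]
    else if i = 6 then mkE [(0,1),(1,3),(0,2),(2,4),(0,5),(0,6),(3,4),(4,5),(5,6),(6,3)]
    else if i = 7 then H7E
    else subdiv H7E 0 5 7)"

end

theory Submission
  imports Defs
begin

text \<open>Every integer-valued 1-Lipschitz potential \<open>f\<close> with \<open>f y - f x = 1\<close> bounds the curvature of the
  edge \<open>xy\<close> from above, so a positively curved edge constrains the distances between the
  neighbours of \<open>x\<close> and those of \<open>y\<close>. A tree edge separates the leaves into two arcs of the cycle,
  which is all that is needed of planarity.

  Let \<open>m\<close> be the number of leaves. If \<open>m \<ge> 5\<close>, positivity of the cycle edges forces the parents
  of consecutive leaves to be equal or adjacent, so the sequence of parents determines the graph;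
  for \<open>m \<ge> 6\<close> the tree is then a star with some edges subdivided once and far from each other, and
  the curvature of the edges at the hub bounds \<open>m\<close>. If \<open>m \<le> 4\<close>, the degree sum leaves a single
  hub or two vertices of degree 3, and positivity of the tree edges bounds the lengths of the paths.\<close>

section \<open>Curvature and potentials\<close>

text \<open>Only necessary conditions are proved, so upper bounds on curvature suffice: every
  excluded configuration is refuted by one explicit potential. \<open>kappa_LLY\<close> is a
  \<open>Lim\<close>, which says something only once convergence is known; the quotient is monotone
  in the idleness and bounded by any potential. The closed neighbourhoods of the ends of an edge are
  within distance 3 of each other, so being 1-Lipschitz there is a matter of equality, adjacency and
  common neighbours. The thresholds for m come from the rim edge between the leaves i and i+1: its
  outer leaves i-1 and i+2 are non-adjacent once m is at least 5, and they share no rim neighbour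
  once m is at least 6. The bounds 11 and 7 come from potentials that vanish at a hub with m
  neighbours: three neighbours get 1, two get 0 and the other m - 5 get -1, with sum 8 - m. For a
  spoke ending in a leaf (degree 3, sum -1) the inequality is -m < 3 (8 - m); for a subdivided spoke
  (degree 2, sum 0) it is 0 < 2 (8 - m).\<close>

lemma gdist_walk:
  assumes "connected_graph V E" "u \<in> V" "v \<in> V"
  obtains xs where "is_walk E xs" "length xs = Suc (gdist E u v)" "hd xs = u" "last xs = v"
proof -
  obtain ys where ys: "is_walk E ys" "hd ys = u" "last ys = v"
    using assms unfolding connected_graph_def by blast
  then have "length ys = Suc (length ys - 1)" by (cases ys) (auto simp: is_walk_def)
  with ys have "\<exists>n xs. is_walk E xs \<and> length xs = Suc n \<and> hd xs = u \<and> last xs = v" by blast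
  from LeastI_ex[OF this] that show thesis unfolding gdist_def by blast
qed

lemma gdist_edge_le: "{u, v} \<in> E \<Longrightarrow> gdist E u v \<le> 1"
  unfolding gdist_def
  by (rule Least_le, rule exI[of _ "[u, v]"]) (auto simp: is_walk_def)

text \<open>The purpose is to trade distances for local conditions. The cap 3 costs nothing in the
  applications, where u and w are joined by at most three steps through an edge. A walk of length 0,
  1 or 2 would give equality, adjacency or a common neighbour.\<close>

lemma gdist_ge:
  assumes "connected_graph V E" "u \<in> V" "w \<in> V"
    and "k > 0 \<longrightarrow> u \<noteq> w" and "k > 1 \<longrightarrow> {u, w} \<notin> E"
    and "k > 2 \<longrightarrow> nbrs E u \<inter> nbrs E w = {}" and "k \<le> (3::int)"
  shows "k \<le> int (gdist E u w)"
proof (rule ccontr)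
  assume less: "\<not> k \<le> int (gdist E u w)"
  obtain xs where xs: "is_walk E xs" "length xs = Suc (gdist E u w)" "hd xs = u" "last xs = w"
    using gdist_walk[OF assms(1-3)] .
  have "gdist E u w = 0 \<or> gdist E u w = 1 \<or> gdist E u w = 2"
    using less assms(7) by linarith
  then consider "gdist E u w = 0" | "gdist E u w = 1" | "gdist E u w = 2" by auto
  then show False
  proof cases
    case 1
    then have "u = w" using xs by (auto simp: length_Suc_conv)
    then show False using 1 less assms(4) by simp
  next
    case 2
    then obtain a b where "xs = [a, b]" using xs(2) by (auto simp: length_Suc_conv)
    then have "{u, w} \<in> E" using xs by (auto simp: is_walk_def)
    then show False using 2 less assms(5) by simp
  next
    case 3
    then obtain a b c where abc: "xs = [a, b, c]" using xs(2)
      by (auto simp: length_Suc_conv numeral_2_eq_2)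
    have st: "\<forall>i. Suc i < 3 \<longrightarrow> {xs ! i, xs ! Suc i} \<in> E" using xs abc by (auto simp: is_walk_def)
    have "{a, b} \<in> E" "{b, c} \<in> E" using st[rule_format, of 0] st[rule_format, of 1] abc by auto
    then have "b \<in> nbrs E u \<inter> nbrs E w" using xs abc by (auto simp: nbrs_def insert_commute)
    then show False using 3 less assms(6) by auto
  qed
qed

lemma nbrs_subset: "simple_graph V E \<Longrightarrow> nbrs E v \<subseteq> V"
  unfolding simple_graph_def nbrs_def by (fastforce simp: doubleton_eq_iff)

lemma not_in_nbrs_self: "simple_graph V E \<Longrightarrow> v \<notin> nbrs E v"
  unfolding simple_graph_def nbrs_def by (fastforce simp: doubleton_eq_iff)

lemma finite_nbrs: "simple_graph V E \<Longrightarrow> finite (nbrs E v)"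
  by (meson finite_subset nbrs_subset simple_graph_def)

lemma nbrs_sym: "u \<in> nbrs E v \<longleftrightarrow> v \<in> nbrs E u"
  by (simp add: nbrs_def insert_commute)

section \<open>Lazy measures and transport costs\<close>

lemma lazy_measure_integral:
  assumes G: "simple_graph V E" and v: "v \<in> V"
  shows "(\<Sum>u\<in>V. f u * lazy_measure E a v u) =
    a * f v + (1 - a) * ((\<Sum>u\<in>nbrs E v. f u) / real (deg E v))"
proof -
  have fin: "finite V" using G by (simp add: simple_graph_def)
  have "(\<Sum>u\<in>V. f u * lazy_measure E a v u) =
    f v * lazy_measure E a v v + (\<Sum>u\<in>V - {v}. f u * lazy_measure E a v u)"
    using v fin by (simp add: sum.remove)
  also have "(\<Sum>u\<in>V - {v}. f u * lazy_measure E a v u) =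
     (\<Sum>u\<in>nbrs E v. f u * ((1 - a) / real (deg E v)))"
    using nbrs_subset[OF G, of v] not_in_nbrs_self[OF G, of v] fin
    by (intro sum.mono_neutral_cong_right) (auto simp: lazy_measure_def)
  also have "\<dots> = (1 - a) * ((\<Sum>u\<in>nbrs E v. f u) / real (deg E v))"
    by (simp add: sum_distrib_right[symmetric] sum_divide_distrib[symmetric])
  finally show ?thesis by (simp add: lazy_measure_def)
qed

lemma lazy_measure_sum:
  assumes "simple_graph V E" "v \<in> V" "nbrs E v \<noteq> {}"
  shows "(\<Sum>u\<in>V. lazy_measure E a v u) = 1"
  using lazy_measure_integral[OF assms(1,2), of "\<lambda>_. 1" a] assms finite_nbrs[OF assms(1), of v]
  by (simp add: deg_def)

lemma lazy_measure_bounds: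
  assumes "simple_graph V E" "0 \<le> a" "a \<le> 1"
  shows "0 \<le> lazy_measure E a v u" "lazy_measure E a v u \<le> 1"
proof -
  show "0 \<le> lazy_measure E a v u" using assms by (simp add: lazy_measure_def)
  have "(1 - a) / real (deg E v) \<le> 1" if "u \<in> nbrs E v"
  proof -
    have "deg E v \<ge> 1" using that finite_nbrs[OF assms(1), of v]
      by (metis One_nat_def Suc_leI card_gt_0_iff deg_def empty_iff)
    then show ?thesis using assms by (simp add: field_simps)
  qed
  then show "lazy_measure E a v u \<le> 1" using assms by (simp add: lazy_measure_def)
qed

definition transport_cost :: "'a set \<Rightarrow> 'a set set \<Rightarrow> ('a \<Rightarrow> 'a \<Rightarrow> real) \<Rightarrow> real" where
  "transport_cost V E \<pi> = (\<Sum>u\<in>V. \<Sum>w\<in>V. \<pi> u w * real (gdist E u w))"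

lemma wasserstein_alt:
  "wasserstein V E m1 m2 = Inf (transport_cost V E ` {\<pi>. is_coupling V m1 m2 \<pi>})"
  unfolding wasserstein_def transport_cost_def by (rule arg_cong[where f=Inf]) auto

lemma transport_cost_nonneg: "is_coupling V m1 m2 \<pi> \<Longrightarrow> 0 \<le> transport_cost V E \<pi>"
  unfolding transport_cost_def is_coupling_def by (intro sum_nonneg mult_nonneg_nonneg) auto

lemma wasserstein_le:
  "is_coupling V m1 m2 \<pi> \<Longrightarrow> wasserstein V E m1 m2 \<le> transport_cost V E \<pi>"
  unfolding wasserstein_alt
  by (rule cInf_lower) (auto intro!: bdd_belowI2[where m=0] transport_cost_nonneg)

lemma product_coupling:
  assumes "finite V" "\<And>u. 0 \<le> m1 u \<and> m1 u \<le> 1" "\<And>u. 0 \<le> m2 u \<and> m2 u \<le> (1::real)"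
    "(\<Sum>u\<in>V. m1 u) = 1" "(\<Sum>u\<in>V. m2 u) = 1"
  shows "is_coupling V m1 m2 (\<lambda>u w. if u \<in> V \<and> w \<in> V then m1 u * m2 w else 0)"
  using assms
  by (auto simp: is_coupling_def mult_le_one sum_distrib_left[symmetric] sum_distrib_right[symmetric])

text \<open>\<open>Inf\<close> of the empty set of reals is unspecified, so a bound on all plans
  passes to the infimum only with some plan in hand. \<open>product_coupling\<close> supplies
  one.\<close>

lemma wasserstein_ge:
  assumes "is_coupling V m1 m2 \<pi>0"
    and "\<And>\<pi>. is_coupling V m1 m2 \<pi> \<Longrightarrow> c \<le> transport_cost V E \<pi>"
  shows "c \<le> wasserstein V E m1 m2"
  unfolding wasserstein_alt using assms by (intro cInf_greatest) auto

text \<open>The easy half of Kantorovich duality. The potential is only tested on the supports.\<close>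
lemma transport_cost_ge:
  assumes fin: "finite V" and cp: "is_coupling V m1 m2 \<pi>"
    and f: "\<And>u w. u \<in> V \<Longrightarrow> w \<in> V \<Longrightarrow> m1 u \<noteq> 0 \<Longrightarrow> m2 w \<noteq> 0 \<Longrightarrow> f w - f u \<le> real (gdist E u w)"
  shows "(\<Sum>w\<in>V. f w * m2 w) - (\<Sum>u\<in>V. f u * m1 u) \<le> transport_cost V E \<pi>"
proof -
  have nn: "0 \<le> \<pi> u w" for u w using cp by (auto simp: is_coupling_def)
  have z1: "\<pi> u w = 0" if "u \<in> V" "w \<in> V" "m1 u = 0" for u w
    using sum_nonneg_eq_0_iff[OF fin, of "\<pi> u"] nn that cp by (auto simp: is_coupling_def)
  have z2: "\<pi> u w = 0" if "u \<in> V" "w \<in> V" "m2 w = 0" for u w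
    using sum_nonneg_eq_0_iff[OF fin, of "\<lambda>u. \<pi> u w"] nn that cp by (auto simp: is_coupling_def)
  have "(\<Sum>w\<in>V. f w * m2 w) = (\<Sum>w\<in>V. \<Sum>u\<in>V. \<pi> u w * f w)"
    using cp by (intro sum.cong) (auto simp: is_coupling_def sum_distrib_right[symmetric])
  also have "\<dots> = (\<Sum>u\<in>V. \<Sum>w\<in>V. \<pi> u w * f w)" by (rule sum.swap)
  finally have e1: "(\<Sum>w\<in>V. f w * m2 w) = (\<Sum>u\<in>V. \<Sum>w\<in>V. \<pi> u w * f w)" .
  have e2: "(\<Sum>u\<in>V. f u * m1 u) = (\<Sum>u\<in>V. \<Sum>w\<in>V. \<pi> u w * f u)"
    using cp by (intro sum.cong) (auto simp: is_coupling_def sum_distrib_right[symmetric])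
  have "(\<Sum>w\<in>V. f w * m2 w) - (\<Sum>u\<in>V. f u * m1 u) = (\<Sum>u\<in>V. \<Sum>w\<in>V. \<pi> u w * (f w - f u))"
    unfolding e1 e2 by (simp add: sum_subtractf right_diff_distrib)
  also have "\<dots> \<le> transport_cost V E \<pi>"
    unfolding transport_cost_def
  proof (intro sum_mono)
    fix u w assume "u \<in> V" "w \<in> V"
    then show "\<pi> u w * (f w - f u) \<le> \<pi> u w * real (gdist E u w)"
      using z1[of u w] z2[of u w] f[of u w] nn[of u w]
      by (cases "m1 u = 0 \<or> m2 w = 0") (auto intro: mult_left_mono)
  qed
  finally show ?thesis .
qed

section \<open>The limit of the idleness towards 1\<close>

lemma lazy_mix:
  assumes "1 - b = t * (1 - a)"
  shows "lazy_measure E b x u = t * lazy_measure E a x u + (1 - t) * (if u = x then 1 else 0)"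
  using assms by (auto simp: lazy_measure_def algebra_simps)

text \<open>Put t = (1 - b) / (1 - a). A plan for idleness a, scaled by t and completed by mass 1 -
  t moved along the edge from x to y, is a plan for idleness b, so W_b is at most t W_a + (1 - t).
  Hence 1 - W_b is at least t (1 - W_a), and dividing by 1 - b = t (1 - a) gives the claim.\<close>

lemma kappa_alpha_ratio_mono:
  assumes G: "simple_graph V E" and xy: "{x, y} \<in> E" and ab: "0 \<le> a" "a \<le> b" "b < 1"
  shows "kappa_alpha V E a x y / (1 - a) \<le> kappa_alpha V E b x y / (1 - b)"
proof -
  define t where "t = (1 - b) / (1 - a)"
  have t: "0 < t" "t \<le> 1" and tab: "1 - b = t * (1 - a)" using ab by (auto simp: t_def)
  have fin: "finite V" using G by (simp add: simple_graph_def)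
  have xV: "x \<in> V" "y \<in> V" using G xy by (auto simp: simple_graph_def doubleton_eq_iff)
  have ne: "nbrs E x \<noteq> {}" "nbrs E y \<noteq> {}" using xy by (auto simp: nbrs_def insert_commute)
  let ?W = "\<lambda>a. wasserstein V E (lazy_measure E a x) (lazy_measure E a y)"
  have step: "?W b \<le> t * transport_cost V E \<pi> + (1 - t)"
    if cp: "is_coupling V (lazy_measure E a x) (lazy_measure E a y) \<pi>" for \<pi>
  proof -
    define \<pi>' where "\<pi>' = (\<lambda>u w. t * \<pi> u w + (1 - t) * (if u = x \<and> w = y then 1 else 0))"
    have \<pi>: "0 \<le> \<pi> u w" "\<pi> u w \<le> 1" "u \<notin> V \<or> w \<notin> V \<Longrightarrow> \<pi> u w = 0" for u w
      using cp by (auto simp: is_coupling_def)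
    have d1: "(\<Sum>w\<in>V. if u = x \<and> w = y then 1 else (0::real)) = (if u = x then 1 else 0)" for u
      using xV fin by (cases "u = x") (auto simp: sum.delta)
    have d2: "(\<Sum>u\<in>V. if u = x \<and> w = y then 1 else (0::real)) = (if w = y then 1 else 0)" for w
      using xV fin by (cases "w = y") (auto simp: sum.delta)
    have "is_coupling V (lazy_measure E b x) (lazy_measure E b y) \<pi>'"
      unfolding is_coupling_def
    proof (intro conjI allI ballI impI)
      fix u w
      show "0 \<le> \<pi>' u w" using t \<pi>(1)[of u w] by (simp add: \<pi>'_def)
      show "\<pi>' u w \<le> 1"
        using t \<pi>(1,2)[of u w] convex_bound_le[of "\<pi> u w" 1 "if u = x \<and> w = y then 1 else 0" t "1 - t"]
        by (simp add: \<pi>'_def split: if_splits)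
      show "\<pi>' u w = 0" if "u \<notin> V \<or> w \<notin> V" using \<pi>(3)[of u w] that xV by (auto simp: \<pi>'_def)
    next
      fix u assume "u \<in> V"
      then show "(\<Sum>w\<in>V. \<pi>' u w) = lazy_measure E b x u"
        unfolding \<pi>'_def lazy_mix[OF tab]
        using cp by (simp add: sum.distrib sum_distrib_left[symmetric] d1 is_coupling_def)
    next
      fix w assume "w \<in> V"
      then show "(\<Sum>u\<in>V. \<pi>' u w) = lazy_measure E b y w"
        unfolding \<pi>'_def lazy_mix[OF tab]
        using cp by (simp add: sum.distrib sum_distrib_left[symmetric] d2 is_coupling_def)
    qed
    from wasserstein_le[OF this] have "?W b \<le> transport_cost V E \<pi>'" .
    also have "\<dots> = (\<Sum>u\<in>V. \<Sum>w\<in>V. t * (\<pi> u w * real (gdist E u w)) +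
        (1 - t) * (if u = x then if w = y then real (gdist E x y) else 0 else 0))"
      unfolding transport_cost_def by (intro sum.cong) (auto simp: \<pi>'_def algebra_simps)
    also have "\<dots> = t * transport_cost V E \<pi> + (1 - t) * real (gdist E x y)"
    proof -
      have "(\<Sum>w\<in>V. if u = x then if w = y then real (gdist E x y) else 0 else 0) =
         (if u = x then real (gdist E x y) else 0)" for u
        using fin xV by (simp add: sum.delta)
      then show ?thesis using fin xV
        by (simp add: sum.distrib sum_distrib_left[symmetric] transport_cost_def sum.delta)
    qed
    also have "\<dots> \<le> t * transport_cost V E \<pi> + (1 - t)"
      using t gdist_edge_le[OF xy] by (simp add: mult_left_le)
    finally show ?thesis .
  qed
  have "(?W b - (1 - t)) / t \<le> ?W a"
  proof (rule wasserstein_ge)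
    show "is_coupling V (lazy_measure E a x) (lazy_measure E a y)
       (\<lambda>u w. if u \<in> V \<and> w \<in> V then lazy_measure E a x u * lazy_measure E a y w else 0)"
      using ab lazy_measure_bounds[OF G, of a] lazy_measure_sum[OF G] xV ne fin
      by (intro product_coupling) auto
  qed (use step t in \<open>simp add: field_simps\<close>)
  then have "t * (1 - ?W a) \<le> 1 - ?W b" using t by (simp add: field_simps)
  then have "t * (1 - ?W a) / (1 - b) \<le> (1 - ?W b) / (1 - b)" using ab by (simp add: divide_right_mono)
  moreover have "t * (1 - ?W a) / (1 - b) = (1 - ?W a) / (1 - a)" using tab t by simp
  ultimately show ?thesis by (simp add: kappa_alpha_def)
qed

text \<open>\<open>Lim\<close> is a definite description, so convergence has to be established
  first: by monotonicity the supremum over the interval [0, 1) is the left limit at 1.\<close>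

lemma Lim_at_left_mono_le:
  fixes g :: "real \<Rightarrow> real"
  assumes mono: "\<And>a b. 0 \<le> a \<Longrightarrow> a \<le> b \<Longrightarrow> b < 1 \<Longrightarrow> g a \<le> g b"
    and le: "\<And>a. 0 \<le> a \<Longrightarrow> a < 1 \<Longrightarrow> g a \<le> c"
  shows "Lim (at_left 1) g \<le> c"
proof -
  define s where "s = Sup (g ` {0..<1})"
  have bdd: "bdd_above (g ` {0..<1})" using le by (auto intro!: bdd_aboveI2)
  have ub: "g a \<le> s" if "0 \<le> a" "a < 1" for a
    unfolding s_def using that bdd by (intro cSup_upper) auto
  have sc: "s \<le> c" unfolding s_def by (rule cSup_least) (auto intro: le)
  have "(g \<longlongrightarrow> s) (at_left 1)"
  proof (rule order_tendstoI)
    fix a assume "a < s"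
    then obtain z where z: "0 \<le> z" "z < 1" "a < g z"
      unfolding s_def using bdd by (subst (asm) less_cSup_iff) auto
    then have "\<forall>x. z < x \<and> x < 1 \<longrightarrow> a < g x" using mono[of z] by (meson less_imp_le less_le_trans)
    then show "eventually (\<lambda>x. a < g x) (at_left 1)"
      using z(2) eventually_at_left by blast
  next
    fix a assume "s < a"
    then have "\<forall>x. 0 < x \<and> x < 1 \<longrightarrow> g x < a" using ub by (meson less_imp_le le_less_trans)
    then show "eventually (\<lambda>x. g x < a) (at_left 1)"
      using eventually_at_left[of 0 "1::real"] by (auto intro: exI[of _ 0])
  qed
  then have "Lim (at_left 1) g = s" by (intro tendsto_Lim) auto
  then show ?thesis using sc by simp
qed

text \<open>At idleness a the two laziness terms differ by a and the two neighbourhood averages by 1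
  - c, weighted with 1 - a. The dual value is therefore 1 - (1 - a) c with c independent of a, and c
  bounds the quotient for every a.\<close>

lemma kappa_LLY_le:
  assumes G: "simple_graph V E" and xy: "{x, y} \<in> E"
    and f: "\<And>u w. u \<in> insert x (nbrs E x) \<Longrightarrow> w \<in> insert y (nbrs E y) \<Longrightarrow>
              f w - f u \<le> real (gdist E u w)"
    and fxy: "f y = f x + 1"
  shows "kappa_LLY V E x y \<le>
    (\<Sum>u\<in>nbrs E x. f u - f x) / real (deg E x) - (\<Sum>w\<in>nbrs E y. f w - f y) / real (deg E y)"
    (is "_ \<le> ?c")
proof -
  have fin: "finite V" using G by (simp add: simple_graph_def)
  have xV: "x \<in> V" "y \<in> V" using G xy by (auto simp: simple_graph_def doubleton_eq_iff)
  have ne: "nbrs E x \<noteq> {}" "nbrs E y \<noteq> {}" using xy by (auto simp: nbrs_def insert_commute)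
  have dp: "real (deg E x) > 0" "real (deg E y) > 0"
    using ne finite_nbrs[OF G] by (auto simp: deg_def card_gt_0_iff)
  have "kappa_alpha V E a x y / (1 - a) \<le> ?c" if a: "0 \<le> a" "a < 1" for a
  proof -
    let ?mx = "lazy_measure E a x" and ?my = "lazy_measure E a y"
    have "(\<Sum>w\<in>V. f w * ?my w) - (\<Sum>u\<in>V. f u * ?mx u) \<le> wasserstein V E ?mx ?my"
    proof (rule wasserstein_ge)
      show "is_coupling V ?mx ?my (\<lambda>u w. if u \<in> V \<and> w \<in> V then ?mx u * ?my w else 0)"
        using a lazy_measure_bounds[OF G, of a] lazy_measure_sum[OF G] xV ne fin
        by (intro product_coupling) auto
    next
      fix \<pi> assume "is_coupling V ?mx ?my \<pi>"
      then show "(\<Sum>w\<in>V. f w * ?my w) - (\<Sum>u\<in>V. f u * ?mx u) \<le> transport_cost V E \<pi>"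
        by (rule transport_cost_ge[OF fin])
           (rule f; auto simp: lazy_measure_def split: if_splits)
    qed
    moreover have "(\<Sum>w\<in>nbrs E y. f w) / real (deg E y) = (\<Sum>w\<in>nbrs E y. f w - f y) / real (deg E y) + f y"
      using dp by (simp add: sum_subtractf deg_def field_simps)
    moreover have "(\<Sum>w\<in>nbrs E x. f w) / real (deg E x) = (\<Sum>w\<in>nbrs E x. f w - f x) / real (deg E x) + f x"
      using dp by (simp add: sum_subtractf deg_def field_simps)
    ultimately have "1 - (1 - a) * ?c \<le> wasserstein V E ?mx ?my"
      using fxy by (simp add: lazy_measure_integral[OF G xV(1)] lazy_measure_integral[OF G xV(2)] algebra_simps)
    then show ?thesis using a by (simp add: kappa_alpha_def field_simps)
  qed
  then show ?thesis
    unfolding kappa_LLY_def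
    by (intro Lim_at_left_mono_le kappa_alpha_ratio_mono[OF G xy]) auto
qed

text \<open>The only form in which curvature enters the combinatorial part. The Lipschitz condition
  is spelled out as non-adjacencies on the two closed neighbourhoods, and clearing the degrees
  leaves an inequality between integers; a configuration is impossible when some admissible
  \<open>f\<close> violates it.\<close>

lemma curvature_test:
  fixes f :: "'a \<Rightarrow> int"
  assumes G: "simple_graph V E" and con: "connected_graph V E" and xy: "{x, y} \<in> E"
    and pos: "kappa_LLY V E x y > 0"
    and fxy: "f y = f x + 1"
    and f: "\<And>u w. u \<in> insert x (nbrs E x) \<Longrightarrow> w \<in> insert y (nbrs E y) \<Longrightarrow>
      (f w > f u \<longrightarrow> u \<noteq> w) \<and> (f w > f u + 1 \<longrightarrow> {u, w} \<notin> E) \<and>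
      (f w > f u + 2 \<longrightarrow> nbrs E u \<inter> nbrs E w = {}) \<and> f w \<le> f u + 3"
  shows "int (deg E x) * (\<Sum>w\<in>nbrs E y. f w - f y) < int (deg E y) * (\<Sum>u\<in>nbrs E x. f u - f x)"
proof -
  have xV: "x \<in> V" "y \<in> V" using G xy by (auto simp: simple_graph_def doubleton_eq_iff)
  have ne: "nbrs E x \<noteq> {}" "nbrs E y \<noteq> {}" using xy by (auto simp: nbrs_def insert_commute)
  have dp: "real (deg E x) > 0" "real (deg E y) > 0"
    using ne finite_nbrs[OF G] by (auto simp: deg_def card_gt_0_iff)
  define F where "F v = real_of_int (f v)" for v
  have "F w - F u \<le> real (gdist E u w)"
    if "u \<in> insert x (nbrs E x)" "w \<in> insert y (nbrs E y)" for u w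
  proof -
    have "u \<in> V" "w \<in> V" using that xV nbrs_subset[OF G] by auto
    then have "f w - f u \<le> int (gdist E u w)"
      using f[OF that] by (intro gdist_ge[OF con]) auto
    then show ?thesis by (simp add: F_def)
  qed
  from kappa_LLY_le[OF G xy this] pos fxy
  have "(\<Sum>w\<in>nbrs E y. F w - F y) / real (deg E y) < (\<Sum>u\<in>nbrs E x. F u - F x) / real (deg E x)"
    by (simp add: F_def)
  then have "real (deg E x) * (\<Sum>w\<in>nbrs E y. F w - F y) < real (deg E y) * (\<Sum>u\<in>nbrs E x. F u - F x)"
    using dp by (simp add: field_simps)
  then have "real_of_int (int (deg E x) * (\<Sum>w\<in>nbrs E y. f w - f y)) <
      real_of_int (int (deg E y) * (\<Sum>u\<in>nbrs E x. f u - f x))"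
    by (simp add: F_def)
  then show ?thesis by (simp only: of_int_less_iff)
qed

section \<open>Trees and the boundary walk\<close>

text \<open>Serves as the induction principle for connected graphs: a candidate for the vertex set
  is complete as soon as no edge leaves it.\<close>

lemma connected_graph_closed:
  assumes con: "connected_graph V E" and s: "s \<in> V" "s \<in> S"
    and cl: "\<And>a b. a \<in> S \<Longrightarrow> {a, b} \<in> E \<Longrightarrow> b \<in> S"
  shows "V \<subseteq> S"
proof
  fix v assume "v \<in> V"
  then obtain xs where xs: "is_walk E xs" "hd xs = s" "last xs = v"
    using con s unfolding connected_graph_def by blast
  have "i < length xs \<Longrightarrow> xs ! i \<in> S" for i
  proof (induction i)
    case 0 then show ?case using xs s by (simp add: hd_conv_nth)
  next
    case (Suc i) then show ?case using xs cl[of "xs ! i" "xs ! Suc i"] by (auto simp: is_walk_def)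
  qed
  then show "v \<in> S" using xs by (metis diff_less last_conv_nth length_greater_0_conv is_walk_def less_one)
qed

section \<open>Rooted trees and the sides of a tree edge\<close>

lemma tree_simple: "is_tree V T \<Longrightarrow> simple_graph V T"
  and tree_connected: "is_tree V T \<Longrightarrow> connected_graph V T"
  by (auto simp: is_tree_def)

lemma edge_verts: "simple_graph V E \<Longrightarrow> {a, b} \<in> E \<Longrightarrow> a \<in> V \<and> b \<in> V \<and> a \<noteq> b"
  by (auto simp: simple_graph_def doubleton_eq_iff)

lemma finite_edges: "simple_graph V E \<Longrightarrow> finite E"
proof -
  assume "simple_graph V E"
  then have "E \<subseteq> Pow V" "finite V" by (auto simp: simple_graph_def)
  then show ?thesis by (meson finite_Pow_iff finite_subset)
qed

text \<open>Trees are given by connectedness and an edge count. This orientation towards a root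
  stands in for acyclicity: the edges are indexed by the non-root vertices, and the level makes the
  parent map well-founded.\<close>

definition rooted :: "'a set \<Rightarrow> 'a set set \<Rightarrow> 'a \<Rightarrow> ('a \<Rightarrow> 'a) \<Rightarrow> ('a \<Rightarrow> nat) \<Rightarrow> bool" where
  "rooted V T r par lev \<longleftrightarrow> T = (\<lambda>u. {u, par u}) ` (V - {r}) \<and>
     (\<forall>u\<in>V - {r}. par u \<in> V \<and> lev u = Suc (lev (par u)))"

text \<open>Every vertex other than the root sends an edge to a vertex of the previous level, and
  these edges are pairwise distinct; by the edge count they are all edges of the tree.\<close>
lemma rooted_exists:
  assumes tree: "is_tree V T" and r: "r \<in> V"
  obtains par lev where "rooted V T r par lev"
proof -
  note G = tree_simple[OF tree] and con = tree_connected[OF tree]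
  define R where "R = {(a, b). {a, b} \<in> T}"
  have reach: "\<exists>n. (r, v) \<in> R ^^ n" if "v \<in> V" for v
  proof -
    have "V \<subseteq> {v. \<exists>n. (r, v) \<in> R ^^ n}"
    proof (rule connected_graph_closed[OF con r])
      show "r \<in> {v. \<exists>n. (r, v) \<in> R ^^ n}" by (auto intro: exI[of _ 0])
      fix a b assume "a \<in> {v. \<exists>n. (r, v) \<in> R ^^ n}" "{a, b} \<in> T"
      then obtain n where "(r, a) \<in> R ^^ n" "(a, b) \<in> R" by (auto simp: R_def)
      then have "(r, b) \<in> R ^^ Suc n" by auto
      then show "b \<in> {v. \<exists>n. (r, v) \<in> R ^^ n}" by blast
    qed
    then show ?thesis using that by auto
  qed
  define lev where "lev v = (LEAST n. (r, v) \<in> R ^^ n)" for v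
  have lev: "(r, v) \<in> R ^^ lev v" if "v \<in> V" for v
    unfolding lev_def using LeastI_ex[OF reach[OF that]] .
  have lev_le: "lev v \<le> n" if "(r, v) \<in> R ^^ n" for v n
    unfolding lev_def using that by (rule Least_le)
  have "\<exists>z. {u, z} \<in> T \<and> lev u = Suc (lev z)" if u: "u \<in> V" "u \<noteq> r" for u
  proof -
    obtain k where k: "lev u = Suc k" using lev[OF u(1)] u(2) by (cases "lev u") auto
    then obtain z where z: "(r, z) \<in> R ^^ k" "(z, u) \<in> R" using lev[OF u(1)] by auto
    have zV: "z \<in> V" using z(2) edge_verts[OF G] by (auto simp: R_def)
    have "(r, u) \<in> R ^^ Suc (lev z)" using lev[OF zV] z(2) by auto
    then have "lev u \<le> Suc (lev z)" by (rule lev_le)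
    then have "lev z = k" using k lev_le[OF z(1)] by simp
    then show ?thesis using z k by (auto simp: R_def insert_commute)
  qed
  then obtain par where par: "\<And>u. u \<in> V \<Longrightarrow> u \<noteq> r \<Longrightarrow> {u, par u} \<in> T \<and> lev u = Suc (lev (par u))"
    by metis
  have inj: "inj_on (\<lambda>u. {u, par u}) (V - {r})"
  proof (rule inj_onI)
    fix u v assume uv: "u \<in> V - {r}" "v \<in> V - {r}" "{u, par u} = {v, par v}"
    show "u = v"
    proof (rule ccontr)
      assume "u \<noteq> v"
      then have "par u = v" "par v = u" using uv(3) by (auto simp: doubleton_eq_iff)
      then have "lev u = Suc (lev v)" "lev v = Suc (lev u)" using par[of u] par[of v] uv by auto
      then show False by linarith
    qed
  qed
  have fin: "finite V" using G by (simp add: simple_graph_def)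
  have "card ((\<lambda>u. {u, par u}) ` (V - {r})) = card T"
  proof -
    have "card T = card V - 1" using tree unfolding is_tree_def by linarith
    then show ?thesis using fin r by (simp add: card_image[OF inj])
  qed
  moreover have "(\<lambda>u. {u, par u}) ` (V - {r}) \<subseteq> T" using par by auto
  ultimately have "T = (\<lambda>u. {u, par u}) ` (V - {r})"
    using card_subset_eq[OF finite_edges[OF G]] by blast
  moreover have "\<forall>u\<in>V - {r}. par u \<in> V \<and> lev u = Suc (lev (par u))"
  proof
    fix u assume "u \<in> V - {r}"
    then show "par u \<in> V \<and> lev u = Suc (lev (par u))"
      using par[of u] edge_verts[OF G, of u "par u"] by blast
  qed
  ultimately show thesis using that unfolding rooted_def by blast
qed

lemma rooted_edge: "rooted V T r par lev \<Longrightarrow> {a, b} \<in> T \<longleftrightarrow>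
    a \<in> V - {r} \<and> b = par a \<or> b \<in> V - {r} \<and> a = par b"
  unfolding rooted_def by (auto simp: doubleton_eq_iff)

lemma rooted_par: "rooted V T r par lev \<Longrightarrow> u \<in> V \<Longrightarrow> u \<noteq> r \<Longrightarrow> par u \<in> V"
  and rooted_lev: "rooted V T r par lev \<Longrightarrow> u \<in> V \<Longrightarrow> u \<noteq> r \<Longrightarrow> lev u = Suc (lev (par u))"
  unfolding rooted_def by blast+

lemma rooted_par_par:
  assumes R: "rooted V T r par lev" and u: "u \<in> V" "u \<noteq> r" "par u \<noteq> r"
  shows "par (par u) \<noteq> u"
proof
  assume "par (par u) = u"
  then have "lev (par u) = Suc (lev u)" using rooted_lev[OF R rooted_par[OF R u(1,2)] u(3)] by simp
  then show False using rooted_lev[OF R u(1,2)] by linarith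
qed

text \<open>Each vertex other than the root is counted once through its parent edge and once as a
  child, so the degrees sum to 2 (|V| - 1). After subtracting 2 per vertex, vertices of degree 2
  drop out of the balance between leaves and branchings.\<close>

lemma tree_degree_sum:
  assumes tree: "is_tree V T"
  shows "(\<Sum>v\<in>V. int (deg T v) - 2) = -2"
proof -
  note G = tree_simple[OF tree]
  have fin: "finite V" using G by (simp add: simple_graph_def)
  obtain r where r: "r \<in> V" using tree by (auto simp: is_tree_def connected_graph_def)
  obtain par lev where R: "rooted V T r par lev" using rooted_exists[OF tree r] .
  have dg: "int (deg T v) = int (card {u \<in> V - {r}. par u = v}) + (if v = r then 0 else 1)" if v: "v \<in> V" for v
  proof -
    have "nbrs T v = {u \<in> V - {r}. par u = v} \<union> (if v = r then {} else {par v})"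
      using v by (auto simp: nbrs_def rooted_edge[OF R])
    moreover have "par v \<notin> {u \<in> V - {r}. par u = v}" if "v \<noteq> r"
      using rooted_par_par[OF R v that] by auto
    ultimately show ?thesis using fin by (auto simp: deg_def)
  qed
  have card1: "int (card (V - {r})) = int (card V) - 1"
  proof -
    have "card V > 0" using fin r card_gt_0_iff by blast
    then show ?thesis using fin r by simp
  qed
  have "(\<Sum>v\<in>V. int (card {u \<in> V - {r}. par u = v})) = (\<Sum>v\<in>V. \<Sum>u\<in>{u \<in> V - {r}. par u = v}. 1)"
    by simp
  also have "\<dots> = (\<Sum>u\<in>V - {r}. 1)"
    using fin by (intro sum.group) (auto dest: rooted_par[OF R])
  finally have 1: "(\<Sum>v\<in>V. int (card {u \<in> V - {r}. par u = v})) = int (card V) - 1"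
    using card1 by simp
  have 2: "(\<Sum>v\<in>V. (if v = r then 0 else 1) :: int) = int (card V) - 1"
    using card1 by (subst sum.remove[OF fin r]) simp
  have "(\<Sum>v\<in>V. int (deg T v) - 2) =
    (\<Sum>v\<in>V. int (card {u \<in> V - {r}. par u = v}) + (if v = r then 0 else 1) - 2)"
    by (intro sum.cong) (auto simp: dg)
  also have "\<dots> = -2"
    unfolding sum_subtractf sum.distrib 1 2 by simp
  finally show ?thesis .
qed

text \<open>\<open>Y\<close> is the component of \<open>y\<close> in the forest obtained from \<open>T\<close> by deleting the edge \<open>xy\<close>.\<close>
definition tree_side :: "'a set set \<Rightarrow> 'a \<Rightarrow> 'a \<Rightarrow> 'a set \<Rightarrow> bool" where
  "tree_side T x y Y \<longleftrightarrow> {x, y} \<in> T \<and> x \<notin> Y \<and> y \<in> Y \<and>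
     (\<forall>a b. {a, b} \<in> T \<longrightarrow> a \<in> Y \<longrightarrow> b \<notin> Y \<longrightarrow> a = y \<and> b = x)"

text \<open>Y consists of the descendants of y. Going down never leaves Y, and going up leaves it
  only from y itself. The leaf is a descendant of greatest level: it has no child, so its parent is
  its only neighbour.\<close>

lemma rooted_side:
  assumes R: "rooted V T r par lev" and y: "y \<in> V" "y \<noteq> r" and fin: "finite V"
  obtains Y where "tree_side T (par y) y Y" "Y \<subseteq> V" "r \<notin> Y"
    "\<forall>u. u \<in> V \<longrightarrow> u \<noteq> r \<longrightarrow> par u \<in> Y \<longrightarrow> u \<in> Y" "\<exists>v\<in>Y. is_leaf T v"
proof -
  define S where "S = {(u, par u) | u. u \<in> V - {r}}"
  define Y where "Y = {v \<in> V. (v, y) \<in> S\<^sup>*}"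
  have up: "u = y \<or> par u \<in> Y" if "u \<in> Y" "u \<noteq> r" for u
  proof -
    have "(u, y) \<in> S\<^sup>*" "par u \<in> V" using that rooted_par[OF R] by (auto simp: Y_def)
    from this(1) show ?thesis
    proof (cases rule: converse_rtranclE)
      case (step z)
      then have "z = par u" by (simp add: S_def)
      then show ?thesis using step \<open>par u \<in> V\<close> by (simp add: Y_def)
    qed simp
  qed
  have down: "u \<in> Y" if "par u \<in> Y" "u \<in> V" "u \<noteq> r" for u
  proof -
    have "(u, par u) \<in> S" using that by (simp add: S_def)
    then show ?thesis using that unfolding Y_def by (blast intro: converse_rtrancl_into_rtrancl)
  qed
  have lev_ge: "lev y \<le> lev v" if "(v, y) \<in> S\<^sup>*" for v
    using that
  proof (induction rule: converse_rtrancl_induct)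
    case (step u z)
    then have "z = par u" "u \<in> V" "u \<noteq> r" by (auto simp: S_def)
    then show ?case using rooted_lev[OF R, of u] step by simp
  qed simp
  have rY: "r \<notin> Y"
  proof
    assume "r \<in> Y"
    then have "(r, y) \<in> S\<^sup>*" by (simp add: Y_def)
    then show False by (cases rule: converse_rtranclE) (use y in \<open>auto simp: S_def\<close>)
  qed
  have px: "par y \<notin> Y"
    using lev_ge[of "par y"] rooted_lev[OF R y] by (auto simp: Y_def)
  have yY: "y \<in> Y" using y by (simp add: Y_def)
  have side: "tree_side T (par y) y Y"
    unfolding tree_side_def
  proof (intro conjI allI impI)
    show "{par y, y} \<in> T" using y by (simp add: rooted_edge[OF R])
    fix a b assume ab: "{a, b} \<in> T" "a \<in> Y" "b \<notin> Y"
    then have "a \<in> V - {r} \<and> b = par a" using down[of b] by (auto simp: rooted_edge[OF R])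
    then show "a = y" "b = par y" using up[of a] ab by auto
  qed (use px yY in auto)
  have finY: "finite Y" "Y \<noteq> {}" using fin yY by (auto simp: Y_def)
  then obtain v where v: "v \<in> Y" "\<And>u. u \<in> Y \<Longrightarrow> lev u \<le> lev v"
  proof -
    have "Max (lev ` Y) \<in> lev ` Y" using finY by simp
    then obtain v where "v \<in> Y" "lev v = Max (lev ` Y)" by auto
    then show ?thesis using that[of v] finY by simp
  qed
  have vV: "v \<in> V" "v \<noteq> r" using v rY by (auto simp: Y_def)
  have "nbrs T v = {par v}"
  proof (intro set_eqI iffI)
    fix w assume w: "w \<in> nbrs T v"
    have "\<not> (w \<in> V - {r} \<and> v = par w)"
    proof
      assume a: "w \<in> V - {r} \<and> v = par w"
      then have "w \<in> Y" using down[of w] v by auto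
      then show False using v(2)[of w] rooted_lev[OF R, of w] a by simp
    qed
    then show "w \<in> {par v}" using w by (auto simp: rooted_edge[OF R] nbrs_def)
  qed (use vV in \<open>auto simp: rooted_edge[OF R] nbrs_def\<close>)
  then have "is_leaf T v" by (simp add: is_leaf_def deg_def)
  moreover have "Y \<subseteq> V" by (auto simp: Y_def)
  ultimately show thesis using down v by (intro that[OF side _ rY]) auto
qed

lemma tree_side_exists:
  assumes tree: "is_tree V T" and xy: "{x, y} \<in> T"
  obtains Y where "tree_side T x y Y" "Y \<subseteq> V" "\<exists>v\<in>Y. is_leaf T v"
proof -
  note G = tree_simple[OF tree]
  have v: "x \<in> V" "y \<in> V" "x \<noteq> y" using edge_verts[OF G xy] by auto
  have fin: "finite V" using G by (simp add: simple_graph_def)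
  obtain par lev where R: "rooted V T x par lev" using rooted_exists[OF tree v(1)] .
  have "par y = x" using xy by (auto simp: rooted_edge[OF R])
  then show thesis using rooted_side[OF R v(2) _ fin] v that by metis
qed

text \<open>An edge leaving Y starts at y, which is not in X, and an edge leaving X starts at x,
  which is not in Y. So no edge leaves the intersection; if it were nonempty it would be all of V,
  although x is not in Y.\<close>

lemma tree_side_disjoint:
  assumes tree: "is_tree V T" and Y: "tree_side T x y Y" "Y \<subseteq> V" and X: "tree_side T y x X"
  shows "X \<inter> Y = {}"
proof (rule ccontr)
  assume "X \<inter> Y \<noteq> {}"
  then obtain s where s: "s \<in> X" "s \<in> Y" by auto
  have "V \<subseteq> X \<inter> Y"
  proof (rule connected_graph_closed[OF tree_connected[OF tree]])
    show "s \<in> V" "s \<in> X \<inter> Y" using s Y by auto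
    fix a b assume "a \<in> X \<inter> Y" "{a, b} \<in> T"
    then show "b \<in> X \<inter> Y" using X Y unfolding tree_side_def by blast
  qed
  then show False using Y X by (auto simp: tree_side_def)
qed

text \<open>Root the tree at a. One of b, c is the parent of the other unless they agree; the cut is
  made just above the upper one, called z in the proof, so that both lie below it and a does not.
  The ends of the cut are kept internal so that no leaf is separated from its parent.\<close>

lemma tree_separate:
  assumes tree: "is_tree V T" and a: "a \<in> V" "a \<noteq> b" "a \<noteq> c" "\<not> is_leaf T a"
    and bc: "b \<in> V" "b = c \<or> {b, c} \<in> T" "\<not> is_leaf T b" "\<not> is_leaf T c"
  obtains x y Y where "tree_side T x y Y" "b \<in> Y" "c \<in> Y" "a \<notin> Y" "\<not> is_leaf T x" "\<not> is_leaf T y"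
proof -
  note G = tree_simple[OF tree]
  have fin: "finite V" using G by (simp add: simple_graph_def)
  have cV: "c \<in> V" using bc(1,2) edge_verts[OF G, of b c] by blast
  obtain par lev where R: "rooted V T a par lev" using rooted_exists[OF tree a(1)] .
  note res = that
  have gen: thesis if z: "{b, c} = {w, z}" "w = z \<or> par w = z" for w z
  proof -
    have "z \<in> {b, c}" "w \<in> {b, c}" using z(1) by blast+
    then have zV: "z \<in> V" "z \<noteq> a" "w \<in> V" "w \<noteq> a" "\<not> is_leaf T z"
      using a(2,3) bc(1,3,4) cV by blast+
    obtain Y where Y: "tree_side T (par z) z Y" "a \<notin> Y"
      "\<forall>u. u \<in> V \<longrightarrow> u \<noteq> a \<longrightarrow> par u \<in> Y \<longrightarrow> u \<in> Y"
      using rooted_side[OF R zV(1,2) fin] by metis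
    have zY: "z \<in> Y" using Y by (simp add: tree_side_def)
    then have wY: "w \<in> Y" using Y(3) z(2) zV by blast
    \<comment> \<open>The parent is either the root a, or it has two distinct neighbours, z and its
      own parent.\<close>
    have "\<not> is_leaf T (par z)"
    proof (cases "par z = a")
      case False
      let ?x = "par z"
      have x: "?x \<in> V" using rooted_par[OF R] zV by auto
      have "{z, par ?x} \<subseteq> nbrs T ?x"
        using zV x False rooted_edge[OF R, of z ?x] rooted_edge[OF R, of "par ?x" ?x]
        by (simp add: nbrs_def)
      moreover have "z \<noteq> par ?x" using rooted_par_par[OF R zV(1,2) False] by simp
      ultimately have "card (nbrs T ?x) \<ge> 2"
        using card_mono[OF finite_nbrs[OF G], of "{z, par ?x}" ?x] by simp
      then show ?thesis by (simp add: is_leaf_def deg_def)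
    qed (use a(4) in simp)
    moreover have "{b, c} \<subseteq> Y" using zY wY unfolding z(1) by simp
    ultimately show ?thesis using Y zV by (intro res[OF Y(1)]) simp_all
  qed
  show thesis
  proof (cases "b = c")
    case True
    then show ?thesis using gen[of b b] by simp
  next
    case False
    then have "{b, c} \<in> T" using bc(2) by simp
    then have "par b = c \<or> par c = b" using rooted_edge[OF R, of b c] by blast
    then show ?thesis using gen[of b c] gen[of c b] insert_commute[of b c "{}"] by blast
  qed
qed


lemma tree_side_compl:
  assumes "is_tree V T" "tree_side T x y Y"
  shows "tree_side T y x (V - Y)"
  using assms(2) edge_verts[OF tree_simple[OF assms(1)]]
  unfolding tree_side_def by (metis Diff_iff insert_commute)

section \<open>Darts and the face boundary\<close>

lemma face_step_dart:
  assumes G: "simple_graph V T" and rot: "rotation_system V T \<rho>" and d: "{u, v} \<in> T"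
  shows "{v, \<rho> v u} \<in> T"
proof -
  have "v \<in> V" "u \<in> nbrs T v" using edge_verts[OF G d] d by (auto simp: nbrs_def)
  then have "\<rho> v u \<in> nbrs T v" using rot unfolding rotation_system_def by (meson bij_betw_apply)
  then show ?thesis by (simp add: nbrs_def insert_commute)
qed

lemma face_step_funpow_dart:
  assumes G: "simple_graph V T" and rot: "rotation_system V T \<rho>" and d: "{fst d, snd d} \<in> T"
  shows "{fst ((face_step \<rho> ^^ n) d), snd ((face_step \<rho> ^^ n) d)} \<in> T"
  by (induction n) (use d face_step_dart[OF G rot] in \<open>auto simp: face_step_def\<close>)

text \<open>The rotation at a vertex is injective, so the boundary walk can be traced
  backwards.\<close>

lemma face_step_inj:
  assumes G: "simple_graph V T" and rot: "rotation_system V T \<rho>"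
    and d: "{fst d, snd d} \<in> T" "{fst d', snd d'} \<in> T" "face_step \<rho> d = face_step \<rho> d'"
  shows "d = d'"
proof -
  have s: "snd d = snd d'" "\<rho> (snd d) (fst d) = \<rho> (snd d) (fst d')"
    using d(3) by (auto simp: face_step_def)
  have "snd d \<in> V" using edge_verts[OF G d(1)] by simp
  then have "inj_on (\<rho> (snd d)) (nbrs T (snd d))"
    using rot unfolding rotation_system_def by (meson bij_betw_imp_inj_on)
  moreover have "fst d \<in> nbrs T (snd d)" "fst d' \<in> nbrs T (snd d)" using d s by (auto simp: nbrs_def)
  ultimately have "fst d = fst d'" using s(2) by (meson inj_onD)
  then show ?thesis using s(1) by (simp add: prod_eq_iff)
qed

lemma face_step_funpow_inj:
  assumes G: "simple_graph V T" and rot: "rotation_system V T \<rho>"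
    and d: "{fst d, snd d} \<in> T" "{fst d', snd d'} \<in> T"
  shows "(face_step \<rho> ^^ n) d = (face_step \<rho> ^^ n) d' \<Longrightarrow> d = d'"
proof (induction n)
  case (Suc n)
  then show ?case
    using face_step_inj[OF G rot face_step_funpow_dart[OF G rot d(1)] face_step_funpow_dart[OF G rot d(2)]]
    by simp
qed simp

text \<open>The stretches of the face boundary between consecutive leaves do not share a dart:
  tracing a common dart backwards, one of the two stretches would contain a leaf in its interior.\<close>
lemma segments_disjoint:
  assumes G: "simple_graph V T" and rot: "rotation_system V T \<rho>"
    and l: "{l, p} \<in> T" "is_leaf T l" and l': "{l', p'} \<in> T"
    and nl': "\<And>k. k < b \<Longrightarrow> \<not> is_leaf T (snd ((face_step \<rho> ^^ k) (l', p')))"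
    and eq: "(face_step \<rho> ^^ a) (l, p) = (face_step \<rho> ^^ b) (l', p')" and ab: "a \<le> b"
  shows "l = l'"
proof -
  let ?f = "face_step \<rho>"
  have "(?f ^^ a) (l, p) = (?f ^^ a) ((?f ^^ (b - a)) (l', p'))"
    using eq ab funpow_add[of a "b - a" ?f] by simp
  then have lp: "(l, p) = (?f ^^ (b - a)) (l', p')"
    using l l' face_step_funpow_dart[OF G rot, of "(l', p')" "b - a"]
    by (intro face_step_funpow_inj[OF G rot, of "(l, p)" _ a]) simp_all
  show ?thesis
  proof (cases "b - a")
    case 0 then show ?thesis using lp by simp
  next
    case (Suc k)
    then have "l = snd ((?f ^^ k) (l', p'))" using lp by (simp add: face_step_def)
    moreover have "k < b" using Suc by simp
    ultimately show ?thesis using nl' l by auto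
  qed
qed

text \<open>The walk starts outside Y, and the only edge into Y is the one from x to y. The dart
  whose head is the first vertex of the walk in Y is therefore (x, y).\<close>

lemma segment_crosses:
  assumes G: "simple_graph V T" and rot: "rotation_system V T \<rho>"
    and side: "tree_side T x y Y" and l: "{l, p} \<in> T" "l \<notin> Y"
    and n: "snd ((face_step \<rho> ^^ n) (l, p)) \<in> Y"
  shows "\<exists>k\<le>n. (face_step \<rho> ^^ k) (l, p) = (x, y)"
proof -
  let ?d = "\<lambda>k. (face_step \<rho> ^^ k) (l, p)"
  define k where "k = (LEAST k. snd (?d k) \<in> Y)"
  have k: "snd (?d k) \<in> Y" "k \<le> n" unfolding k_def using n by (auto intro: LeastI Least_le)
  have "fst (?d k) \<notin> Y"
  proof (cases k)
    case (Suc j)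
    then have "snd (?d j) \<notin> Y" using not_less_Least[of j "\<lambda>k. snd (?d k) \<in> Y"] by (simp add: k_def)
    then show ?thesis using Suc by (simp add: face_step_def)
  qed (use l in simp)
  moreover have "{snd (?d k), fst (?d k)} \<in> T"
    using face_step_funpow_dart[OF G rot, of "(l, p)" k] l by (simp add: insert_commute)
  ultimately have "snd (?d k) = y \<and> fst (?d k) = x"
    using side k(1) unfolding tree_side_def by blast
  then show ?thesis using k(2) by (auto simp: prod_eq_iff)
qed

text \<open>The embedding survives only in \<open>enter_once\<close>: the boundary walk uses the
  dart (x, y) once, so the leaf cycle enters Y at one index modulo m. Indexing the leaves by all
  integers with period m avoids wrap-around and makes rotations and the reflection
  available.\<close>

locale leaf_cycle =
  fixes V :: "'a set" and T E :: "'a set set" and L :: "int \<Rightarrow> 'a" and m :: int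
  assumes tree: "is_tree V T" and branching: "\<exists>v\<in>V. deg T v \<ge> 3"
    and m_pos: "m > 0" and L_eq: "L i = L j \<longleftrightarrow> i mod m = j mod m"
    and leaves: "range L = {v \<in> V. is_leaf T v}"
    and E_def: "E = T \<union> range (\<lambda>i. {L i, L (i + 1)})"
    and enter_once: "tree_side T x y Y \<Longrightarrow> L i \<notin> Y \<Longrightarrow> L (i + 1) \<in> Y \<Longrightarrow>
       L j \<notin> Y \<Longrightarrow> L (j + 1) \<in> Y \<Longrightarrow> i mod m = j mod m"

text \<open>For \<open>enter_once\<close>: two stretches of the boundary that lead from a leaf
  outside Y to a leaf inside both contain the dart (x, y), and stretches sharing a dart start at the
  same leaf.\<close>

lemma gen_halin_leaf_cycle:
  assumes "gen_halin V E"
  obtains T L m where "leaf_cycle V T E L m"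
proof -
  obtain T \<rho> ls where tree: "is_tree V T" and br: "\<exists>v\<in>V. deg T v \<ge> 3" and rot: "rotation_system V T \<rho>"
    and ls: "distinct ls" "set ls = {v\<in>V. is_leaf T v}"
    and nxt: "\<And>i. i<length ls \<Longrightarrow> next_leaf T \<rho> (ls ! i) (ls ! ((i + 1) mod length ls))"
    and E: "E = T \<union> {{ls ! i, ls ! ((i + 1) mod length ls)} | i. i < length ls}"
    using assms unfolding gen_halin_def by blast
  note G = tree_simple[OF tree]
  define m where "m = int (length ls)"
  define L where "L i = ls ! nat (i mod m)" for i
  have "\<exists>x y. {x, y} \<in> T"
  proof -
    obtain v where "deg T v \<ge> 3" using br by auto
    then have "nbrs T v \<noteq> {}" by (auto simp: deg_def)
    then show ?thesis by (auto simp: nbrs_def)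
  qed
  then obtain x y where "{x, y} \<in> T" by auto
  then obtain Y where "Y \<subseteq> V" "\<exists>v\<in>Y. is_leaf T v" using tree_side_exists[OF tree] by metis
  then have ne: "ls \<noteq> []" using ls by force
  then have mp: "m > 0" by (simp add: m_def)
  have idx: "nat (i mod m) < length ls" for i using mp by (simp add: m_def nat_less_iff)
  have idx1: "nat ((i + 1) mod m) = (nat (i mod m) + 1) mod length ls" for i
  proof -
    have "int ((nat (i mod m) + 1) mod length ls) = (i mod m + 1) mod m"
      using mp by (simp add: m_def zmod_int add.commute)
    also have "\<dots> = (i + 1) mod m" by (simp add: mod_add_left_eq)
    finally show ?thesis by linarith
  qed
  have idx2: "nat (int i mod m) = i" if "i < length ls" for i
    using that by (simp add: m_def)
  have step: "\<exists>p n. {L i, p} \<in> T \<and> is_leaf T (L i) \<and> snd ((face_step \<rho> ^^ n) (L i, p)) = L (i + 1) \<and>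
      (\<forall>k<n. \<not> is_leaf T (snd ((face_step \<rho> ^^ k) (L i, p))))" for i
  proof -
    have "next_leaf T \<rho> (L i) (L (i + 1))"
      using nxt[OF idx, of i] unfolding L_def idx1 .
    then obtain p n where "nbrs T (L i) = {p}" "snd ((face_step \<rho> ^^ n) (L i, p)) = L (i + 1)"
      "\<forall>k<n. \<not> is_leaf T (snd ((face_step \<rho> ^^ k) (L i, p)))"
      unfolding next_leaf_def by blast
    moreover have "L i \<in> set ls" using idx by (simp add: L_def)
    moreover have "p \<in> nbrs T (L i) \<Longrightarrow> {L i, p} \<in> T" by (simp add: nbrs_def insert_commute)
    ultimately show ?thesis using ls by blast
  qed
  have Leq: "L i = L j \<longleftrightarrow> i mod m = j mod m" for i j
    using nth_eq_iff_index_eq[OF ls(1) idx idx, of i j] mp by (simp add: L_def eq_nat_nat_iff)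
  have "leaf_cycle V T E L m"
  proof
    show "is_tree V T" "\<exists>v\<in>V. deg T v \<ge> 3" "m > 0" by fact+
    show "\<And>i j. (L i = L j) = (i mod m = j mod m)" by (rule Leq)
    have "range L = set ls"
    proof
      show "range L \<subseteq> set ls" using idx by (auto simp: L_def)
      show "set ls \<subseteq> range L"
      proof
        fix v assume "v \<in> set ls"
        then obtain i where "i < length ls" "v = ls ! i" by (auto simp: in_set_conv_nth)
        then have "v = L (int i)" by (simp add: L_def idx2)
        then show "v \<in> range L" by simp
      qed
    qed
    then show "range L = {v \<in> V. is_leaf T v}" using ls by simp
    have "{{ls ! i, ls ! ((i + 1) mod length ls)} | i. i < length ls} = range (\<lambda>i. {L i, L (i + 1)})"
    proof (intro set_eqI iffI)
      fix e assume "e \<in> {{ls ! i, ls ! ((i + 1) mod length ls)} | i. i < length ls}"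
      then obtain i where i: "i < length ls" "e = {ls ! i, ls ! ((i + 1) mod length ls)}" by blast
      then have "e = {L (int i), L (int i + 1)}" unfolding L_def idx1 idx2[OF i(1)] by simp
      then show "e \<in> range (\<lambda>i. {L i, L (i + 1)})" by simp
    next
      fix e assume "e \<in> range (\<lambda>i. {L i, L (i + 1)})"
      then obtain i where "e = {L i, L (i + 1)}" by auto
      then show "e \<in> {{ls ! i, ls ! ((i + 1) mod length ls)} | i. i < length ls}"
        unfolding L_def idx1 using idx[of i] by blast
    qed
    then show "E = T \<union> range (\<lambda>i. {L i, L (i + 1)})" using E by simp
    fix x y Y i j
    assume side: "tree_side T x y Y" and i: "L i \<notin> Y" "L (i + 1) \<in> Y" and j: "L j \<notin> Y" "L (j + 1) \<in> Y"
    obtain p n where p: "{L i, p} \<in> T" "is_leaf T (L i)" "snd ((face_step \<rho> ^^ n) (L i, p)) = L (i + 1)"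
      "\<forall>k<n. \<not> is_leaf T (snd ((face_step \<rho> ^^ k) (L i, p)))" using step by blast
    obtain p' n' where p': "{L j, p'} \<in> T" "is_leaf T (L j)" "snd ((face_step \<rho> ^^ n') (L j, p')) = L (j + 1)"
      "\<forall>k<n'. \<not> is_leaf T (snd ((face_step \<rho> ^^ k) (L j, p')))" using step by blast
    obtain a where a: "a \<le> n" "(face_step \<rho> ^^ a) (L i, p) = (x, y)"
      using segment_crosses[OF G rot side p(1) i(1), of n] p i by auto
    obtain b where b: "b \<le> n'" "(face_step \<rho> ^^ b) (L j, p') = (x, y)"
      using segment_crosses[OF G rot side p'(1) j(1), of n'] p' j by auto
    have "L i = L j"
    proof (cases "a \<le> b")
      case True
      then show ?thesis using p p' a b by (intro segments_disjoint[OF G rot p(1,2) p'(1), of b a]) auto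
    next
      case False
      then have "L j = L i" using p p' a b by (intro segments_disjoint[OF G rot p'(1,2) p(1), of a b]) auto
      then show ?thesis by simp
    qed
    then show "i mod m = j mod m" by (simp add: Leq)
  qed
  then show thesis by (rule that)
qed

definition leaf_parent :: "'a set set \<Rightarrow> 'a \<Rightarrow> 'a" where
  "leaf_parent T l = (THE p. nbrs T l = {p})"

lemma int_first_entry:
  fixes a b :: int
  assumes "a < b" "\<not> Q a" "Q b"
  obtains t where "a \<le> t" "t < b" "\<not> Q t" "Q (t + 1)"
proof -
  have "\<exists>t. a \<le> t \<and> t < b \<and> \<not> Q t \<and> Q (t + 1)"
    using assms
  proof (induction b rule: int_gr_induct)
    case (step b)
    show ?case
    proof (cases "Q b")
      case True
      then obtain t where "a \<le> t" "t < b" "\<not> Q t" "Q (t + 1)" using step by blast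
      then show ?thesis by (intro exI[of _ t]) simp
    next
      case False
      then show ?thesis using step by (intro exI[of _ b]) simp
    qed
  qed (auto intro: exI[of _ a])
  then show thesis using that by blast
qed

section \<open>Combinatorics of the leaf cycle\<close>

context leaf_cycle
begin

abbreviation P :: "int \<Rightarrow> 'a" where "P i \<equiv> leaf_parent T (L i)"

lemmas simple_T = tree_simple[OF tree] and connected_T = tree_connected[OF tree]

lemma finite_V: "finite V" using simple_T by (simp add: simple_graph_def)

lemma L_leaf: "is_leaf T (L i)" and L_in: "L i \<in> V"
  using leaves by (metis (mono_tags, lifting) mem_Collect_eq rangeI)+

lemma leaf_obtain: "is_leaf T v \<Longrightarrow> v \<in> V \<Longrightarrow> \<exists>i. v = L i"
  using leaves by (metis (mono_tags, lifting) imageE mem_Collect_eq)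

lemma L_eq_dvd: "L i = L j \<longleftrightarrow> m dvd (i - j)"
  using L_eq by (simp add: mod_eq_dvd_iff)

lemma L_cong: "L i = L j \<Longrightarrow> L (i + k) = L (j + k)"
  by (simp add: L_eq_dvd)

lemma L_neq: "i \<noteq> j \<Longrightarrow> \<bar>i - j\<bar> < m \<Longrightarrow> L i \<noteq> L j"
  unfolding L_eq_dvd using dvd_imp_le_int[of "i - j" m] by auto

lemma L_period: "L (i + m) = L i" by (simp add: L_eq_dvd)

lemma L_reduce: "\<exists>t. 0 \<le> t \<and> t < m \<and> L i = L (s + t)"
  by (rule exI[of _ "(i - s) mod m"])
     (use m_pos in \<open>simp add: L_eq mod_add_right_eq\<close>)

lemma range_L: "range L = (\<lambda>t. L (s + t)) ` {0..<m}"
  using L_reduce[of _ s] by force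

lemma card_leaves: "card (range L) = nat m"
proof -
  have "inj_on (\<lambda>t. L (0 + t)) {0..<m}"
  proof (rule inj_onI)
    fix x y assume "x \<in> {0..<m}" "y \<in> {0..<m}" "L (0 + x) = L (0 + y)"
    moreover from this have "\<bar>x - y\<bar> < m" by auto
    ultimately show "x = y" using L_neq[of x y] by auto
  qed
  then show ?thesis using range_L[of 0] by (simp add: card_image)
qed

lemma nbrs_T_nonempty:
  assumes "v \<in> V" shows "nbrs T v \<noteq> {}"
proof
  assume em: "nbrs T v = {}"
  have "V \<subseteq> {v}"
    by (rule connected_graph_closed[OF connected_T assms])
       (use em in \<open>auto simp: nbrs_def insert_commute\<close>)
  then obtain "deg T v \<ge> 3" using branching by auto
  then show False using em by (simp add: deg_def)
qed

lemma deg_T_ge1: "v \<in> V \<Longrightarrow> deg T v \<ge> 1"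
  using nbrs_T_nonempty finite_nbrs[OF simple_T] by (simp add: deg_def Suc_le_eq card_gt_0_iff)

lemma deg_internal: "v \<in> V \<Longrightarrow> \<not> is_leaf T v \<Longrightarrow> deg T v \<ge> 2"
  using deg_T_ge1[of v] by (simp add: is_leaf_def)

text \<open>The sum over the whole tree is -2 and each leaf contributes -1. Thus m - 2 is the whole
  branching available to the internal vertices, which leaves few shapes when m is small.\<close>

lemma degree_excess: "(\<Sum>v\<in>{v \<in> V. \<not> is_leaf T v}. int (deg T v) - 2) = m - 2"
proof -
  have "(\<Sum>v\<in>V. int (deg T v) - 2) = (\<Sum>v\<in>{v \<in> V. \<not> is_leaf T v}. int (deg T v) - 2) +
      (\<Sum>v\<in>{v \<in> V. is_leaf T v}. int (deg T v) - 2)"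
    using finite_V by (subst sum.union_disjoint[symmetric]) (auto intro: sum.cong)
  also have "(\<Sum>v\<in>{v \<in> V. is_leaf T v}. int (deg T v) - 2) = (\<Sum>v\<in>{v \<in> V. is_leaf T v}. -1)"
    by (intro sum.cong) (auto simp: is_leaf_def)
  also have "\<dots> = - m" using card_leaves m_pos by (simp add: leaves)
  finally show ?thesis using tree_degree_sum[OF tree] by simp
qed

lemma m_ge: "m \<ge> 3"
proof -
  obtain v where v: "v \<in> V" "deg T v \<ge> 3" using branching by auto
  then have "v \<in> {v \<in> V. \<not> is_leaf T v}" by (simp add: is_leaf_def)
  then have "int (deg T v) - 2 \<le> (\<Sum>v\<in>{v \<in> V. \<not> is_leaf T v}. int (deg T v) - 2)"
    using finite_V by (intro member_le_sum) (auto dest: deg_internal)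
  then show ?thesis using degree_excess v by linarith
qed

lemma nbrs_T_leaf: "nbrs T (L i) = {P i}"
proof -
  have "card (nbrs T (L i)) = 1" using L_leaf by (simp add: is_leaf_def deg_def)
  then obtain p where "nbrs T (L i) = {p}" by (auto simp: card_1_singleton_iff)
  then show ?thesis by (simp add: leaf_parent_def)
qed

lemma leaf_edge_iff: "{L i, u} \<in> T \<longleftrightarrow> u = P i"
proof -
  have "u \<in> nbrs T (L i) \<longleftrightarrow> u = P i" by (simp add: nbrs_T_leaf)
  then show ?thesis by (simp add: nbrs_def insert_commute)
qed

lemma leaf_edge_iff': "{u, L i} \<in> T \<longleftrightarrow> u = P i"
  using leaf_edge_iff[of i u] by (simp add: insert_commute)

lemma leaf_edge: "{L i, P i} \<in> T" "{P i, L i} \<in> T"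
  by (simp_all add: leaf_edge_iff leaf_edge_iff')

lemma P_in: "P i \<in> V" and P_neq_L: "P i \<noteq> L i"
  using edge_verts[OF simple_T leaf_edge(1)[of i]] by auto

text \<open>Two adjacent leaves would form a component by themselves and leave no branching
  vertex.\<close>

lemma P_internal: "\<not> is_leaf T (P i)"
proof
  assume "is_leaf T (P i)"
  then obtain j where j: "P i = L j" using leaf_obtain P_in by blast
  have "{L j, L i} \<in> T" using leaf_edge(2)[of i] by (simp add: j)
  then have ij: "L i = P j" by (simp add: leaf_edge_iff)
  have "V \<subseteq> {L i, L j}"
  proof (rule connected_graph_closed[OF connected_T, of "L i"])
    fix a b assume "a \<in> {L i, L j}" "{a, b} \<in> T"
    then have "b = P i \<or> b = P j" using leaf_edge_iff by auto
    then have "b = L j \<or> b = L i" unfolding j ij[symmetric] .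
    then show "b \<in> {L i, L j}" by blast
  qed (auto simp: L_in)
  then have "deg T v \<le> 1" if "v \<in> V" for v using that L_leaf by (auto simp: is_leaf_def)
  then show False using branching by force
qed

lemma P_neq: "P i \<noteq> L j" using P_internal L_leaf by metis

lemma E_iff: "{u, v} \<in> E \<longleftrightarrow> {u, v} \<in> T \<or> (\<exists>i. {u, v} = {L i, L (i + 1)})"
  by (auto simp: E_def)

lemma E_edge_cases: "{u, v} \<in> E \<Longrightarrow> {u, v} \<in> T \<or> is_leaf T u \<and> is_leaf T v"
  unfolding E_iff by (auto simp: doubleton_eq_iff L_leaf)

lemma T_sub_E: "{u, v} \<in> T \<Longrightarrow> {u, v} \<in> E" by (simp add: E_def)

lemma rim_edge: "{L i, L (i + 1)} \<in> E" by (auto simp: E_def)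

lemma nbrs_E_internal: "\<not> is_leaf T v \<Longrightarrow> nbrs E v = nbrs T v"
  using E_edge_cases[of _ v] T_sub_E[of _ v] by (auto simp: nbrs_def)

lemma nbrs_E_leaf: "nbrs E (L i) = {P i, L (i - 1), L (i + 1)}"
proof (intro set_eqI iffI)
  fix u assume "u \<in> nbrs E (L i)"
  then consider "{u, L i} \<in> T" | j where "{u, L i} = {L j, L (j + 1)}"
    by (auto simp: nbrs_def E_iff)
  then show "u \<in> {P i, L (i - 1), L (i + 1)}"
  proof cases
    case (2 j)
    then have "u = L j \<and> L i = L (j + 1) \<or> u = L (j + 1) \<and> L i = L j" by (auto simp: doubleton_eq_iff)
    then show ?thesis using L_cong[of i "j + 1" "-1"] L_cong[of i j 1] by auto
  qed (simp add: leaf_edge_iff')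
next
  fix u assume "u \<in> {P i, L (i - 1), L (i + 1)}"
  then show "u \<in> nbrs E (L i)"
    using T_sub_E[OF leaf_edge(2)] rim_edge[of i] rim_edge[of "i - 1"]
    by (auto simp: nbrs_def insert_commute)
qed

lemma simple_E: "simple_graph V E"
proof -
  have "L i \<noteq> L (i + 1)" for i using m_ge by (intro L_neq) auto
  then show ?thesis using simple_T L_in unfolding simple_graph_def E_def by blast
qed

lemma connected_E: "connected_graph V E"
proof -
  have "is_walk E xs" if "is_walk T xs" for xs using that by (auto simp: is_walk_def E_def)
  then show ?thesis using connected_T unfolding connected_graph_def by blast
qed

lemma deg_E_leaf: "deg E (L i) = 3"
proof -
  have "L (i - 1) \<noteq> L (i + 1)" using m_ge by (intro L_neq) auto
  then show ?thesis using P_neq by (auto simp: deg_def nbrs_E_leaf)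
qed

lemma internal_edge_E_iff: "\<not> is_leaf T u \<or> \<not> is_leaf T v \<Longrightarrow> {u, v} \<in> E \<longleftrightarrow> {u, v} \<in> T"
  using E_edge_cases[of u v] T_sub_E[of u v] by blast

text \<open>Lets every statement about leaf i + 1 be reflected to one about leaf i - 1. Read
  backwards, entering Y becomes leaving it, that is entering the complement of Y, which is the other
  side of the same edge.\<close>

lemma leaf_cycle_rev: "leaf_cycle V T E (\<lambda>i. L (- i)) m"
proof
  show "is_tree V T" "\<exists>v\<in>V. 3 \<le> deg T v" "0 < m" using tree branching m_pos .
  show "(L (- i) = L (- j)) = (i mod m = j mod m)" for i j
    unfolding L_eq_dvd mod_eq_dvd_iff by (simp add: dvd_diff_commute)
  have r: "range (\<lambda>i. g (- i)) = range g" for g :: "int \<Rightarrow> 'b"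
    by (metis (mono_tags, lifting) add.inverse_inverse image_eqI rangeI subsetI subset_antisym image_subset_iff)
  show "range (\<lambda>i. L (- i)) = {v \<in> V. is_leaf T v}" using r[of L] leaves by simp
  have "range (\<lambda>i. {L (- i), L (- (i + 1))}) = range (\<lambda>i. {L i, L (i + 1)})"
  proof (intro set_eqI iffI)
    fix e assume "e \<in> range (\<lambda>i. {L (- i), L (- (i + 1))})"
    then obtain i where "e = {L (- i), L (- (i + 1))}" by auto
    then have "e = {L (- i - 1), L (- i - 1 + 1)}" by (simp add: insert_commute)
    then show "e \<in> range (\<lambda>i. {L i, L (i + 1)})" by blast
  next
    fix e assume "e \<in> range (\<lambda>i. {L i, L (i + 1)})"
    then obtain i where "e = {L i, L (i + 1)}" by auto
    then have "e = {L (- (- i - 1)), L (- ((- i - 1) + 1))}" by (simp add: insert_commute add.commute)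
    then show "e \<in> range (\<lambda>i. {L (- i), L (- (i + 1))})" by blast
  qed
  then show "E = T \<union> range (\<lambda>i. {L (- i), L (- (i + 1))})" using E_def by simp
  fix x y Y i j
  assume side: "tree_side T x y Y" and i: "L (- i) \<notin> Y" "L (- (i + 1)) \<in> Y"
    and j: "L (- j) \<notin> Y" "L (- (j + 1)) \<in> Y"
  have "(- (i + 1)) mod m = (- (j + 1)) mod m"
    using i j L_in by (intro enter_once[OF tree_side_compl[OF tree side]]) auto
  then have "L (- (i + 1)) = L (- (j + 1))" by (simp add: L_eq)
  then show "i mod m = j mod m" unfolding mod_eq_dvd_iff L_eq_dvd by (simp add: dvd_diff_commute)
qed

text \<open>The cut edge has two internal ends, so it is not the edge between a leaf and its
  parent.\<close>

lemma leaf_side_iff: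
  assumes "tree_side T x y Y" "\<not> is_leaf T x" "\<not> is_leaf T y"
  shows "L t \<in> Y \<longleftrightarrow> P t \<in> Y"
  using assms leaf_edge[of t] L_leaf[of t] unfolding tree_side_def by blast

text \<open>The planarity statement that the rest relies on. Cut the tree with b, c inside Y and a
  outside: the leaf cycle would enter Y once between j and k and once more between r and i + m, at
  indices that are not congruent modulo m.\<close>

lemma no_alternation:
  assumes ijkr: "i < j" "j < k" "k < r" "r < i + m"
    and bc: "P i \<in> {b, c}" "P k \<in> {b, c}" and a: "P j = a" "P r = a" "a \<notin> {b, c}"
    and adj: "b = c \<or> {b, c} \<in> T" "\<not> is_leaf T b" "\<not> is_leaf T c"
  shows False
proof -
  have "b \<in> V" using adj(1) bc(1) P_in[of i] edge_verts[OF simple_T, of b c] by auto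
  moreover have "a \<in> V" "a \<noteq> b" "a \<noteq> c" "\<not> is_leaf T a" using a P_in[of j] P_internal[of j] by auto
  ultimately obtain x y Y where Y: "tree_side T x y Y" "b \<in> Y" "c \<in> Y" "a \<notin> Y"
      "\<not> is_leaf T x" "\<not> is_leaf T y"
    using adj by (elim tree_separate[OF tree, of a b c])
  note side = leaf_side_iff[OF Y(1,5,6)]
  have bcY: "z \<in> Y" if "z \<in> {b, c}" for z using that Y(2,3) by auto
  have "P k \<in> Y" "P i \<in> Y" using bcY[OF bc(1)] bcY[OF bc(2)] by simp_all
  then have "L j \<notin> Y" "L k \<in> Y" "L r \<notin> Y" "L (i + m) \<in> Y"
    unfolding L_period side a(1,2) using Y(4) by simp_all
  note ent = this
  obtain t where t: "j \<le> t" "t < k" "L t \<notin> Y" "L (t + 1) \<in> Y"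
    using int_first_entry[of j k "\<lambda>t. L t \<in> Y", OF ijkr(2) ent(1,2)] .
  obtain t' where t': "r \<le> t'" "t' < i + m" "L t' \<notin> Y" "L (t' + 1) \<in> Y"
    using int_first_entry[of r "i + m" "\<lambda>t. L t \<in> Y", OF ijkr(4) ent(3,4)] .
  have "L t = L t'" using enter_once[OF Y(1) t(3,4) t'(3,4)] by (simp add: L_eq)
  moreover have "L t \<noteq> L t'" using t t' ijkr by (intro L_neq) auto
  ultimately show False by simp
qed

lemma no_alternation_eq:
  assumes ijkr: "i < j" "j < k" "k < r" "r < i + m" and "P i = P k" "P j = P r"
  shows "P i = P j"
proof (rule ccontr)
  assume "P i \<noteq> P j"
  then show False
    using P_internal[of i] assms(5)[symmetric] assms(6)[symmetric]
    by (intro no_alternation[OF ijkr, of "P i" "P i" "P j"]) simp_all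
qed

lemma no_alternation_adjacent:
  assumes ijkr: "i < j" "j < k" "k < r" "r < i + m" and "P j = P r" "{P i, P k} \<in> T"
  shows "P i = P j \<or> P k = P j"
proof (rule ccontr)
  assume neg: "\<not> ?thesis"
  then show False
    using P_internal[of i] P_internal[of k] assms(5)[symmetric] assms(6)
    by (intro no_alternation[OF ijkr, of "P i" "P k" "P j"]) auto
qed

text \<open>Both sides of a tree edge contain leaves, so the leaf cycle has to enter Y
  somewhere.\<close>

lemma crossing_exists:
  assumes "{x, y} \<in> T"
  obtains i Y where "tree_side T x y Y" "L i \<notin> Y" "L (i + 1) \<in> Y"
proof -
  obtain Y where Y: "tree_side T x y Y" "Y \<subseteq> V" "\<exists>v\<in>Y. is_leaf T v"
    using tree_side_exists[OF tree assms] .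
  obtain X where X: "tree_side T y x X" "X \<subseteq> V" "\<exists>v\<in>X. is_leaf T v"
    using tree_side_exists[OF tree assms[unfolded insert_commute[of x y]]] .
  have disj: "X \<inter> Y = {}" using tree_side_disjoint[OF tree Y(1,2) X(1)] .
  obtain u v where uv: "u \<in> X" "is_leaf T u" "v \<in> Y" "is_leaf T v" using X(3) Y(3) by blast
  obtain i j where "u = L i" "v = L j" using uv X(2) Y(2) leaf_obtain[of u] leaf_obtain[of v] by blast
  then have ij: "L i \<notin> Y" "L j \<in> Y" using uv disj by auto
  obtain t where t: "0 \<le> t" "t < m" "L j = L (i + t)" using L_reduce by blast
  have "t \<noteq> 0" using ij t(3) by auto
  then have "i < i + t" "L (i + t) \<in> Y" using t ij by auto
  then obtain k where "L k \<notin> Y" "L (k + 1) \<in> Y"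
    using int_first_entry[of i "i + t" "\<lambda>t. L t \<in> Y"] ij(1) by auto
  then show thesis using that Y(1) by simp
qed

lemma tree_triangle:
  assumes "{x, y} \<in> T" "{y, w} \<in> T" "w \<noteq> x"
  shows "{x, w} \<notin> T"
proof
  assume xw: "{x, w} \<in> T"
  obtain Y where Y: "tree_side T x y Y" using tree_side_exists[OF tree assms(1)] by metis
  have wy: "w \<noteq> y" using edge_verts[OF simple_T assms(2)] by auto
  have "w \<in> Y" using Y assms unfolding tree_side_def by blast
  then show False using Y xw wy unfolding tree_side_def by (metis insert_commute)
qed

text \<open>The vertices u, x, y, w form a path in a tree, so its ends are at distance 3: w lies in
  the side of y, u outside, and xy is the only edge across.\<close>

lemma tree_path4:
  assumes "{x, y} \<in> T" "{y, w} \<in> T" "w \<noteq> x" "{x, u} \<in> T" "u \<noteq> y"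
  shows "u \<noteq> w" "{u, w} \<notin> T" "nbrs T u \<inter> nbrs T w = {}"
proof -
  obtain Y where Y: "tree_side T x y Y" using tree_side_exists[OF tree assms(1)] by metis
  have wy: "w \<noteq> y" using edge_verts[OF simple_T assms(2)] by auto
  have w: "w \<in> Y" using Y assms unfolding tree_side_def by blast
  have u: "u \<notin> Y" using Y assms unfolding tree_side_def by (metis insert_commute)
  show "u \<noteq> w" using u w by auto
  show "{u, w} \<notin> T" using Y u w wy unfolding tree_side_def by (metis insert_commute)
  show "nbrs T u \<inter> nbrs T w = {}"
  proof (rule ccontr)
    assume "nbrs T u \<inter> nbrs T w \<noteq> {}"
    then obtain z where z: "{z, u} \<in> T" "{z, w} \<in> T" "{w, z} \<in> T" by (auto simp: nbrs_def insert_commute)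
    have "z \<in> Y" using Y w z wy unfolding tree_side_def by blast
    then have "z = y" "u = x" using Y z u unfolding tree_side_def by blast+
    then show False using edge_verts[OF simple_T assms(4)] by simp
  qed
qed

end

section \<open>Consequences of positive curvature\<close>

locale positive_halin = leaf_cycle +
  assumes pos: "{u, v} \<in> E \<Longrightarrow> kappa_LLY V E u v > 0"
begin

lemma positive_halin_rev: "positive_halin V T E (\<lambda>i. L (- i)) m"
  using leaf_cycle_rev pos by (simp add: positive_halin_def positive_halin_axioms_def)

lemmas test = curvature_test[OF simple_E connected_E _ pos]

text \<open>Give w, y, x, u the values 2, 1, 0, -1 and all other vertices 0: both sums in the test
  vanish, which positivity forbids. So u cannot be at distance 3 from w. In the tree it is, hence
  their common neighbour z must be reached from u by a rim edge, which makes u and z leaves.\<close>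

lemma degree2_far_internal:
  assumes x: "\<not> is_leaf T x" and y: "\<not> is_leaf T y" "nbrs T y = {x, w}" "w \<noteq> x"
    and w: "\<not> is_leaf T w" and u: "u \<in> nbrs T x" "u \<noteq> y"
  shows "is_leaf T u \<and> (\<exists>z. is_leaf T z \<and> {z, w} \<in> T \<and> {u, z} \<in> E)"
proof (rule ccontr)
  assume neg: "\<not> ?thesis"
  have xy: "{x, y} \<in> T" and yw: "{y, w} \<in> T" and xu: "{x, u} \<in> T"
    using y u by (auto simp: nbrs_def insert_commute)
  have nx: "nbrs E x = nbrs T x" and ny: "nbrs E y = {x, w}"
    using x y by (auto simp: nbrs_E_internal)
  note path = tree_path4[OF xy yw y(3)]
  have xV: "x \<noteq> y" "y \<noteq> w" "x \<noteq> u" using edge_verts[OF simple_T] xy yw xu by auto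
  have yx: "y \<in> nbrs T x" using xy by (simp add: nbrs_def insert_commute)
  have nbr_x: "v \<noteq> w \<and> v \<noteq> x \<and> {v, w} \<notin> E \<and> {v, y} \<notin> E" if v: "v \<in> nbrs T x" "v \<noteq> y" for v
  proof -
    have xv: "{x, v} \<in> T" using v by (simp add: nbrs_def insert_commute)
    have "{v, w} \<notin> E" using path(2)[OF xv v(2)] w internal_edge_E_iff by blast
    moreover have "v \<noteq> x" using edge_verts[OF simple_T xv] by auto
    moreover have "v \<noteq> w" using path(1)[OF xv v(2)] .
    moreover have "v \<notin> nbrs E y" using ny calculation by simp
    ultimately show ?thesis by (simp add: nbrs_def)
  qed
  have far: "nbrs E u \<inter> nbrs E w = {}"
  proof (rule ccontr)
    assume "nbrs E u \<inter> nbrs E w \<noteq> {}"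
    then obtain z where z: "{z, u} \<in> E" "z \<in> nbrs T w"
      unfolding nbrs_E_internal[OF w] by (auto simp: nbrs_def)
    then have "{z, u} \<notin> T" using path(3)[OF xu u(2)] by (auto simp: nbrs_def)
    then have "is_leaf T z" "is_leaf T u" using E_edge_cases[OF z(1)] by auto
    then show False using neg z by (auto simp: nbrs_def insert_commute)
  qed
  define f :: "'a \<Rightarrow> int" where "f v = (if v = w then 2 else if v = y then 1 else if v = u then -1 else 0)" for v
  have f: "f w = 2" "f y = 1" "f u = -1" "f x = 0" using xV y(3) u nbr_x[OF u] by (auto simp: f_def)
  have "int (deg E x) * (\<Sum>w\<in>nbrs E y. f w - f y) < int (deg E y) * (\<Sum>u\<in>nbrs E x. f u - f x)"
  proof (rule test)
    show "{x, y} \<in> E" "{x, y} \<in> E" using xy T_sub_E by auto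
    show "f y = f x + 1" using f by simp
    fix a b assume a: "a \<in> insert x (nbrs E x)" and b: "b \<in> insert y (nbrs E y)"
    have b': "b = x \<or> b = y \<or> b = w" using b ny by auto
    have xw: "{x, w} \<notin> E" using tree_triangle[OF xy yw y(3)] internal_edge_E_iff x by blast
    have a': "a = x \<or> a = y \<or> a = u \<or> (a \<in> nbrs T x \<and> a \<noteq> y \<and> a \<noteq> u \<and> f a = 0)"
      using a nx nbr_x[of a] by (auto simp: f_def)
    show "(f b > f a \<longrightarrow> a \<noteq> b) \<and> (f b > f a + 1 \<longrightarrow> {a, b} \<notin> E) \<and>
      (f b > f a + 2 \<longrightarrow> nbrs E a \<inter> nbrs E b = {}) \<and> f b \<le> f a + 3"
      using a' b' f far nbr_x[of a] nbr_x[OF u] xw xV y(3) by auto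
  qed
  moreover have "(\<Sum>v\<in>nbrs E y. f v - f y) = 0" using y(3) ny f by simp
  moreover have "(\<Sum>v\<in>nbrs E x. f v - f x) = 0"
  proof -
    have fin: "finite (nbrs T x)" using finite_nbrs[OF simple_T] .
    have "(\<Sum>v\<in>nbrs T x. f v) = (\<Sum>v\<in>{y, u}. f v)"
      using fin yx u nbr_x by (intro sum.mono_neutral_right) (auto simp: f_def)
    then show ?thesis using f u(2) nx by simp
  qed
  ultimately show False by simp
qed

text \<open>Give y and w the value 1, x the value 0 and the other d - 1 neighbours of x the value
  -1. The test then reads -d < 2 (2 - d), that is d < 4. The potential fails to be admissible only
  if w is adjacent to another neighbour of x, and such an edge must lie on the rim.\<close>

lemma degree2_large_hub:
  assumes x: "\<not> is_leaf T x" "deg T x \<ge> 4" and y: "\<not> is_leaf T y" "nbrs T y = {x, w}" "w \<noteq> x"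
  shows "\<exists>u\<in>nbrs T x - {y}. {u, w} \<in> E \<and> is_leaf T u \<and> is_leaf T w"
proof (rule ccontr)
  assume neg: "\<not> ?thesis"
  have xy: "{x, y} \<in> T" and yw: "{y, w} \<in> T"
    using y by (auto simp: nbrs_def insert_commute)
  have nx: "nbrs E x = nbrs T x" and ny: "nbrs E y = {x, w}"
    using x y by (auto simp: nbrs_E_internal)
  note path = tree_path4[OF xy yw y(3)]
  have xV: "x \<noteq> y" "y \<noteq> w" using edge_verts[OF simple_T] xy yw by auto
  have yx: "y \<in> nbrs T x" using xy by (simp add: nbrs_def insert_commute)
  have nbr_x: "v \<noteq> w \<and> v \<noteq> x \<and> {v, w} \<notin> E \<and> {v, y} \<notin> E" if v: "v \<in> nbrs T x" "v \<noteq> y" for v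
  proof -
    have xv: "{x, v} \<in> T" using v by (simp add: nbrs_def insert_commute)
    have "{v, w} \<notin> E" using path(2)[OF xv v(2)] neg v E_edge_cases by blast
    moreover have "v \<noteq> x" using edge_verts[OF simple_T xv] by auto
    moreover have "v \<noteq> w" using path(1)[OF xv v(2)] .
    moreover have "v \<notin> nbrs E y" using ny calculation by simp
    ultimately show ?thesis by (simp add: nbrs_def)
  qed
  define f :: "'a \<Rightarrow> int" where "f v = (if v = w \<or> v = y then 1 else if v = x then 0 else -1)" for v
  have f: "f w = 1" "f y = 1" "f x = 0" using xV y(3) by (auto simp: f_def)
  have "int (deg E x) * (\<Sum>w\<in>nbrs E y. f w - f y) < int (deg E y) * (\<Sum>u\<in>nbrs E x. f u - f x)"
  proof (rule test)
    show "{x, y} \<in> E" "{x, y} \<in> E" using xy T_sub_E by auto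
    show "f y = f x + 1" using f by simp
    fix a b assume a: "a \<in> insert x (nbrs E x)" and b: "b \<in> insert y (nbrs E y)"
    have a': "a = x \<or> a = y \<or> (a \<in> nbrs T x \<and> a \<noteq> y \<and> f a = -1)"
      using a nx nbr_x[of a] by (auto simp: f_def)
    have b': "b = x \<or> b = y \<or> b = w" using b ny by auto
    show "(f b > f a \<longrightarrow> a \<noteq> b) \<and> (f b > f a + 1 \<longrightarrow> {a, b} \<notin> E) \<and>
      (f b > f a + 2 \<longrightarrow> nbrs E a \<inter> nbrs E b = {}) \<and> f b \<le> f a + 3"
      using a' b' f nbr_x[of a] by auto
  qed
  moreover have "(\<Sum>v\<in>nbrs E y. f v - f y) = -1" using y(3) ny f by simp
  moreover have "(\<Sum>v\<in>nbrs E x. f v - f x) = 2 - int (deg T x)"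
  proof -
    have fin: "finite (nbrs T x)" using finite_nbrs[OF simple_T] .
    have "(\<Sum>v\<in>nbrs T x. f v) = f y + (\<Sum>v\<in>nbrs T x - {y}. f v)"
      using fin yx by (simp add: sum.remove)
    also have "(\<Sum>v\<in>nbrs T x - {y}. f v) = (\<Sum>v\<in>nbrs T x - {y}. -1)"
      using nbr_x by (intro sum.cong) (auto simp: f_def)
    also have "\<dots> = 1 - int (deg T x)" using fin yx x(2) by (simp add: deg_def of_nat_diff)
    finally show ?thesis using f nx by simp
  qed
  moreover have "deg E x = deg T x" "deg E y = 2" using x y nx ny by (auto simp: deg_def)
  ultimately show False using x(2) by simp
qed

text \<open>Two potentials, both extending 0 at x and 1 at y. The first has -1 at both
  \<open>u\<close> and 1 at both \<open>w\<close>, and is admissible when no rim edge joins them.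
  The second has 0, -1 at \<open>u1\<close>, \<open>u2\<close> and 1, 2 at \<open>w1\<close>,
  \<open>w2\<close>; it is admissible when \<open>u2\<close> and \<open>w2\<close> are internal, for
  then they keep their tree distance 3.\<close>

lemma cubic_edge:
  assumes x: "\<not> is_leaf T x" "nbrs T x = {y, u1, u2}" "distinct [y, u1, u2]"
    and y: "\<not> is_leaf T y" "nbrs T y = {x, w1, w2}" "distinct [x, w1, w2]"
  shows "\<exists>u\<in>{u1, u2}. \<exists>w\<in>{w1, w2}. {u, w} \<in> E" and "is_leaf T u2 \<or> is_leaf T w2"
proof -
  have xy: "{x, y} \<in> T" using x by (auto simp: nbrs_def insert_commute)
  have u: "{x, u1} \<in> T" "{x, u2} \<in> T" and w: "{y, w1} \<in> T" "{y, w2} \<in> T"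
    using x y by (auto simp: nbrs_def insert_commute)
  have nx: "nbrs E x = {y, u1, u2}" and ny: "nbrs E y = {x, w1, w2}"
    using x y by (auto simp: nbrs_E_internal)
  have dg: "deg E x = 3" "deg E y = 3" using nx ny x(3) y(3) by (auto simp: deg_def)
  have ux: "u1 \<noteq> x" "u2 \<noteq> x" "w1 \<noteq> y" "w2 \<noteq> y" "x \<noteq> y"
    using edge_verts[OF simple_T] u w xy by auto
  have uw: "u \<noteq> w" "{u, w} \<notin> T" "nbrs T u \<inter> nbrs T w = {}" if "u \<in> {u1, u2}" "w \<in> {w1, w2}" for u w
    using tree_path4[of x y w u] xy u w that x(3) y(3) by auto
  have wx: "w1 \<noteq> x" "w2 \<noteq> x" "u1 \<noteq> y" "u2 \<noteq> y" "u2 \<noteq> u1" "w2 \<noteq> w1" using x(3) y(3) by auto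
  have uw_ne: "u1 \<noteq> w1" "u1 \<noteq> w2" "u2 \<noteq> w1" "u2 \<noteq> w2" using uw(1) by blast+
  have ux': "{u, y} \<notin> E" if "u \<in> {u1, u2}" for u
  proof -
    have "u \<notin> nbrs E y" using ny uw[OF that] that ux by auto
    then show ?thesis by (simp add: nbrs_def)
  qed
  have wx': "{x, w} \<notin> E" if "w \<in> {w1, w2}" for w
  proof -
    have "w \<notin> nbrs E x" using nx uw[OF _ that] that ux by auto
    then show ?thesis by (simp add: nbrs_def insert_commute)
  qed
  \<comment> \<open>The degrees are both 3 and cancel; 4 collects the base values 1 + 1 at y and the
    two contributions of the edge xy.\<close>
  have gen: "f w1 + f w2 < f u1 + f u2 + 4"
    if f: "f x = 0" "f y = 1" "\<And>u. u \<in> {u1, u2} \<Longrightarrow> f u \<ge> -1 \<and> f u \<le> 0"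
      "\<And>w. w \<in> {w1, w2} \<Longrightarrow> f w \<ge> 1 \<and> f w \<le> 2"
      and d: "\<And>u w. u \<in> {u1, u2} \<Longrightarrow> w \<in> {w1, w2} \<Longrightarrow>
       (f w > f u + 1 \<longrightarrow> {u, w} \<notin> E) \<and> (f w > f u + 2 \<longrightarrow> nbrs E u \<inter> nbrs E w = {})"
    for f :: "'a \<Rightarrow> int"
  proof -
    have "int (deg E x) * (\<Sum>w\<in>nbrs E y. f w - f y) < int (deg E y) * (\<Sum>u\<in>nbrs E x. f u - f x)"
    proof (rule test)
      show "{x, y} \<in> E" "{x, y} \<in> E" using xy T_sub_E by auto
      show "f y = f x + 1" using f by simp
      fix a b assume a: "a \<in> insert x (nbrs E x)" and b: "b \<in> insert y (nbrs E y)"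
      have a': "a = x \<or> a = y \<or> a \<in> {u1, u2}" using a nx by auto
      have b': "b = x \<or> b = y \<or> b \<in> {w1, w2}" using b ny by auto
      show "(f b > f a \<longrightarrow> a \<noteq> b) \<and> (f b > f a + 1 \<longrightarrow> {a, b} \<notin> E) \<and>
        (f b > f a + 2 \<longrightarrow> nbrs E a \<inter> nbrs E b = {}) \<and> f b \<le> f a + 3"
      proof (cases "a \<in> {u1, u2}")
        case True
        show ?thesis
        proof (cases "b \<in> {w1, w2}")
          case bT: True
          show ?thesis using d[OF True bT] uw(1)[OF True bT] f(3)[OF True] f(4)[OF bT] by auto
        next
          case False
          then have "b = x \<or> b = y" using b' by auto
          then show ?thesis using f(1,2) f(3)[OF True] ux'[OF True] by auto
        qed
      next
        case False
        then have ax: "a = x \<or> a = y" using a' by auto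
        show ?thesis
        proof (cases "b \<in> {w1, w2}")
          case bT: True
          show ?thesis using ax f(1,2) f(4)[OF bT] wx'[OF bT] y(3) ux bT by auto
        next
          case False
          then have "b = x \<or> b = y" using b' by auto
          then show ?thesis using ax f(1,2) ux by auto
        qed
      qed
    qed
    then show ?thesis using x(3) y(3) nx ny dg f(1,2) by simp
  qed
  show "\<exists>u\<in>{u1, u2}. \<exists>w\<in>{w1, w2}. {u, w} \<in> E"
  proof (rule ccontr)
    assume neg: "\<not> ?thesis"
    define f :: "'a \<Rightarrow> int" where "f v = (if v = u1 \<or> v = u2 then -1 else if v = x then 0 else 1)" for v
    have f: "f u1 = -1" "f u2 = -1" "f x = 0" "f y = 1" "f w1 = 1" "f w2 = 1"
      using ux ux[symmetric] x(3) y(3) wx uw_ne uw_ne[symmetric] by (simp_all add: f_def)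
    have "f w1 + f w2 < f u1 + f u2 + 4" using f neg by (intro gen) auto
    then show False using f by simp
  qed
  show "is_leaf T u2 \<or> is_leaf T w2"
  proof (rule ccontr)
    assume neg: "\<not> ?thesis"
    define f :: "'a \<Rightarrow> int" where "f v = (if v = u2 then -1 else if v = w2 then 2 else if v = x \<or> v = u1 then 0 else 1)" for v
    have f: "f u1 = 0" "f u2 = -1" "f x = 0" "f y = 1" "f w1 = 1" "f w2 = 2"
      using ux ux[symmetric] x(3) y(3) wx uw_ne uw_ne[symmetric] by (simp_all add: f_def)
    have d: "{u2, w1} \<notin> E" "{u2, w2} \<notin> E" "{u1, w2} \<notin> E" "nbrs E u2 \<inter> nbrs E w2 = {}"
      using neg internal_edge_E_iff[of u2 w1] internal_edge_E_iff[of u2 w2] internal_edge_E_iff[of u1 w2]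
        uw(2)[of u2 w1] uw(2)[of u2 w2] uw(2)[of u1 w2] uw(3)[of u2 w2]
        nbrs_E_internal[of u2] nbrs_E_internal[of w2] by simp_all
    have "f w1 + f w2 < f u1 + f u2 + 4" using f d by (intro gen) auto
    then show False using f by simp
  qed
qed

text \<open>The test for the rim edge from leaf i to leaf i + 1, with value 0 at the first and 1 at
  the second. The values a, b, c, d sit at \<open>L (i - 1)\<close>, \<open>P i\<close>,
  \<open>L (i + 2)\<close>, \<open>P (i + 1)\<close>. Both ends have degree 3, so positivity says
  that the two outer pairs together are less than 4 apart in potential. With five leaves the outer
  leaves are non-adjacent.\<close>

lemma rim_test:
  assumes m: "m \<ge> 5" and ne: "P i \<noteq> P (i + 1)"
    and bds: "a \<ge> -1" "b \<ge> -1" "c \<le> 2" "d \<le> (2::int)"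
    and ac: "c > a + 2 \<longrightarrow> nbrs E (L (i - 1)) \<inter> nbrs E (L (i + 2)) = {}"
    and bd: "d > b + 1 \<longrightarrow> {P i, P (i + 1)} \<notin> E" "d \<le> b + 2"
    and bc: "c > b + 1 \<longrightarrow> {P i, L (i + 2)} \<notin> E" "c \<le> b + 2"
    and ad: "d > a + 1 \<longrightarrow> {L (i - 1), P (i + 1)} \<notin> E"
      "d > a + 2 \<longrightarrow> nbrs E (L (i - 1)) \<inter> nbrs E (P (i + 1)) = {}"
  shows "c + d < a + b + 4"
proof -
  let ?la = "L (i - 1)" and ?lb = "L i" and ?lc = "L (i + 1)" and ?ld = "L (i + 2)"
    and ?p = "P i" and ?q = "P (i + 1)"
  have dl: "?la \<noteq> ?lb" "?la \<noteq> ?lc" "?la \<noteq> ?ld" "?lb \<noteq> ?lc" "?lb \<noteq> ?ld" "?lc \<noteq> ?ld"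
    using m L_neq[of "i - 1" i] L_neq[of "i - 1" "i + 1"] L_neq[of "i - 1" "i + 2"] L_neq[of i "i + 1"]
      L_neq[of i "i + 2"] L_neq[of "i + 1" "i + 2"] by simp_all
  have dp: "?p \<noteq> L j" "?q \<noteq> L j" "L j \<noteq> ?p" "L j \<noteq> ?q" for j using P_neq by metis+
  have nl: "nbrs E ?lb = {?p, ?la, ?lc}" using nbrs_E_leaf[of i] by simp
  have nl1: "nbrs E ?lc = {?q, ?lb, ?ld}" using nbrs_E_leaf[of "i + 1"] by (simp add: add.commute)
  have nadj: "{?la, ?lc} \<notin> E" "{?p, ?lc} \<notin> E" "{?lb, ?q} \<notin> E" "{?lb, ?ld} \<notin> E"
  proof -
    have "?la \<notin> nbrs E ?lc" "?p \<notin> nbrs E ?lc" "?q \<notin> nbrs E ?lb" "?ld \<notin> nbrs E ?lb"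
      using nl nl1 dl dp ne by auto
    then show "{?la, ?lc} \<notin> E" "{?p, ?lc} \<notin> E" "{?lb, ?q} \<notin> E" "{?lb, ?ld} \<notin> E"
      by (simp_all add: nbrs_def insert_commute)
  qed
  have l02: "{?la, ?ld} \<notin> E"
  proof -
    have "L (i - 1) \<noteq> L (i + 3)" using m by (intro L_neq) auto
    then have "?la \<notin> nbrs E ?ld" using nbrs_E_leaf[of "i + 2"] dl dp P_neq[of "i + 2" "i - 1"] by (auto simp: add.commute)
    then show ?thesis by (simp add: nbrs_def)
  qed
  define f :: "'a \<Rightarrow> int" where "f v = (if v = ?la then a else if v = ?p then b else if v = ?ld then c
    else if v = ?q then d else if v = ?lb then 0 else 1)" for v
  have f: "f ?la = a" "f ?p = b" "f ?ld = c" "f ?q = d" "f ?lb = 0" "f ?lc = 1"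
    using dl dp ne by (auto simp: f_def)
  have "int (deg E ?lb) * (\<Sum>w\<in>nbrs E ?lc. f w - f ?lc) < int (deg E ?lc) * (\<Sum>u\<in>nbrs E ?lb. f u - f ?lb)"
  proof (rule test)
    show "{?lb, ?lc} \<in> E" "{?lb, ?lc} \<in> E" by (rule rim_edge)+
    show "f ?lc = f ?lb + 1" using f by simp
    fix u w assume u: "u \<in> insert ?lb (nbrs E ?lb)" and w: "w \<in> insert ?lc (nbrs E ?lc)"
    have u': "u = ?lb \<or> u = ?p \<or> u = ?la \<or> u = ?lc" using u nl by auto
    have w': "w = ?lc \<or> w = ?q \<or> w = ?lb \<or> w = ?ld" using w nl1 by auto
    have c3: "c \<le> a + 3" "d \<le> a + 3" using bds by auto
    show "(f w > f u \<longrightarrow> u \<noteq> w) \<and> (f w > f u + 1 \<longrightarrow> {u, w} \<notin> E) \<and>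
      (f w > f u + 2 \<longrightarrow> nbrs E u \<inter> nbrs E w = {}) \<and> f w \<le> f u + 3"
      using u' w' bds ac bd bc ad nadj l02 c3 dl dp ne
      by (elim disjE; simp only: f; simp)
  qed
  moreover have "(\<Sum>w\<in>nbrs E ?lc. f w - f ?lc) = d + c - 3"
    using nl1 dl dp f by simp
  moreover have "(\<Sum>u\<in>nbrs E ?lb. f u - f ?lb) = b + a + 1"
    using nl dl dp f by simp
  ultimately show ?thesis by (simp add: deg_E_leaf)
qed

text \<open>In this configuration the crossed matching of the outer neighbours can be short, and planarity
  takes the place of the curvature argument.\<close>
lemma rim_return:
  assumes m: "m \<ge> 5" and ne: "P i \<noteq> P (i + 1)" and ret: "P i = P (i + 2)"
    and near: "P (i - 1) = P (i + 1) \<or> nbrs E (L (i - 1)) \<inter> nbrs E (P (i + 1)) \<noteq> {}"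
  shows "{P i, P (i + 1)} \<in> T \<and> P (i - 1) = P i"
proof -
  have no1: "P (i - 1) \<noteq> P (i + 1)"
    using no_alternation_eq[of "i - 1" i "i + 1" "i + 2"] m ne ret by fastforce
  have no2: "P (i - 2) \<noteq> P (i + 1)"
    using no_alternation_eq[of "i - 2" i "i + 1" "i + 2"] m ne ret by fastforce
  obtain z where z: "z \<in> nbrs E (L (i - 1))" "z \<in> nbrs T (P (i + 1))"
    using near no1 nbrs_E_internal[OF P_internal] by auto
  have "z = P (i - 1) \<or> z = L (i - 2) \<or> z = L i" using z(1) nbrs_E_leaf[of "i - 1"] by auto
  moreover have "z \<noteq> L (i - 2)" "z \<noteq> L i"
    using z(2) no2 ne by (auto simp: nbrs_def leaf_edge_iff)
  ultimately have adj: "{P (i - 1), P (i + 1)} \<in> T" using z(2) by (auto simp: nbrs_def)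
  have "P (i - 1) = P i"
    using no_alternation_adjacent[of "i - 1" i "i + 1" "i + 2"] m ne ret adj by fastforce
  then show ?thesis using adj by simp
qed

text \<open>Since \<open>P i\<close> is adjacent to \<open>L (i + 2)\<close>, the values at these
  two may differ by 1 only: 0 and 1. The loss is recovered with -1 at \<open>L (i - 1)\<close> and 2
  at \<open>P (i + 1)\<close>, which are at distance 3 by \<open>rim_return\<close> if the two
  parents are not adjacent.\<close>

lemma parents_adjacent_if_return:
  assumes m: "m \<ge> 5" and ne: "P i \<noteq> P (i + 1)" and ret: "P i = P (i + 2)"
  shows "{P i, P (i + 1)} \<in> T"
proof (rule ccontr)
  assume neg: "{P i, P (i + 1)} \<notin> T"
  then have far: "P (i - 1) \<noteq> P (i + 1)" "nbrs E (L (i - 1)) \<inter> nbrs E (P (i + 1)) = {}"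
    using rim_return[OF m ne ret] by auto
  have "(1::int) + 2 < -1 + 0 + 4"
    using neg far internal_edge_E_iff[of "P i" "P (i + 1)"] internal_edge_E_iff[of "L (i - 1)" "P (i + 1)"] P_internal
    by (intro rim_test[OF m ne]) (auto simp: leaf_edge_iff)
  then show False by simp
qed

text \<open>Without a return in either direction, no outer neighbour on the left is adjacent to one
  on the right, so the potential with -1 on the left pair and 1 on the right pair is admissible and
  attains the forbidden total 4.\<close>

lemma parents_adjacent:
  assumes m: "m \<ge> 5" and ne: "P i \<noteq> P (i + 1)"
  shows "{P i, P (i + 1)} \<in> T"
proof (rule ccontr)
  assume neg: "{P i, P (i + 1)} \<notin> T"
  have r1: "P i \<noteq> P (i + 2)" using parents_adjacent_if_return[OF m ne] neg by blast
  \<comment> \<open>The mirror image of \<open>r1\<close>, read off from the reversed cycle.\<close>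
  have r2: "P (i + 1) \<noteq> P (i - 1)"
  proof
    assume "P (i + 1) = P (i - 1)"
    then have "{P (i + 1), P i} \<in> T"
      using positive_halin.parents_adjacent_if_return[OF positive_halin_rev m, of "- (i + 1)"] ne by (simp add: add.commute)
    then show False using neg by (simp add: insert_commute)
  qed
  have "(1::int) + 1 < -1 + (-1) + 4"
    using neg r1 r2 internal_edge_E_iff[of "P i" "P (i + 1)"] internal_edge_E_iff[of "L (i - 1)" "P (i + 1)"]
      internal_edge_E_iff[of "P i" "L (i + 2)"] P_internal
    by (intro rim_test[OF m ne]) (auto simp: leaf_edge_iff leaf_edge_iff')
  then show False by simp
qed

text \<open>The outermost rim neighbours \<open>L (i - 2)\<close> and \<open>L (i + 3)\<close> are
  five steps apart, so six leaves are what it takes to separate them. Only a common parent remains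
  as a common neighbour.\<close>

lemma outer_parents_far:
  assumes m: "m \<ge> 6" and "P (i - 1) \<noteq> P (i + 2)"
  shows "nbrs E (L (i - 1)) \<inter> nbrs E (L (i + 2)) = {}"
proof -
  have "L (i - 2) \<noteq> L (i + 1)" "L (i - 2) \<noteq> L (i + 3)" "L i \<noteq> L (i + 1)" "L i \<noteq> L (i + 3)"
    using m L_neq[of "i - 2" "i + 1"] L_neq[of "i - 2" "i + 3"] L_neq[of i "i + 1"] L_neq[of i "i + 3"]
    by simp_all
  moreover have "nbrs E (L (i - 1)) = {P (i - 1), L (i - 2), L i}" using nbrs_E_leaf[of "i - 1"] by simp
  moreover have "nbrs E (L (i + 2)) = {P (i + 2), L (i + 1), L (i + 3)}" using nbrs_E_leaf[of "i + 2"] by (simp add: add.commute)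
  moreover have "P j \<noteq> L k" "L k \<noteq> P j" for j k using P_neq by metis+
  ultimately show ?thesis using assms(2) by auto
qed

text \<open>As \<open>P i\<close> is adjacent to \<open>L (i + 2)\<close>, it takes 1 while
  \<open>L (i + 2)\<close> and \<open>P (i + 1)\<close> both take 2. The value -1 at
  \<open>L (i - 1)\<close> needs distance 3 to both; this comes from
  \<open>outer_parents_far\<close> and \<open>rim_return\<close>.\<close>

lemma outer_parents_if_return:
  assumes m: "m \<ge> 6" and ne: "P i \<noteq> P (i + 1)" and ret: "P i = P (i + 2)"
  shows "P (i - 1) = P (i + 2)"
proof (rule ccontr)
  assume neg: "P (i - 1) \<noteq> P (i + 2)"
  have m5: "m \<ge> 5" using m by simp
  have far: "P (i - 1) \<noteq> P (i + 1)" "nbrs E (L (i - 1)) \<inter> nbrs E (P (i + 1)) = {}"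
    using rim_return[OF m5 ne ret] neg ret by auto
  have "(2::int) + 2 < -1 + 1 + 4"
    using far outer_parents_far[OF m neg] internal_edge_E_iff[of "L (i - 1)" "P (i + 1)"] P_internal
    by (intro rim_test[OF m5 ne]) (auto simp: leaf_edge_iff)
  then show False by simp
qed

text \<open>The potential has 0 and 1 at the two parents and -1 and 2 at the outer leaves. It is
  admissible once there is no return and the outer leaves have no common neighbour, and it again
  attains the total 4.\<close>

lemma outer_parents:
  assumes m: "m \<ge> 6" and ne: "P i \<noteq> P (i + 1)"
  shows "P (i - 1) = P (i + 2)"
proof (rule ccontr)
  assume neg: "P (i - 1) \<noteq> P (i + 2)"
  have m5: "m \<ge> 5" using m by simp
  have r1: "P i \<noteq> P (i + 2)" using outer_parents_if_return[OF m ne] neg by blast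
  have r2: "P (i + 1) \<noteq> P (i - 1)"
    using positive_halin.outer_parents_if_return[OF positive_halin_rev m, of "- (i + 1)"] ne neg
    by (auto simp: add.commute)
  have "(2::int) + 1 < -1 + 0 + 4"
    using r1 r2 outer_parents_far[OF m neg] internal_edge_E_iff[of "L (i - 1)" "P (i + 1)"]
      internal_edge_E_iff[of "P i" "L (i + 2)"] P_internal
    by (intro rim_test[OF m5 ne]) (auto simp: leaf_edge_iff leaf_edge_iff')
  then show False by simp
qed

end

section \<open>Spiders and subdivided wheels\<close>

text \<open>A list of the vertices in the order of their numbers is the inverse of the isomorphism,
  so that comparing with a concrete graph becomes an equation between edge sets.\<close>

lemma graph_iso_nth:
  assumes xs: "distinct xs" "set xs = V" and E: "E = (`) ((!) xs) ` E'" and E': "\<Union>E' \<subseteq> {0..<length xs}"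
  shows "graph_iso V E {0..<length xs} E'"
proof -
  let ?g = "(!) xs" and ?I = "{0..<length xs}"
  have bij: "bij_betw ?g ?I V" using xs by (intro bij_betw_nth) auto
  then have inj: "inj_on ?g ?I" by (simp add: bij_betw_def)
  let ?f = "inv_into ?I ?g"
  have gf: "?g (?f u) = u" "?f u \<in> ?I" if "u \<in> V" for u
    using that bij by (auto simp: bij_betw_def f_inv_into_f inv_into_into)
  have "{u, v} \<in> E \<longleftrightarrow> {?f u, ?f v} \<in> E'" if uv: "u \<in> V" "v \<in> V" for u v
  proof
    assume "{u, v} \<in> E"
    then obtain e where e: "e \<in> E'" "{u, v} = ?g ` e" by (auto simp: E)
    have "?g ` {?f u, ?f v} = ?g ` e" using gf uv e(2) by simp
    then have "{?f u, ?f v} = e"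
      using inj_on_image_eq_iff[OF inj, of "{?f u, ?f v}" e] gf(2) uv e(1) E' by auto
    then show "{?f u, ?f v} \<in> E'" using e by simp
  next
    assume "{?f u, ?f v} \<in> E'"
    then have "?g ` {?f u, ?f v} \<in> E" unfolding E by blast
    then show "{u, v} \<in> E" using gf uv by simp
  qed
  moreover have "bij_betw ?f V ?I" using bij by (rule bij_betw_inv_into)
  ultimately show ?thesis unfolding graph_iso_def by blast
qed

lemma graph_iso_mkE:
  assumes xs: "distinct xs" "set xs = V" and E: "E = set (map (\<lambda>(a, b). {xs ! a, xs ! b}) ps)"
    and ps: "\<forall>(a, b)\<in>set ps. a < length xs \<and> b < length xs"
  shows "graph_iso V E {0..<length xs} (mkE ps)"
proof (rule graph_iso_nth[OF xs])
  show "E = (`) ((!) xs) ` mkE ps" unfolding E mkE_def by (force simp: image_image)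
  show "\<Union> (mkE ps) \<subseteq> {0..<length xs}" using ps by (auto simp: mkE_def)
qed

text \<open>Subdividing deletes an edge, and taking images commutes with set difference only under
  injectivity; A is a set carrying all the old edges on which it holds.\<close>

lemma image_subdiv:
  assumes inj: "inj_on g A" and A: "\<Union>E \<subseteq> A" "a \<in> A" "b \<in> A"
  shows "(`) g ` subdiv E a b w = subdiv ((`) g ` E) (g a) (g b) (g w)"
proof -
  have "inj_on ((`) g) (Pow A)" using inj by (rule inj_on_image_Pow)
  then have "(`) g ` (E - {{a, b}}) = (`) g ` E - (`) g ` {{a, b}}"
    using A by (intro inj_on_image_set_diff[of _ "Pow A"]) auto
  then show ?thesis by (simp add: subdiv_def image_Un)
qed

lemma Union_subdiv: "\<Union>(subdiv E a b w) \<subseteq> \<Union>E \<union> {a, b, w}"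
  unfolding subdiv_def by auto

lemma Union_wheelE: "n \<ge> 2 \<Longrightarrow> \<Union>(wheelE n) \<subseteq> {0..<n}"
  by (auto simp: wheelE_def)

section \<open>Wheels and spiders over the leaf cycle\<close>

context leaf_cycle
begin

lemma rim_shift: "range (\<lambda>i. {L i, L (i + 1)}) = (\<lambda>t. {L (s + t), L (s + t + 1)}) ` {0..<m}"
proof (intro equalityI subsetI)
  fix e assume "e \<in> range (\<lambda>i. {L i, L (i + 1)})"
  then obtain i where i: "e = {L i, L (i + 1)}" by auto
  obtain t where t: "0 \<le> t" "t < m" "L i = L (s + t)" using L_reduce by blast
  then have "e = {L (s + t), L (s + t + 1)}" using i L_cong[OF t(3), of 1] by simp
  then show "e \<in> (\<lambda>t. {L (s + t), L (s + t + 1)}) ` {0..<m}" using t by auto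
qed auto

text \<open>Turns a table of all neighbourhoods into an explicit edge set.\<close>

lemma T_as_nbrs: "T = (\<Union>v\<in>V. (\<lambda>u. {u, v}) ` nbrs T v)"
proof (intro equalityI subsetI)
  fix e assume e: "e \<in> T"
  then obtain u v where "u \<in> V" "v \<in> V" "e = {u, v}" using simple_T by (auto simp: simple_graph_def)
  then show "e \<in> (\<Union>v\<in>V. (\<lambda>u. {u, v}) ` nbrs T v)" using e by (auto simp: nbrs_def)
qed (auto simp: nbrs_def)

text \<open>The wheel before any spoke is subdivided; a spoke at a leaf whose parent is not h is not
  an edge of E.\<close>

definition full_wheel :: "'a \<Rightarrow> 'a set set" where
  "full_wheel h = range (\<lambda>i. {h, L i}) \<union> range (\<lambda>i. {L i, L (i + 1)})"

text \<open>The start s is free so that the numbering can begin at a subdivided spoke. Rim vertex t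
  + 1 is the leaf s + t, hence the closing edge from m to 1 is the rim edge between s + m - 1 and s
  + m.\<close>

lemma wheel_image:
  assumes g: "g 0 = h" "\<And>t. t < nat m \<Longrightarrow> g (Suc t) = L (s + int t)"
  shows "(`) g ` wheelE (Suc (nat m)) = full_wheel h"
proof -
  let ?M = "nat m"
  have M: "?M \<ge> 3" "int ?M = m" using m_ge by auto
  have "range (\<lambda>i. {h, L i}) = (\<lambda>l. {h, l}) ` range L" by auto
  also have "\<dots> = (\<lambda>t. {h, L (s + t)}) ` {0..<m}" unfolding range_L[of s] by (simp add: image_image)
  also have "{0..<m} = int ` {0..<?M}" using M(2) by (simp add: image_int_atLeastLessThan)
  finally have sp: "range (\<lambda>i. {h, L i}) = (\<lambda>t. {h, L (s + int t)}) ` {0..<?M}" by (simp add: image_image)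
  have rim: "range (\<lambda>i. {L i, L (i + 1)}) = (\<lambda>t. {L (s + int t), L (s + int t + 1)}) ` {0..<?M}"
  proof -
    have "{0..<m} = int ` {0..<?M}" using M(2) by (simp add: image_int_atLeastLessThan)
    then show ?thesis unfolding rim_shift[of s] by (simp add: image_image)
  qed
  have w: "wheelE (Suc ?M) = (\<lambda>t. {0, Suc t}) ` {0..<?M} \<union> (\<lambda>t. {Suc t, Suc (Suc t)}) ` {0..<?M - 1} \<union> {{?M, 1}}"
  proof -
    have "{{0, i} | i. 1 \<le> i \<and> i < Suc ?M} = (\<lambda>t. {0, Suc t}) ` {0..<?M}"
      by (auto simp: image_iff Suc_le_eq gr0_conv_Suc)
    moreover have "{{i, i + 1} | i. 1 \<le> i \<and> i + 1 < Suc ?M} = (\<lambda>t. {Suc t, Suc (Suc t)}) ` {0..<?M - 1}"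
      by (auto simp: image_iff Suc_le_eq gr0_conv_Suc)
    ultimately show ?thesis unfolding wheelE_def by simp
  qed
  have i1: "(`) g ` (\<lambda>t. {0, Suc t}) ` {0..<?M} = range (\<lambda>i. {h, L i})"
    unfolding sp image_image using g by (intro image_cong) auto
  have i2: "(`) g ` (\<lambda>t. {Suc t, Suc (Suc t)}) ` {0..<?M - 1} = (\<lambda>t. {L (s + int t), L (s + int t + 1)}) ` {0..<?M - 1}"
    unfolding image_image using g(2) by (intro image_cong) (auto simp: add.commute add.left_commute)
  have i3: "g ` {?M, 1} = {L (s + int (?M - 1)), L (s + int (?M - 1) + 1)}"
  proof -
    have "g ?M = L (s + int (?M - 1))" using g(2)[of "?M - 1"] M by simp
    moreover have "g 1 = L s" using g(2)[of 0] M by simp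
    moreover have "s + int (?M - 1) + 1 = s + m" using M by (simp add: of_nat_diff)
    ultimately show ?thesis by (simp add: L_period)
  qed
  have "{0..<?M} = insert (?M - 1) {0..<?M - 1}" using M by auto
  then have "(\<lambda>t. {L (s + int t), L (s + int t + 1)}) ` {0..<?M} =
     insert {L (s + int (?M - 1)), L (s + int (?M - 1) + 1)} ((\<lambda>t. {L (s + int t), L (s + int t + 1)}) ` {0..<?M - 1})"
    by simp
  then show ?thesis
    unfolding w image_Un image_insert image_empty i1 i2 i3[unfolded image_insert image_empty] full_wheel_def rim
    by (simp only: Un_insert_right Un_empty_right Un_assoc)
qed

text \<open>All legs at the hub have length 1 or 2. With the rim added, these are the wheels with
  some spokes subdivided once, which covers the three wheel families, \<open>H_1\<close> and
  \<open>H_6\<close>.\<close>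

definition spider :: "'a \<Rightarrow> bool" where
  "spider h \<longleftrightarrow> h \<in> V \<and> \<not> is_leaf T h \<and>
     (\<forall>y\<in>nbrs T h. is_leaf T y \<or> (\<exists>w. is_leaf T w \<and> nbrs T y = {h, w}))"

context
  fixes h
  assumes sp: "spider h"
begin

lemma hub: "h \<in> V" "\<not> is_leaf T h" and hub_neq: "h \<noteq> L i" "L i \<noteq> h"
  using sp L_leaf by (auto simp: spider_def)

text \<open>The hub, its neighbours and the ends of the long legs are closed under tree edges, hence
  they are all vertices; a leaf is found in the second or third group.\<close>

lemma spider_parent: "P i = h \<or> P i \<noteq> h \<and> nbrs T (P i) = {h, L i}"
proof -
  let ?S = "{h} \<union> nbrs T h \<union> {w. is_leaf T w \<and> (\<exists>y\<in>nbrs T h. nbrs T y = {h, w})}"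
  have "V \<subseteq> ?S"
  proof (rule connected_graph_closed[OF connected_T hub(1)])
    fix a b assume a: "a \<in> ?S" and ab: "{a, b} \<in> T"
    then have ba: "b \<in> nbrs T a" "a \<in> nbrs T b" by (auto simp: nbrs_def insert_commute)
    consider "a = h" | "a \<in> nbrs T h" | y where "is_leaf T a" "y \<in> nbrs T h" "nbrs T y = {h, a}" using a by blast
    then show "b \<in> ?S"
    proof cases
      case 1 then show ?thesis using ba by simp
    next
      case 2
      have ha: "h \<in> nbrs T a" using 2 by (simp add: nbrs_sym[of h])
      show ?thesis
      proof (cases "is_leaf T a")
        case True
        then obtain x where "nbrs T a = {x}" by (auto simp: is_leaf_def deg_def card_1_singleton_iff)
        then show ?thesis using ha ba by auto
      next
        case False
        then obtain w where "is_leaf T w" "nbrs T a = {h, w}" using 2 sp by (auto simp: spider_def)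
        then show ?thesis using ba 2 by auto
      qed
    next
      case (3 y)
      then obtain x where x: "nbrs T a = {x}" by (auto simp: is_leaf_def deg_def card_1_singleton_iff)
      have "a \<in> nbrs T y" using 3 by simp
      then have "y \<in> nbrs T a" by (simp add: nbrs_sym[of y])
      then show ?thesis using x ba 3 by auto
    qed
  qed simp
  then have "L i \<in> ?S" using L_in by blast
  then consider "L i \<in> nbrs T h" | y where "y \<in> nbrs T h" "nbrs T y = {h, L i}" using hub_neq by blast
  then show ?thesis
  proof cases
    case 1
    then have "h \<in> nbrs T (L i)" by (simp add: nbrs_sym[of h])
    then show ?thesis by (simp add: nbrs_T_leaf)
  next
    case (2 y)
    have "L i \<in> nbrs T y" using 2 by simp
    then have "y \<in> nbrs T (L i)" by (simp add: nbrs_sym[of y])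
    then have "y = P i" by (simp add: nbrs_T_leaf)
    moreover have "y \<noteq> h" using 2 not_in_nbrs_self[OF simple_T] by auto
    ultimately show ?thesis using 2 by simp
  qed
qed

lemma spider_nbrs: "P i \<noteq> h \<Longrightarrow> nbrs T (P i) = {h, L i}" using spider_parent by blast

lemma spider_inj: "P i \<noteq> h \<Longrightarrow> P i = P j \<Longrightarrow> L i = L j"
proof -
  assume "P i \<noteq> h" "P i = P j"
  then have "{h, L i} = {h, L j}" using spider_nbrs[of i] spider_nbrs[of j] by metis
  then show ?thesis using hub_neq by (metis doubleton_eq_iff)
qed

lemma spider_hub_nbrs: "nbrs T h = {L i | i. P i = h} \<union> {P i | i. P i \<noteq> h}"
proof (intro equalityI subsetI)
  fix y assume y: "y \<in> nbrs T h"
  show "y \<in> {L i | i. P i = h} \<union> {P i | i. P i \<noteq> h}"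
  proof (cases "is_leaf T y")
    case True
    moreover have "y \<in> V" using y nbrs_subset[OF simple_T] by blast
    ultimately obtain i where i: "y = L i" using leaf_obtain by blast
    then have "h \<in> nbrs T (L i)" using y by (simp add: nbrs_sym[of h])
    then have "P i = h" by (simp add: nbrs_T_leaf)
    then show ?thesis using i by blast
  next
    case False
    then obtain w where w: "is_leaf T w" "nbrs T y = {h, w}" using y sp by (auto simp: spider_def)
    then have "w \<in> nbrs T y" by simp
    then obtain i where i: "w = L i" using leaf_obtain[OF w(1)] nbrs_subset[OF simple_T] by blast
    then have "y \<in> nbrs T (L i)" using w by (simp add: nbrs_sym[of y])
    then have "y = P i" by (simp add: nbrs_T_leaf)
    moreover have "y \<noteq> h" using y not_in_nbrs_self[OF simple_T] by blast
    ultimately show ?thesis by blast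
  qed
next
  fix y assume "y \<in> {L i | i. P i = h} \<union> {P i | i. P i \<noteq> h}"
  then consider i where "y = L i" "P i = h" | i where "y = P i" "P i \<noteq> h" by blast
  then show "y \<in> nbrs T h"
  proof cases
    case (1 i) then show ?thesis using leaf_edge(1)[of i] by (simp add: nbrs_def)
  next
    case (2 i)
    have "h \<in> nbrs T y" using spider_nbrs[of i] 2 by simp
    then show ?thesis by (simp add: nbrs_sym[of h])
  qed
qed

lemma spider_V: "V = {h} \<union> range L \<union> {P i | i. P i \<noteq> h}"
proof (intro equalityI)
  show "V \<subseteq> {h} \<union> range L \<union> {P i | i. P i \<noteq> h}"
  proof (rule connected_graph_closed[OF connected_T hub(1)])
    fix a b assume a: "a \<in> {h} \<union> range L \<union> {P i | i. P i \<noteq> h}" and "{a, b} \<in> T"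
    then have b: "b \<in> nbrs T a" by (simp add: nbrs_def insert_commute)
    show "b \<in> {h} \<union> range L \<union> {P i | i. P i \<noteq> h}"
      using a b spider_hub_nbrs spider_nbrs nbrs_T_leaf by blast
  qed simp
qed (use hub L_in P_in in auto)

lemma spider_E: "E = {{h, L i} | i. P i = h} \<union> {{h, P i} | i. P i \<noteq> h} \<union> {{P i, L i} | i. P i \<noteq> h}
    \<union> range (\<lambda>i. {L i, L (i + 1)})"
proof -
  have "T = {{h, L i} | i. P i = h} \<union> {{h, P i} | i. P i \<noteq> h} \<union> {{P i, L i} | i. P i \<noteq> h}" (is "T = ?R")
  proof (intro equalityI subsetI)
    fix e assume e: "e \<in> T"
    then obtain u v where uv: "u \<in> V" "e = {v, u}" "v \<in> nbrs T u"
      using simple_T by (auto simp: simple_graph_def nbrs_def insert_commute)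
    consider "u = h" | i where "u = L i" | i where "u = P i" "P i \<noteq> h" using uv(1) spider_V by blast
    then show "e \<in> ?R"
    proof cases
      case 1 then show ?thesis using uv spider_hub_nbrs by (auto simp: insert_commute)
    next
      case (2 i) then show ?thesis using uv nbrs_T_leaf[of i] by auto
    next
      case (3 i) then show ?thesis using uv spider_nbrs[of i] by (auto simp: insert_commute)
    qed
  next
    fix e assume "e \<in> ?R"
    then consider i where "e = {h, L i}" "P i = h" | i where "e = {h, P i}" "P i \<noteq> h" | i where "e = {P i, L i}"
      by blast
    then show "e \<in> T"
    proof cases
      case (1 i) then show ?thesis using leaf_edge(2)[of i] by simp
    next
      case (2 i)
      have "h \<in> nbrs T (P i)" using spider_nbrs[of i] 2 by simp
      then show ?thesis using 2 by (simp add: nbrs_def)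
    qed (simp add: leaf_edge)
  qed
  then show ?thesis using E_def by simp
qed

definition spider_list :: "int \<Rightarrow> 'a list" where
  "spider_list s = h # map (\<lambda>t. L (s + int t)) [0..<nat m]"

lemma spider_list: "distinct (spider_list s)" "set (spider_list s) = {h} \<union> range L"
    "length (spider_list s) = Suc (nat m)" "spider_list s ! 0 = h"
    "t < nat m \<Longrightarrow> spider_list s ! Suc t = L (s + int t)"
proof -
  have "inj_on (\<lambda>t. L (s + int t)) (set [0..<nat m])"
  proof (rule inj_onI)
    fix x y assume "x \<in> set [0..<nat m]" "y \<in> set [0..<nat m]" "L (s + int x) = L (s + int y)"
    moreover from this have "\<bar>(s + int x) - (s + int y)\<bar> < m" by auto
    ultimately show "x = y" using L_neq[of "s + int x" "s + int y"] by auto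
  qed
  then show "distinct (spider_list s)" using hub_neq by (auto simp: spider_list_def distinct_map)
  have "range L = (\<lambda>t. L (s + t)) ` int ` {0..<nat m}"
    unfolding range_L[of s] using m_pos by (simp add: image_int_atLeastLessThan)
  then show "set (spider_list s) = {h} \<union> range L" by (simp add: spider_list_def image_image)
qed (simp_all add: spider_list_def)

lemma spider_iso_wheel:
  assumes "\<And>i. P i = h"
  shows "graph_iso V E (wheelV (Suc (nat m))) (wheelE (Suc (nat m)))"
proof -
  have "graph_iso V E {0..<length (spider_list 0)} (wheelE (Suc (nat m)))"
  proof (rule graph_iso_nth)
    show "set (spider_list 0) = V" using spider_V assms spider_list by auto
    have "E = full_wheel h" unfolding spider_E full_wheel_def using assms by auto
    then show "E = (`) ((!) (spider_list 0)) ` wheelE (Suc (nat m))"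
      using wheel_image[of "(!) (spider_list 0)" h 0] spider_list(4,5) by simp
    show "\<Union>(wheelE (Suc (nat m))) \<subseteq> {0..<length (spider_list 0)}"
      using Union_wheelE[of "Suc (nat m)"] m_pos spider_list(3) by simp
  qed (rule spider_list)
  then show ?thesis by (simp add: spider_list wheelV_def)
qed

lemma full_wheel_minus: "full_wheel h - {{h, L s}} = {{h, L i} | i. L i \<noteq> L s} \<union> range (\<lambda>i. {L i, L (i + 1)})"
  unfolding full_wheel_def using hub_neq by (auto simp: doubleton_eq_iff)

lemma spider_iso_wheel1:
  assumes J: "\<And>i. P i \<noteq> h \<longleftrightarrow> L i = L s"
  shows "graph_iso V E (wheel1V (nat m + 2)) (wheel1E (nat m + 2))"
proof -
  let ?xs = "spider_list s @ [P s]" and ?M = "nat m"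
  have Ps: "P s \<noteq> h" using J by simp
  have PJ: "P i = P s" if "L i = L s" for i using that by simp
  have nth: "?xs ! 0 = h" "?xs ! Suc ?M = P s" "\<And>t. t < ?M \<Longrightarrow> ?xs ! Suc t = L (s + int t)"
    using spider_list by (auto simp: nth_append)
  have len: "length ?xs = ?M + 2" using spider_list by simp
  have dist: "distinct ?xs" using spider_list(1,2) Ps P_neq by auto
  have M: "?M \<ge> 3" using m_ge by simp
  have "graph_iso V E {0..<length ?xs} (wheel1E (?M + 2))"
  proof (rule graph_iso_nth[OF dist])
    show "set ?xs = V" using spider_V spider_list(2) J PJ by auto
    have w1: "wheel1E (?M + 2) = subdiv (wheelE (Suc ?M)) 0 1 (Suc ?M)" by (simp add: wheel1E_def)
    have U: "\<Union>(wheelE (Suc ?M)) \<subseteq> {0..<Suc ?M}" using Union_wheelE[of "Suc ?M"] M by simp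
    then show "\<Union>(wheel1E (?M + 2)) \<subseteq> {0..<length ?xs}"
      unfolding w1 len using Union_subdiv[of "wheelE (Suc ?M)" 0 1 "Suc ?M"] M by fastforce
    have "(`) ((!) ?xs) ` wheel1E (?M + 2) = subdiv (full_wheel h) h (L s) (P s)"
    proof -
      have "inj_on ((!) ?xs) {0..<Suc ?M}"
        by (rule inj_on_subset[OF inj_on_nth[OF dist, of "{0..<length ?xs}"]]) (auto simp: spider_list(3))
      from image_subdiv[OF this U, of 0 1 "Suc ?M"] wheel_image[of "(!) ?xs" h s] nth M nth(3)[of 0]
      show ?thesis unfolding w1 by simp
    qed
    also have "\<dots> = E"
      unfolding subdiv_def full_wheel_minus spider_E using J PJ by (auto simp: insert_commute)
    finally show "E = (`) ((!) ?xs) ` wheel1E (?M + 2)" by simp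
  qed
  then show ?thesis by (simp only: len wheel1V_def)
qed

text \<open>Numbering from s puts the first subdivided spoke at rim vertex 1 and the other at rim
  vertex k + 1. The two middle vertices receive the last numbers m + 1 and m + 2, in the order in
  which \<open>wheel2E\<close> introduces them.\<close>

lemma spider_iso_wheel2:
  assumes J: "\<And>i. P i \<noteq> h \<longleftrightarrow> L i = L s \<or> L i = L (s + int k)"
    and k: "0 < k" "k < nat m" "Suc k = nat \<lceil>real (nat m + 1) / 2\<rceil>"
  shows "graph_iso V E (wheel2V (nat m + 3)) (wheel2E (nat m + 3))"
proof -
  let ?r = "s + int k"
  let ?xs = "spider_list s @ [P s, P ?r]" and ?M = "nat m"
  have Ps: "P s \<noteq> h" "P ?r \<noteq> h" using J by simp_all
  have PJ: "P i = P s" if "L i = L s" for i using that by simp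
  have PJ': "P i = P ?r" if "L i = L ?r" for i using that by simp
  have sr: "L s \<noteq> L ?r" using k by (intro L_neq) auto
  then have Psr: "P s \<noteq> P ?r" using spider_inj[OF Ps(1)] by blast
  have nth: "?xs ! 0 = h" "?xs ! Suc ?M = P s" "?xs ! Suc (Suc ?M) = P ?r"
     "\<And>t. t < ?M \<Longrightarrow> ?xs ! Suc t = L (s + int t)"
    using spider_list by (auto simp: nth_append)
  have len: "length ?xs = ?M + 3" using spider_list by simp
  have dist: "distinct ?xs" using spider_list(1,2) Ps Psr P_neq by auto
  have M: "?M \<ge> 3" using m_ge by simp
  have inj: "inj_on ((!) ?xs) {0..<?M + 3}"
    by (rule inj_on_nth[OF dist]) (auto simp: spider_list(3))
  have "graph_iso V E {0..<length ?xs} (wheel2E (?M + 3))"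
  proof (rule graph_iso_nth[OF dist])
    show "set ?xs = V" using spider_V spider_list(2) J PJ PJ' by auto
    have w2: "wheel2E (?M + 3) = subdiv (subdiv (wheelE (Suc ?M)) 0 1 (Suc ?M)) 0 (Suc k) (Suc (Suc ?M))"
      unfolding wheel2E_def k(3) by (simp add: numeral_3_eq_3)
    have U: "\<Union>(wheelE (Suc ?M)) \<subseteq> {0..<?M + 3}" using Union_wheelE[of "Suc ?M"] M by fastforce
    then have U1: "\<Union>(subdiv (wheelE (Suc ?M)) 0 1 (Suc ?M)) \<subseteq> {0..<?M + 3}"
      using Union_subdiv[of "wheelE (Suc ?M)" 0 1 "Suc ?M"] M by fastforce
    then show "\<Union>(wheel2E (?M + 3)) \<subseteq> {0..<length ?xs}"
      unfolding w2 len
      using Union_subdiv[of "subdiv (wheelE (Suc ?M)) 0 1 (Suc ?M)" 0 "Suc k" "Suc (Suc ?M)"] k by fastforce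
    have "(`) ((!) ?xs) ` wheel2E (?M + 3) = subdiv (subdiv (full_wheel h) h (L s) (P s)) h (L ?r) (P ?r)"
      using image_subdiv[OF inj U, of 0 1 "Suc ?M"] image_subdiv[OF inj U1, of 0 "Suc k" "Suc (Suc ?M)"]
        wheel_image[of "(!) ?xs" h s] nth(1-3) nth(4)[of 0] nth(4) M k(1,2)
      unfolding w2 by simp
    also have "\<dots> = (full_wheel h - {{h, L s}} - {{h, L ?r}}) \<union> {{h, P s}, {P s, L s}, {h, P ?r}, {P ?r, L ?r}}"
      using P_neq[of s ?r] hub_neq sr by (auto simp: subdiv_def doubleton_eq_iff)
    also have "full_wheel h - {{h, L s}} - {{h, L ?r}} =
       {{h, L i} | i. L i \<noteq> L s \<and> L i \<noteq> L ?r} \<union> range (\<lambda>i. {L i, L (i + 1)})"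
      unfolding full_wheel_minus using hub_neq by (auto simp: doubleton_eq_iff)
    also have "\<dots> \<union> {{h, P s}, {P s, L s}, {h, P ?r}, {P ?r, L ?r}} = E"
    proof -
      have long: "{L i | i. P i \<noteq> h} = {L s, L ?r}" using J by auto
      have "{{h, L i} | i. P i = h} = {{h, L i} | i. L i \<noteq> L s \<and> L i \<noteq> L ?r}"
        using J by (metis (no_types, lifting))
      moreover have "{{h, P i} | i. P i \<noteq> h} = (\<lambda>l. {h, leaf_parent T l}) ` {L i | i. P i \<noteq> h}" by blast
      moreover have "{{P i, L i} | i. P i \<noteq> h} = (\<lambda>l. {leaf_parent T l, l}) ` {L i | i. P i \<noteq> h}" by blast
      ultimately show ?thesis unfolding spider_E long by (simp add: insert_commute Un_ac)
    qed
    finally show "E = (`) ((!) ?xs) ` wheel2E (?M + 3)" by simp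
  qed
  then show ?thesis by (simp only: len wheel2V_def)
qed

end

end

section \<open>At least five leaves\<close>

context positive_halin
begin

text \<open>The leaf cycle enters the side of y between two consecutive leaves, whose parents then
  lie on different sides. These parents are adjacent, and xy is the only edge across.\<close>

lemma internal_edge_crossing:
  assumes m: "m \<ge> 5" and xy: "{x, y} \<in> T" "\<not> is_leaf T x" "\<not> is_leaf T y"
  obtains i where "P i = x" "P (i + 1) = y"
proof -
  obtain i Y where Y: "tree_side T x y Y" "L i \<notin> Y" "L (i + 1) \<in> Y" using crossing_exists[OF xy(1)] .
  have "P i \<notin> Y" "P (i + 1) \<in> Y" using leaf_side_iff[OF Y(1) xy(2,3)] Y(2,3) by auto
  moreover from this have "{P (i + 1), P i} \<in> T"
    using parents_adjacent[OF m, of i] by (metis insert_commute)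
  ultimately have "P (i + 1) = y \<and> P i = x" using Y(1) unfolding tree_side_def by blast
  then show thesis using that by blast
qed

text \<open>A second leaf with the parent of leaf k would make the sequence alternate between that
  parent and h, with the occurrences of h taken at k + 1 and k - 1 + m.\<close>

lemma isolated_parent_unique:
  assumes k: "P (k - 1) = h" "P (k + 1) = h" "P k \<noteq> h" and j: "P j = P k"
  shows "L j = L k"
proof (rule ccontr)
  assume ne: "L j \<noteq> L k"
  obtain t where t: "0 \<le> t" "t < m" "L j = L (k + t)" using L_reduce by blast
  have Pt: "P (k + t) = P k" using j t by simp
  have h': "P (k + (m - 1)) = h" using k(1) L_period[of "k - 1"] by (simp add: algebra_simps)
  have "t \<noteq> 0" using ne t by auto
  moreover have "t \<noteq> 1" using Pt k by auto
  moreover have "t \<noteq> m - 1" using Pt k h' by auto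
  ultimately have "P k = P (k + 1)"
    using t Pt h' k by (intro no_alternation_eq[of k "k + 1" "k + t" "k + (m - 1)"]) auto
  then show False using k by simp
qed

text \<open>Every internal neighbour y of h occurs in the parent sequence, and by isolation at one
  leaf only. Any internal neighbour of y occurs right after that leaf, so it is h; thus y has just h
  and its leaf as neighbours.\<close>

lemma spider_intro:
  assumes m: "m \<ge> 5" and s: "P s = h" and iso: "\<And>i. P i \<noteq> h \<Longrightarrow> P (i - 1) = h \<and> P (i + 1) = h"
  shows "spider h"
proof -
  have h: "h \<in> V" "\<not> is_leaf T h" using s P_in P_internal by auto
  have "\<exists>w. is_leaf T w \<and> nbrs T y = {h, w}" if y: "y \<in> nbrs T h" "\<not> is_leaf T y" for y
  proof -
    have yh: "{h, y} \<in> T" "y \<noteq> h"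
      using y not_in_nbrs_self[OF simple_T] by (auto simp: nbrs_def insert_commute)
    obtain i where "P i = h" "P (i + 1) = y" using internal_edge_crossing[OF m yh(1) h(2) y(2)] .
    then obtain k where k: "P k = y" by blast
    then have kh: "P k \<noteq> h" "P (k - 1) = h" "P (k + 1) = h" using iso[of k] yh by auto
    have "nbrs T y = {h, L k}"
    proof (intro equalityI subsetI)
      fix z assume z: "z \<in> nbrs T y"
      then have yz: "{y, z} \<in> T" and zV: "z \<in> V"
        using nbrs_subset[OF simple_T] by (auto simp: nbrs_def insert_commute)
      show "z \<in> {h, L k}"
      proof (cases "is_leaf T z")
        case True
        then obtain j where j: "z = L j" using leaf_obtain zV by blast
        then have "P j = P k" using yz k by (simp add: leaf_edge_iff')
        then show ?thesis using isolated_parent_unique[OF kh(2,3,1)] j by simp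
      next
        case False
        obtain j where j: "P j = y" "P (j + 1) = z" using internal_edge_crossing[OF m yz y(2) False] .
        then have "L j = L k" using isolated_parent_unique[OF kh(2,3,1)] k by simp
        then have "L (j + 1) = L (k + 1)" by (rule L_cong)
        then show ?thesis using j kh by simp
      qed
    next
      fix z assume "z \<in> {h, L k}"
      then show "z \<in> nbrs T y" using yh leaf_edge(1)[of k] k by (auto simp: nbrs_def)
    qed
    then show ?thesis using L_leaf by blast
  qed
  then show ?thesis using h unfolding spider_def by blast
qed

text \<open>If both equalities fail, the parents change at two consecutive places.
  \<open>outer_parents\<close> at both gives \<open>P (i - 1) = P (i + 2)\<close> and
  \<open>P i = P (i + 3)\<close>, an alternation.\<close>

lemma parent_change_singleton:
  assumes m: "m \<ge> 6" and ne: "P i \<noteq> P (i + 1)"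
  shows "P (i - 1) = P i \<or> P (i - 1) = P (i + 1)"
proof (rule ccontr)
  assume neg: "\<not> ?thesis"
  have z: "P (i - 1) = P (i + 2)" using outer_parents[OF m ne] .
  then have "P (i + 1) \<noteq> P (i + 1 + 1)" using neg by (auto simp: add.assoc)
  from outer_parents[OF m this] have "P i = P (i + 3)" by (simp add: add.assoc)
  then have "P (i - 1) = P i"
    using z m by (intro no_alternation_eq[of "i - 1" i "i + 2" "i + 3"]) auto
  then show False using neg by simp
qed

text \<open>Not all consecutive parents differ: otherwise \<open>P (-1)\<close> would equal both
  \<open>P 1\<close> and \<open>P 2\<close>. Starting from two consecutive leaves at the same parent
  h, \<open>outer_parents\<close> shows that each departure from h lasts for one leaf and is
  followed by two leaves at h.\<close>

lemma large_hub:
  assumes m: "m \<ge> 6"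
  shows "\<exists>s. \<forall>i. P i \<noteq> P s \<longrightarrow>
    P (i - 1) = P s \<and> P (i + 1) = P s \<and> P (i - 2) = P s \<and> P (i + 2) = P s"
proof -
  have "\<exists>s. P s = P (s + 1)"
  proof (rule ccontr)
    assume "\<not> ?thesis"
    then have ne: "P s \<noteq> P (s + 1)" for s by blast
    have "P (-1) \<noteq> P 0" "P 1 \<noteq> P 2" using ne[of "-1"] ne[of 1] by auto
    then show False using parent_change_singleton[OF m ne, of 0] outer_parents[OF m ne, of 0] by auto
  qed
  then obtain s where s: "P s = P (s + 1)" by blast
  define h where "h = P s"
  define good where "good j \<longleftrightarrow> P j = h \<and> P (j + 1) = h" for j
  have skip: "P (j + 3) = h \<and> P (j + 4) = h" if "good j" "P (j + 2) \<noteq> h" for j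
  proof -
    have "P (j + 1) \<noteq> P (j + 1 + 1)" using that by (simp add: good_def add.assoc)
    from outer_parents[OF m this] have 3: "P (j + 3) = h" using that by (simp add: good_def add.assoc)
    then have "P (j + 2) \<noteq> P (j + 2 + 1)" using that by (simp add: add.assoc)
    from outer_parents[OF m this] have "P (j + 1) = P (j + 4)" by (simp add: add.assoc algebra_simps)
    then show ?thesis using 3 that by (simp add: good_def)
  qed
  \<comment> \<open>Scanning forward from s, every position is one of a pair of leaves at h, or the
    single departure right after such a pair.\<close>
  have inv: "\<exists>j. good j \<and> (s + int n = j \<or> s + int n = j + 1 \<or> s + int n = j + 2 \<and> P (j + 2) \<noteq> h)" for n
  proof (induction n)
    case 0
    then show ?case using s by (intro exI[of _ s]) (simp add: good_def h_def)
  next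
    case (Suc n)
    then obtain j where j: "good j" "s + int n = j \<or> s + int n = j + 1 \<or> s + int n = j + 2 \<and> P (j + 2) \<noteq> h"
      by blast
    consider "s + int n = j" | "s + int n = j + 1" "P (j + 2) \<noteq> h" | "s + int n = j + 1" "P (j + 2) = h"
      | "s + int n = j + 2" "P (j + 2) \<noteq> h" using j(2) by blast
    then show ?case
    proof cases
      case 1 then show ?thesis using j by (intro exI[of _ j]) auto
    next
      case 2 then show ?thesis using j by (intro exI[of _ j]) auto
    next
      case 3 then show ?thesis using j by (intro exI[of _ "j + 1"]) (auto simp: good_def add.assoc)
    next
      case 4 then show ?thesis using j skip[OF j(1)] by (intro exI[of _ "j + 3"]) (auto simp: good_def add.assoc)
    qed
  qed
  have "P (i - 1) = h \<and> P (i + 1) = h \<and> P (i - 2) = h \<and> P (i + 2) = h" if i: "P i \<noteq> h" for i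
  proof -
    obtain t where t: "0 \<le> t" "t < m" "L i = L (s + t)" using L_reduce by blast
    obtain j where j: "good j" "s + t = j \<or> s + t = j + 1 \<or> s + t = j + 2 \<and> P (j + 2) \<noteq> h"
      using inv[of "nat t"] t by auto
    have "P (s + t) \<noteq> h" using i t by simp
    then have st: "s + t = j + 2" "P (j + 2) \<noteq> h" using j by (auto simp: good_def)
    have "P (i + k) = P (j + 2 + k)" for k using L_cong[OF t(3), of k] st by simp
    from this[of "-1"] this[of 1] this[of "-2"] this[of 2] skip[OF j(1) st(2)] j(1)
    show ?thesis by (simp add: good_def add.assoc add.commute)
  qed
  then show ?thesis unfolding h_def by blast
qed

section \<open>Curvature at the hub\<close>

lemma hub_sum:
  fixes f :: "'a \<Rightarrow> int"
  assumes S: "S \<subseteq> N" "finite N" and f: "\<And>v. v \<in> N - S \<Longrightarrow> f v = -1"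
  shows "(\<Sum>v\<in>N. f v) = (\<Sum>v\<in>S. f v) - (int (card N) - int (card S))"
proof -
  have fS: "finite S" using S by (rule finite_subset)
  have "(\<Sum>v\<in>N. f v) = (\<Sum>v\<in>N - S. f v) + (\<Sum>v\<in>S. f v)" using S by (simp add: sum.subset_diff)
  also have "(\<Sum>v\<in>N - S. f v) = (\<Sum>v\<in>N - S. -1)" using f by (intro sum.cong) auto
  also have "\<dots> = - (int (card N) - int (card S))"
    using S fS card_mono[OF S(2,1)] by (simp add: card_Diff_subset of_nat_diff)
  finally show ?thesis by simp
qed

text \<open>Each leg meets the hub in one vertex, the leaf itself or its parent, so the neighbours
  of the hub correspond to the leaves.\<close>

lemma spider_hub_degree:
  assumes sp: "spider h"
  shows "int (card (nbrs E h)) = m"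
proof -
  define g where "g l = (if leaf_parent T l = h then l else leaf_parent T l)" for l
  have "nbrs E h = g ` range L"
    unfolding nbrs_E_internal[OF hub(2)[OF sp]] spider_hub_nbrs[OF sp] by (auto simp: g_def)
  moreover have "inj_on g (range L)"
  proof (rule inj_onI)
    fix a b assume "a \<in> range L" "b \<in> range L" and g: "g a = g b"
    then obtain i j where ij: "a = L i" "b = L j" by auto
    have "P i \<noteq> L j" "P j \<noteq> L i" using P_neq by metis+
    then show "a = b" using g spider_inj[OF sp, of i j] unfolding ij g_def by (auto split: if_splits)
  qed
  ultimately show ?thesis using card_leaves m_pos by (simp add: card_image)
qed

text \<open>The test is on the spoke to \<open>L 0\<close>, with 1 at that leaf and its two rim
  neighbours. The next leaves on either side are adjacent to a vertex of value 1 and must take 0;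
  all further leaves can take -1.\<close>

lemma wheel_bound:
  assumes sp: "spider h" and all: "\<And>i. P i = h" and m: "m \<ge> 5"
  shows "m \<le> 11"
proof -
  have nh: "nbrs E h = range L"
    unfolding nbrs_E_internal[OF hub(2)[OF sp]] spider_hub_nbrs[OF sp] using all by auto
  have nl: "nbrs E (L 0) = {h, L (-1), L 1}" using nbrs_E_leaf[of 0] all by simp
  have d: "L i \<noteq> L j" if "i \<noteq> j" "\<bar>i\<bar> \<le> 2" "\<bar>j\<bar> \<le> 2" for i j using m that by (intro L_neq) auto
  have hl: "h \<noteq> L i" "L i \<noteq> h" for i using hub_neq[OF sp] by auto
  let ?S = "{L 0, L 1, L (-1), L 2, L (-2)}"
  define f :: "'a \<Rightarrow> int" where "f v = (if v = h \<or> v = L 2 \<or> v = L (-2) then 0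
      else if v = L 0 \<or> v = L 1 \<or> v = L (-1) then 1 else -1)" for v
  have f: "f h = 0" "f (L 0) = 1" "f (L 1) = 1" "f (L (-1)) = 1" "f (L 2) = 0" "f (L (-2)) = 0"
    using d hl by (simp_all add: f_def)
  have near: "u \<in> ?S \<or> u = h" if "{u, w} \<in> E" "w \<in> {L 0, L 1, L (-1)}" for u w
  proof -
    have "u \<in> nbrs E (L 0) \<union> nbrs E (L 1) \<union> nbrs E (L (-1))" using that by (auto simp: nbrs_def)
    then show ?thesis using nbrs_E_leaf[of 0] nbrs_E_leaf[of 1] nbrs_E_leaf[of "-1"] all by auto
  qed
  have "int (deg E h) * (\<Sum>w\<in>nbrs E (L 0). f w - f (L 0)) < int (deg E (L 0)) * (\<Sum>u\<in>nbrs E h. f u - f h)"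
  proof (rule test)
    show "{h, L 0} \<in> E" "{h, L 0} \<in> E" using T_sub_E leaf_edge(2)[of 0] all by auto
    show "f (L 0) = f h + 1" using f by simp
    fix u w assume "u \<in> insert h (nbrs E h)" and w: "w \<in> insert (L 0) (nbrs E (L 0))"
    have w': "w = h \<or> w \<in> {L 0, L 1, L (-1)}" using w nl by auto
    have lo: "f u \<ge> -1" "f u \<ge> 0 \<or> u \<notin> ?S \<and> u \<noteq> h" using f by (auto simp: f_def)
    have fw: "f w \<le> 1" "f w \<le> 0 \<or> w \<noteq> h" by (auto simp: f_def)
    show "(f w > f u \<longrightarrow> u \<noteq> w) \<and> (f w > f u + 1 \<longrightarrow> {u, w} \<notin> E) \<and>
      (f w > f u + 2 \<longrightarrow> nbrs E u \<inter> nbrs E w = {}) \<and> f w \<le> f u + 3"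
      using w' lo fw near[of u w] by auto
  qed
  moreover have "(\<Sum>w\<in>nbrs E (L 0). f w - f (L 0)) = -1"
    using nl f hl d by simp
  moreover have "(\<Sum>u\<in>nbrs E h. f u - f h) = 8 - m"
  proof -
    have S: "?S \<subseteq> nbrs E h" unfolding nh by blast
    have "f v = -1" if "v \<in> nbrs E h - ?S" for v using that hl unfolding nh by (auto simp: f_def)
    then have "(\<Sum>u\<in>nbrs E h. f u) = (\<Sum>u\<in>?S. f u) - (m - int (card ?S))"
      using hub_sum[OF S finite_nbrs[OF simple_E], of f] spider_hub_degree[OF sp] by simp
    moreover have "(\<Sum>u\<in>?S. f u) = 3" "card ?S = 5" using f d by simp_all
    ultimately show ?thesis using f by simp
  qed
  moreover have "int (deg E h) = m" using spider_hub_degree[OF sp] by (simp add: deg_def)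
  ultimately show ?thesis by (simp add: deg_E_leaf)
qed

text \<open>The test is on the edge from the hub to the middle \<open>P j\<close> of a long leg. Its
  leaf takes 2, which forces 1 at the middle and at both rim neighbours and 0 at the leaves two
  steps away. All other neighbours of the hub are at distance 3 from that leaf and take -1.\<close>

lemma long_leg_bound:
  assumes sp: "spider h" and j: "P j \<noteq> h" "P (j - 1) = h" "P (j + 1) = h" "P (j - 2) = h" "P (j + 2) = h"
    and m: "m \<ge> 6"
  shows "m \<le> 7"
proof -
  let ?q = "P j" and ?w = "L j"
  have nq: "nbrs E ?q = {h, ?w}" using spider_nbrs[OF sp j(1)] nbrs_E_internal[OF P_internal] by simp
  have nw: "nbrs E ?w = {?q, L (j - 1), L (j + 1)}" using nbrs_E_leaf[of j] by simp
  have d: "L (j + i) \<noteq> L (j + k)" if "i \<noteq> k" "\<bar>i\<bar> \<le> 2" "\<bar>k\<bar> \<le> 2" for i k using m that by (intro L_neq) auto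
  have d': "?w \<noteq> L (j + 1)" "?w \<noteq> L (j - 1)" "?w \<noteq> L (j + 2)" "?w \<noteq> L (j - 2)"
     "L (j + 1) \<noteq> ?w" "L (j - 1) \<noteq> ?w" "L (j + 2) \<noteq> ?w" "L (j - 2) \<noteq> ?w"
     "L (j + 1) \<noteq> L (j - 1)" "L (j + 1) \<noteq> L (j + 2)" "L (j + 1) \<noteq> L (j - 2)" "L (j - 1) \<noteq> L (j + 2)"
     "L (j - 1) \<noteq> L (j - 2)" "L (j + 2) \<noteq> L (j - 2)" "L (j + 2) \<noteq> L (j + 1)" "L (j - 2) \<noteq> L (j + 1)"
     "L (j + 2) \<noteq> L (j - 1)" "L (j - 2) \<noteq> L (j - 1)"
    using d[of 0 1] d[of 0 "-1"] d[of 0 2] d[of 0 "-2"] d[of 1 "-1"] d[of 1 2] d[of 1 "-2"] d[of "-1" 2]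
      d[of "-1" "-2"] d[of 2 "-2"] by auto
  have hl: "h \<noteq> L i" "L i \<noteq> h" "P k \<noteq> L i" "L i \<noteq> P k" for i k
    using hub_neq[OF sp] P_neq[of k i] by auto
  have hq: "h \<noteq> ?q" using j by simp
  let ?S = "{?q, L (j + 1), L (j - 1), L (j + 2), L (j - 2)}"
  define f :: "'a \<Rightarrow> int" where "f v = (if v = ?w then 2 else if v = ?q \<or> v = L (j + 1) \<or> v = L (j - 1) then 1
      else if v = h \<or> v = L (j + 2) \<or> v = L (j - 2) then 0 else -1)" for v
  have f: "f h = 0" "f ?w = 2" "f ?q = 1" "f (L (j + 1)) = 1" "f (L (j - 1)) = 1" "f (L (j + 2)) = 0" "f (L (j - 2)) = 0"
    using d' hl hq by (simp_all add: f_def)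
  have Nh: "nbrs E h = {L i | i. P i = h} \<union> {P i | i. P i \<noteq> h}"
    unfolding nbrs_E_internal[OF hub(2)[OF sp]] spider_hub_nbrs[OF sp] ..
  \<comment> \<open>A leaf outside the exceptional set is more than two rim steps from leaf j. The
    middle of another long leg is joined only to h and its own leaf, which is not next to leaf j
    because both rim neighbours of j hang on h.\<close>
  have far: "nbrs E u \<inter> nbrs E ?w = {}" if u: "u \<in> nbrs E h" "u \<notin> ?S" for u
  proof -
    consider i where "u = L i" "P i = h" | i where "u = P i" "P i \<noteq> h" using u(1) Nh by blast
    then show ?thesis
    proof cases
      case (1 i)
      have 11: "L (i + 1) \<noteq> L (j - 1)" using L_cong[of "i + 1" "j - 1" "-1"] u 1 by auto
      have 12: "L (i - 1) \<noteq> L (j + 1)" using L_cong[of "i - 1" "j + 1" 1] u 1 by (auto simp: add.assoc)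
      have 13: "L (i + 1) \<noteq> L (j + 1)" "L (i - 1) \<noteq> L (j - 1)"
        using L_cong[of "i + 1" "j + 1" "-1"] L_cong[of "i - 1" "j - 1" 1] 1 j(1) by auto
      show ?thesis using 1 11 12 13 nbrs_E_leaf[of i] nw hl hq by auto
    next
      case (2 i)
      then have "nbrs E u = {h, L i}" using spider_nbrs[OF sp, of i] nbrs_E_internal[OF P_internal] by simp
      moreover have "L i \<noteq> L (j + 1)" "L i \<noteq> L (j - 1)" using 2 j by auto
      ultimately show ?thesis using nw hl hq by auto
    qed
  qed
  have wh: "?w \<notin> nbrs E h"
    using Nh hl j(1) spider_inj[OF sp] by auto
  have nhh: "h \<notin> nbrs E h" using not_in_nbrs_self[OF simple_E] .
  have "int (deg E h) * (\<Sum>w\<in>nbrs E ?q. f w - f ?q) < int (deg E ?q) * (\<Sum>u\<in>nbrs E h. f u - f h)"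
  proof (rule test)
    have "h \<in> nbrs E ?q" using nq by simp
    then show "{h, ?q} \<in> E" "{h, ?q} \<in> E" by (simp_all add: nbrs_def)
    show "f ?q = f h + 1" using f by simp
    fix u w assume u: "u \<in> insert h (nbrs E h)" and w: "w \<in> insert ?q (nbrs E ?q)"
    have w': "w = h \<or> w = ?q \<or> w = ?w" using w nq by auto
    consider "u = h" | "u = ?q" | "u = L (j + 1) \<or> u = L (j - 1)" | "u = L (j + 2) \<or> u = L (j - 2)"
      | "u \<in> nbrs E h" "u \<notin> ?S" using u by blast
    then show "(f w > f u \<longrightarrow> u \<noteq> w) \<and> (f w > f u + 1 \<longrightarrow> {u, w} \<notin> E) \<and>
      (f w > f u + 2 \<longrightarrow> nbrs E u \<inter> nbrs E w = {}) \<and> f w \<le> f u + 3"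
    proof cases
      case 1
      have "{h, ?w} \<notin> E" using wh by (simp add: nbrs_def insert_commute)
      then show ?thesis using 1 w' f hl hq by auto
    next
      case 2 then show ?thesis using w' f hl by auto
    next
      case 3 then show ?thesis using w' f d' by auto
    next
      case 4
      have "L (j + 2) \<notin> nbrs E ?w" "L (j - 2) \<notin> nbrs E ?w" using nw d' hl by auto
      then have "{u, ?w} \<notin> E" using 4 by (auto simp: nbrs_def)
      then show ?thesis using 4 w' f d' hl by auto
    next
      case 5
      have uw: "u \<noteq> ?w" "u \<noteq> h" using 5 wh nhh by auto
      then have fu: "f u = -1" using 5 by (auto simp: f_def)
      have "u \<notin> nbrs E ?q" "u \<notin> nbrs E ?w" using nq nw uw 5 by auto
      then have "{u, ?q} \<notin> E" "{u, ?w} \<notin> E" by (simp_all add: nbrs_def)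
      then show ?thesis using w' f fu uw far[OF 5] 5 by auto
    qed
  qed
  moreover have "(\<Sum>w\<in>nbrs E ?q. f w - f ?q) = 0" using nq f hl by simp
  moreover have "(\<Sum>u\<in>nbrs E h. f u - f h) = 8 - m"
  proof -
    have S: "?S \<subseteq> nbrs E h" unfolding Nh using j by auto
    have "f v = -1" if "v \<in> nbrs E h - ?S" for v
    proof -
      have "v \<noteq> ?w" "v \<noteq> h" using that wh nhh by auto
      then show ?thesis using that by (auto simp: f_def)
    qed
    then have "(\<Sum>u\<in>nbrs E h. f u) = (\<Sum>u\<in>?S. f u) - (m - int (card ?S))"
      using hub_sum[OF S finite_nbrs[OF simple_E], of f] spider_hub_degree[OF sp] by simp
    moreover have "(\<Sum>u\<in>?S. f u) = 3" "card ?S = 5" using f d' hl by simp_all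
    ultimately show ?thesis using f by simp
  qed
  moreover have "deg E ?q = 2" using nq hl by (simp add: deg_def)
  ultimately show ?thesis by simp
qed

end

section \<open>The list of graphs\<close>

definition halin_list :: "'a set \<Rightarrow> 'a set set \<Rightarrow> bool" where
  "halin_list V E \<longleftrightarrow>
    (\<exists>n. 4 \<le> n \<and> n \<le> 12 \<and> graph_iso V E (wheelV n) (wheelE n)) \<or>
    (\<exists>n. 5 \<le> n \<and> n \<le> 9 \<and> graph_iso V E (wheel1V n) (wheel1E n)) \<or>
    (\<exists>n. 6 \<le> n \<and> n \<le> 10 \<and> graph_iso V E (wheel2V n) (wheel2E n)) \<or>
    (\<exists>i. 1 \<le> i \<and> i \<le> 8 \<and> graph_iso V E (HV i) (HE i))"

lemma halin_list_card:
  assumes "halin_list V E" shows "card V \<le> 12"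
proof -
  have c: "card V = card V'" if "graph_iso V E V' E'" for V' :: "nat set" and E'
    using that bij_betw_same_card unfolding graph_iso_def by blast
  consider n where "n \<le> 12" "graph_iso V E (wheelV n) (wheelE n)"
    | n where "n \<le> 9" "graph_iso V E (wheel1V n) (wheel1E n)"
    | n where "n \<le> 10" "graph_iso V E (wheel2V n) (wheel2E n)"
    | i where "graph_iso V E (HV i) (HE i)"
    using assms unfolding halin_list_def by blast
  then show ?thesis
  proof cases
    case (1 n) then show ?thesis using c[OF 1(2)] by (simp add: wheelV_def)
  next
    case (2 n) then show ?thesis using c[OF 2(2)] by (simp add: wheel1V_def)
  next
    case (3 n) then show ?thesis using c[OF 3(2)] by (simp add: wheel2V_def)
  next
    case (4 i) then show ?thesis using c[OF 4] by (simp add: HV_def)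
  qed
qed

lemma HE_8: "HE 8 = mkE [(0,7),(7,5),(0,1),(0,4),(0,6),(1,2),(1,3),(2,3),(3,4),(4,5),(5,6),(6,2)]"
proof -
  have "HE 8 = subdiv H7E 0 5 7" by (simp add: HE_def)
  also have "\<dots> = mkE [(0,7),(7,5),(0,1),(0,4),(0,6),(1,2),(1,3),(2,3),(3,4),(4,5),(5,6),(6,2)]"
    unfolding subdiv_def H7E_def mkE_def by (simp add: insert_Diff_if doubleton_eq_iff)
  finally show ?thesis .
qed

lemma halin_listI:
  assumes "1 \<le> i" "i \<le> 8" "distinct xs" "set xs = V" "HV i = {0..<length xs}" "HE i = mkE ps"
    "E = set (map (\<lambda>(a, b). {xs ! a, xs ! b}) ps)"
    "\<forall>(a, b)\<in>set ps. a < length xs \<and> b < length xs"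
  shows "halin_list V E"
proof -
  have "graph_iso V E (HV i) (HE i)"
    using graph_iso_mkE[OF assms(3,4,7,8)] assms(5,6) by simp
  then show ?thesis using assms(1,2) unfolding halin_list_def by blast
qed

context positive_halin
begin

lemma wheel_listed:
  assumes "spider h" "\<And>i. P i = h" "m \<le> 11"
  shows "halin_list V E"
  using spider_iso_wheel[OF assms(1,2)] assms(3) m_ge
  unfolding halin_list_def by (intro disjI1 exI[of _ "Suc (nat m)"]) auto

lemma wheel1_listed:
  assumes "spider h" "\<And>i. P i \<noteq> h \<longleftrightarrow> L i = L s" "m \<le> 7"
  shows "halin_list V E"
proof -
  have "5 \<le> nat m + 2 \<and> nat m + 2 \<le> 9" using assms(3) m_ge by auto
  then show ?thesis using spider_iso_wheel1[OF assms(1,2)] unfolding halin_list_def by blast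
qed

text \<open>With n = m + 3 the second subdivided spoke is the one numbered ceiling of (m + 1) / 2,
  which is m div 2 + 1 and hence lies m div 2 steps after the first.\<close>

lemma wheel2_listed:
  assumes "spider h" "\<And>i. P i \<noteq> h \<longleftrightarrow> L i = L s \<or> L i = L (s + int k)"
    and "0 < k" "int k < m" "m \<le> 7" "int k = m div 2"
  shows "halin_list V E"
proof -
  have "Suc k = nat \<lceil>real (nat m + 1) / 2\<rceil>"
  proof -
    have "m = 3 \<or> m = 4 \<or> m = 5 \<or> m = 6 \<or> m = 7" using m_ge assms(5) by auto
    then show ?thesis using assms(6) by (auto simp: ceiling_divide_eq_div numeral_eq_Suc)
  qed
  moreover have "6 \<le> nat m + 3 \<and> nat m + 3 \<le> 10" "k < nat m" using assms(4,5) m_ge by auto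
  ultimately show ?thesis using spider_iso_wheel2[OF assms(1,2,3)] unfolding halin_list_def by blast
qed

text \<open>A long leg forces m to be 6 or 7, and two long legs are at least three steps apart in
  both directions. So there are at most two of them, as nearly opposite as possible.\<close>

lemma listed_ge6:
  assumes m: "m \<ge> 6"
  shows "halin_list V E"
proof -
  obtain h s0 where s0: "P s0 = h"
    and iso: "\<And>i. P i \<noteq> h \<Longrightarrow> P (i - 1) = h \<and> P (i + 1) = h \<and> P (i - 2) = h \<and> P (i + 2) = h"
    using large_hub[OF m] by fast
  have sp: "spider h" using spider_intro[OF _ s0] iso m by simp
  show ?thesis
  proof (cases "\<forall>i. P i = h")
    case True
    then show ?thesis using wheel_bound[OF sp] m by (intro wheel_listed[OF sp]) auto
  next
    case False
    then obtain j where j: "P j \<noteq> h" by blast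
    have m7: "m \<le> 7" using long_leg_bound[OF sp j] iso[OF j] m by blast
    have offset: "t = 0 \<or> t = 3 \<or> t = 4 \<and> m = 7"
      if "P s \<noteq> h" "P (s + t) \<noteq> h" "0 \<le> t" "t < m" for s t
    proof -
      have "P (s + (m - 1)) = P (s - 1)" "P (s + (m - 2)) = P (s - 2)"
        using L_period[of "s - 1"] L_period[of "s - 2"] by (simp_all add: algebra_simps)
      then have "t \<noteq> 1" "t \<noteq> 2" "t \<noteq> m - 1" "t \<noteq> m - 2" using iso[OF that(1)] that(2) by auto
      then show ?thesis using m m7 that(3,4) by auto
    qed
    show ?thesis
    proof (cases "\<forall>i. P i \<noteq> h \<longrightarrow> L i = L j")
      case True
      have "P i \<noteq> h \<longleftrightarrow> L i = L j" for i using True j by metis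
      then show ?thesis using wheel1_listed[OF sp _ m7] by blast
    next
      case False
      then obtain i where i: "P i \<noteq> h" "L i \<noteq> L j" by blast
      obtain t where t: "0 \<le> t" "t < m" "L i = L (j + t)" using L_reduce by blast
      have Pt: "P (j + t) \<noteq> h" using i t by simp
      \<comment> \<open>An offset 4 occurs only for m = 7; counted from the other long leg it is
        3.\<close>
      have "\<exists>s. P s \<noteq> h \<and> P (s + 3) \<noteq> h"
      proof -
        consider "t = 0" | "t = 3" | "t = 4" "m = 7" using offset[OF j Pt t(1,2)] by blast
        then show ?thesis
        proof cases
          case 1 then show ?thesis using i t by simp
        next
          case 2 then show ?thesis using j Pt by blast
        next
          case 3
          have "P (j + 4 + 3) = P j" using L_period[of j] 3 by (simp add: add.assoc)
          then show ?thesis using j Pt 3 by (metis (full_types))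
        qed
      qed
      then obtain s where s: "P s \<noteq> h" "P (s + 3) \<noteq> h" by blast
      have s4: "P (s + 4) = h" using iso[OF s(2)] by (simp add: add.assoc)
      have "P i \<noteq> h \<longleftrightarrow> L i = L s \<or> L i = L (s + int 3)" for i
      proof
        assume i: "P i \<noteq> h"
        obtain t where t: "0 \<le> t" "t < m" "L i = L (s + t)" using L_reduce by blast
        have "P (s + t) \<noteq> h" using i t by simp
        then have "t = 0 \<or> t = 3" using offset[OF s(1) _ t(1,2)] s4 by auto
        then show "L i = L s \<or> L i = L (s + int 3)" using t(3) by auto
      next
        assume "L i = L s \<or> L i = L (s + int 3)"
        then show "P i \<noteq> h" using s by auto
      qed
      then show ?thesis using m m7 by (intro wheel2_listed[OF sp, of s 3]) auto
    qed
  qed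
qed

section \<open>Five leaves\<close>

lemma cycle_Union: "(\<Union>i. F (L i) (L (i + 1))) = (\<Union>t\<in>{0..<m}. F (L (s + t)) (L (s + t + 1)))"
proof (intro equalityI subsetI)
  fix e assume "e \<in> (\<Union>i. F (L i) (L (i + 1)))"
  then obtain i where i: "e \<in> F (L i) (L (i + 1))" by blast
  obtain t where t: "0 \<le> t" "t < m" "L i = L (s + t)" using L_reduce by blast
  then have "e \<in> F (L (s + t)) (L (s + t + 1))" using i L_cong[OF t(3), of 1] by simp
  then show "e \<in> (\<Union>t\<in>{0..<m}. F (L (s + t)) (L (s + t + 1)))" using t by auto
qed blast

lemma V_ge5: "m \<ge> 5 \<Longrightarrow> V = (\<Union>i. {L i, P i})"
proof (intro equalityI subsetI)
  fix v assume m: "m \<ge> 5" and v: "v \<in> V"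
  show "v \<in> (\<Union>i. {L i, P i})"
  proof (cases "is_leaf T v")
    case True then show ?thesis using leaf_obtain v by blast
  next
    case False
    obtain u where u: "u \<in> nbrs T v" using nbrs_T_nonempty[OF v] by blast
    then have uv: "{v, u} \<in> T" "u \<in> V" using nbrs_subset[OF simple_T, of v] by (auto simp: nbrs_def insert_commute)
    show ?thesis
    proof (cases "is_leaf T u")
      case True
      then obtain i where "u = L i" using leaf_obtain uv by blast
      then show ?thesis using uv by (auto simp: leaf_edge_iff')
    next
      case u: False
      obtain i where "P i = v" using internal_edge_crossing[OF m uv(1) False u] by blast
      then show ?thesis by blast
    qed
  qed
qed (use L_in P_in in auto)

text \<open>The cyclic sequence of parents determines the graph: consecutive distinct parents are
  adjacent, and conversely each internal edge is met between two consecutive leaves.\<close>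

lemma E_ge5:
  assumes m: "m \<ge> 5"
  shows "E = (\<Union>i. {{P i, L i}, {L i, L (i + 1)}} \<union> (if P i = P (i + 1) then {} else {{P i, P (i + 1)}}))"
    (is "E = ?R")
proof (intro equalityI subsetI)
  fix e assume e: "e \<in> E"
  then obtain u v where uv: "e = {u, v}" using simple_E by (auto simp: simple_graph_def)
  consider "{u, v} \<in> T" | i where "e = {L i, L (i + 1)}" using e uv by (auto simp: E_def)
  then show "e \<in> ?R"
  proof cases
    case 1
    then have V: "u \<in> V" "v \<in> V" "u \<noteq> v" using edge_verts[OF simple_T] by blast+
    consider "is_leaf T u" | "is_leaf T v" | "\<not> is_leaf T u" "\<not> is_leaf T v" by blast
    then show ?thesis
    proof cases
      assume "is_leaf T u"
      then obtain i where "u = L i" using leaf_obtain V by blast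
      then have "e = {P i, L i}" using 1 uv by (auto simp: leaf_edge_iff)
      then show ?thesis by blast
    next
      assume "is_leaf T v"
      then obtain i where "v = L i" using leaf_obtain V by blast
      then have "e = {P i, L i}" using 1 uv by (auto simp: leaf_edge_iff')
      then show ?thesis by blast
    next
      assume "\<not> is_leaf T u" "\<not> is_leaf T v"
      then obtain i where "P i = u" "P (i + 1) = v" using internal_edge_crossing[OF m 1] by blast
      then have "e \<in> (if P i = P (i + 1) then {} else {{P i, P (i + 1)}})" using uv V by simp
      then show ?thesis by blast
    qed
  next
    case (2 i) then show ?thesis by blast
  qed
next
  fix e assume "e \<in> ?R"
  then obtain i where i: "e \<in> {{P i, L i}, {L i, L (i + 1)}} \<union>
      (if P i = P (i + 1) then {} else {{P i, P (i + 1)}})" by blast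
  have "e = {P i, L i} \<or> e = {L i, L (i + 1)} \<or> e = {P i, P (i + 1)} \<and> P i \<noteq> P (i + 1)"
    using i by (cases "P i = P (i + 1)") auto
  then show "e \<in> E"
    using T_sub_E[OF leaf_edge(2)[of i]] rim_edge[of i] T_sub_E[OF parents_adjacent[OF m, of i]] by blast
qed

text \<open>An internal edge crossed by the leaf cycle in one direction has to be crossed back in
  the other.\<close>

lemma reverse_step:
  assumes m: "m \<ge> 5" and ne: "P i \<noteq> P (i + 1)"
  obtains t where "0 \<le> t" "t < m" "P (s + t) = P (i + 1)" "P (s + t + 1) = P i"
proof -
  have "{P (i + 1), P i} \<in> T" using parents_adjacent[OF m ne] by (simp add: insert_commute)
  then obtain j where j: "P j = P (i + 1)" "P (j + 1) = P i"
    using internal_edge_crossing[OF m _ P_internal P_internal] by blast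
  obtain t where t: "0 \<le> t" "t < m" "L j = L (s + t)" using L_reduce by blast
  then show thesis using that[of t] j L_cong[OF t(3), of 1] by simp
qed

text \<open>The argument runs over the cyclic patterns of five parents, restricted by
  \<open>reverse_step\<close> and by the absence of alternations. \<open>outer_parents\<close> is
  not at hand here since it needs six leaves.\<close>

lemma listed_5:
  assumes m: "m = 5"
  shows "halin_list V E"
proof -
  have m5: "m \<ge> 5" using m by simp
  have per: "L (s + 5) = L s" "L (s + 6) = L (s + 1)"
    and per': "L (s + 7) = L (s + 2)" "L (s + 8) = L (s + 3)" for s
    using L_period[of s] L_period[of "s + 1"] L_period[of "s + 2"] L_period[of "s + 3"] m
    by (simp_all add: add.assoc)
  have rs: "P s = P (i + 1) \<and> P (s + 1) = P i \<or> P (s + 1) = P (i + 1) \<and> P (s + 2) = P i \<or>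
      P (s + 2) = P (i + 1) \<and> P (s + 3) = P i \<or> P (s + 3) = P (i + 1) \<and> P (s + 4) = P i \<or>
      P (s + 4) = P (i + 1) \<and> P s = P i" if ne: "P i \<noteq> P (i + 1)" for i s
  proof -
    obtain t where t: "0 \<le> t" "t < m" "P (s + t) = P (i + 1)" "P (s + t + 1) = P i"
      using reverse_step[OF m5 ne] .
    then have "t = 0 \<or> t = 1 \<or> t = 2 \<or> t = 3 \<or> t = 4" using m by auto
    then show ?thesis using t per by (auto simp: add.assoc)
  qed
  have alt: "P s = P (s + 1)" if "P s = P (s + 2)" "P (s + 1) = P (s + 3)" for s
    using that m by (intro no_alternation_eq[of s "s + 1" "s + 2" "s + 3"]) auto
  \<comment> \<open>Some two cyclically consecutive parents agree. Otherwise a crossing can only be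
    undone by \<open>P (s + 2) = P s\<close> or by \<open>P (s + 4) = P (s + 1)\<close>. The first
    leads to an alternation; the second is the first one for the start s + 4.\<close>
  have "\<exists>s. P s = P (s + 4)"
  proof (rule ccontr)
    assume "\<not> ?thesis"
    then have n4: "P s \<noteq> P (s + 4)" for s by blast
    have n1: "P s \<noteq> P (s + 1)" for s using n4[of "s + 1"] per[of s] by (auto simp: add.assoc)
    have n1': "P (s + 1) \<noteq> P (s + 2)" "P (s + 2) \<noteq> P (s + 3)" "P (s + 3) \<noteq> P (s + 4)" for s
      using n1[of "s + 1"] n1[of "s + 2"] n1[of "s + 3"] by (auto simp: add.assoc)
    have pat: "P (s + 2) = P s \<or> P (s + 4) = P (s + 1)" for s
      using rs[OF n1[of s], of s] n1[of s] n1'[of s] n4[of s] by auto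
    have no2: "P (s + 2) \<noteq> P s" for s
    proof
      assume 2: "P (s + 2) = P s"
      have "P (s + 4) = P (s + 2) \<or> P (s + 1) = P (s + 3)"
        using pat[of "s + 2"] per[of s] by (auto simp: add.assoc)
      then have "P (s + 1) = P (s + 3)" using n4[of s] 2 by auto
      then show False using alt[of s] 2 n1[of s] by simp
    qed
    then have "P (0 + 4) = P (0 + 1)" using pat[of 0] by blast
    then show False using no2[of "4"] per[of 1] by (simp add: add.assoc)
  qed
  then obtain s where s: "P s = P (s + 4)" by blast
  define h where "h = P s"
  let ?a = "P (s + 1)" and ?b = "P (s + 2)" and ?c = "P (s + 3)"
  have h: "P s = h" "P (s + 4) = h" using s by (auto simp: h_def)
  \<comment> \<open>For the pattern h, a, b, c, h these say which later steps undo the step from h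
    to a and the step from a to b.\<close>
  have r0: "h \<noteq> ?a \<Longrightarrow> ?b = h \<or> ?c = ?a \<or> ?b = ?a \<and> ?c = h"
    using rs[of s s] h by auto
  have r1: "?a \<noteq> ?b \<Longrightarrow> ?b = h \<or> ?c = ?a \<or> ?a = h \<and> ?c = ?b"
    using rs[of "s + 1" s] h by (auto simp: add.assoc)
  have cover: "\<exists>t\<in>{0, 1, 2, 3, 4}. L i = L (s + t)" for i
  proof -
    obtain t where "0 \<le> t" "t < m" "L i = L (s + t)" using L_reduce by blast
    moreover from this have "t \<in> {0, 1, 2, 3, 4}" using m by auto
    ultimately show ?thesis by blast
  qed
  have nb: "P (s + t) \<noteq> h \<Longrightarrow> P (s + t - 1) = h \<and> P (s + t + 1) = h \<Longrightarrow> L i = L (s + t) \<Longrightarrow>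
       P (i - 1) = h \<and> P (i + 1) = h" for i t
    using L_cong[of i "s + t" 1] L_cong[of i "s + t" "-1"] by simp
  have I5: "{0..<m} = {0, 1, 2, 3, 4}" using m by auto
  have Vs: "V = {L r, L (r + 1), L (r + 2), L (r + 3), L (r + 4), P r, P (r + 1), P (r + 2), P (r + 3), P (r + 4)}" for r
    using V_ge5[OF m5] cycle_Union[of "\<lambda>l _. {l, leaf_parent T l}" r] unfolding I5 by auto
  have Es: "E = ({{P r, L r}, {L r, L (r + 1)}} \<union> (if P r = P (r + 1) then {} else {{P r, P (r + 1)}})) \<union>
      (({{P (r + 1), L (r + 1)}, {L (r + 1), L (r + 2)}} \<union> (if P (r + 1) = P (r + 2) then {} else {{P (r + 1), P (r + 2)}})) \<union>
      (({{P (r + 2), L (r + 2)}, {L (r + 2), L (r + 3)}} \<union> (if P (r + 2) = P (r + 3) then {} else {{P (r + 2), P (r + 3)}})) \<union>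
      (({{P (r + 3), L (r + 3)}, {L (r + 3), L (r + 4)}} \<union> (if P (r + 3) = P (r + 4) then {} else {{P (r + 3), P (r + 4)}})) \<union>
      (({{P (r + 4), L (r + 4)}, {L (r + 4), L r}} \<union> (if P (r + 4) = P r then {} else {{P (r + 4), P r}}))))))" for r
    unfolding E_ge5[OF m5]
      cycle_Union[of "\<lambda>l l'. {{leaf_parent T l, l}, {l, l'}} \<union>
        (if leaf_parent T l = leaf_parent T l' then {} else {{leaf_parent T l, leaf_parent T l'}})" r] I5
    by (simp add: add.assoc per cong: if_cong split del: if_split)
  have PL: "P i \<noteq> L j" "L j \<noteq> P i" for i j using P_neq by metis+
  have dd: "L r \<noteq> L (r + 1)" "L r \<noteq> L (r + 2)" "L r \<noteq> L (r + 3)" "L r \<noteq> L (r + 4)"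
    "L (r + 1) \<noteq> L (r + 2)" "L (r + 1) \<noteq> L (r + 3)" "L (r + 1) \<noteq> L (r + 4)"
    "L (r + 2) \<noteq> L (r + 3)" "L (r + 2) \<noteq> L (r + 4)" "L (r + 3) \<noteq> L (r + 4)" for r
    using m L_neq[of r "r + 1"] L_neq[of r "r + 2"] L_neq[of r "r + 3"] L_neq[of r "r + 4"]
      L_neq[of "r + 1" "r + 2"] L_neq[of "r + 1" "r + 3"] L_neq[of "r + 1" "r + 4"]
      L_neq[of "r + 2" "r + 3"] L_neq[of "r + 2" "r + 4"] L_neq[of "r + 3" "r + 4"] by simp_all
  have H7: "halin_list V E"
    if p: "P r = x" "P (r + 1) = x" "P (r + 2) = x" "P (r + 3) = y" "P (r + 4) = y" and xy: "x \<noteq> y" for r x y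
  proof (rule halin_listI[of 7 "[x, y, L (r + 3), L (r + 4), L r, L (r + 1), L (r + 2)]"])
    have xL: "x \<noteq> L j" "y \<noteq> L j" for j using PL p by blast+
    show "distinct [x, y, L (r + 3), L (r + 4), L r, L (r + 1), L (r + 2)]"
      using xL xy dd[of r] dd[of r, symmetric] by simp
    show "set [x, y, L (r + 3), L (r + 4), L r, L (r + 1), L (r + 2)] = V"
      unfolding Vs[of r] p by auto
    show "HE 7 = mkE [(0,1),(0,4),(0,5),(0,6),(1,2),(1,3),(2,3),(3,4),(4,5),(5,6),(6,2)]"
      by (simp add: HE_def H7E_def)
    show "E = set (map (\<lambda>(a, b). {[x, y, L (r + 3), L (r + 4), L r, L (r + 1), L (r + 2)] ! a,
        [x, y, L (r + 3), L (r + 4), L r, L (r + 1), L (r + 2)] ! b})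
        [(0,1),(0,4),(0,5),(0,6),(1,2),(1,3),(2,3),(3,4),(4,5),(5,6),(6,2)])"
      unfolding Es[of r] p using xy by (simp add: insert_commute)
  qed (auto simp: HV_def)
  have H8: "halin_list V E"
    if p: "P r = x" "P (r + 1) = z" "P (r + 2) = x" "P (r + 3) = y" "P (r + 4) = y"
      and xyz: "x \<noteq> y" "x \<noteq> z" "y \<noteq> z" for r x y z
  proof (rule halin_listI[of 8 "[x, y, L (r + 3), L (r + 4), L r, L (r + 1), L (r + 2), z]"])
    have xL: "x \<noteq> L j" "y \<noteq> L j" "L j \<noteq> z" for j using PL p by blast+
    show "distinct [x, y, L (r + 3), L (r + 4), L r, L (r + 1), L (r + 2), z]"
      using xL xyz dd[of r] dd[of r, symmetric] by simp
    show "set [x, y, L (r + 3), L (r + 4), L r, L (r + 1), L (r + 2), z] = V"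
      unfolding Vs[of r] p by auto
    show "HE 8 = mkE [(0,7),(7,5),(0,1),(0,4),(0,6),(1,2),(1,3),(2,3),(3,4),(4,5),(5,6),(6,2)]" by (rule HE_8)
    show "E = set (map (\<lambda>(a, b). {[x, y, L (r + 3), L (r + 4), L r, L (r + 1), L (r + 2), z] ! a,
        [x, y, L (r + 3), L (r + 4), L r, L (r + 1), L (r + 2), z] ! b})
        [(0,7),(7,5),(0,1),(0,4),(0,6),(1,2),(1,3),(2,3),(3,4),(4,5),(5,6),(6,2)])"
      unfolding Es[of r] p using xyz by (simp add: insert_commute)
  qed (auto simp: HV_def)
  have spid: "spider h"
    if p: "?a \<noteq> h \<Longrightarrow> ?b = h" "?b \<noteq> h \<Longrightarrow> ?a = h \<and> ?c = h" "?c \<noteq> h \<Longrightarrow> ?b = h"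
  proof (rule spider_intro[OF m5 h(1)])
    fix i assume i: "P i \<noteq> h"
    obtain t where t: "t \<in> {0, 1, 2, 3, 4}" "L i = L (s + t)" using cover by blast
    have "P (s + t) \<noteq> h" using i t by simp
    then consider "t = 1" "?a \<noteq> h" | "t = 2" "?b \<noteq> h" | "t = 3" "?c \<noteq> h" using t(1) h by fastforce
    then have "P (s + t - 1) = h \<and> P (s + t + 1) = h"
    proof cases
      case 1
      then have "s + t - 1 = s" "s + t + 1 = s + 2" by simp_all
      then show ?thesis using p(1)[OF 1(2)] h by (simp add: add.commute)
    next
      case 2
      then have "s + t - 1 = s + 1" "s + t + 1 = s + 3" by simp_all
      then show ?thesis using p(2)[OF 2(2)] by (simp add: add.commute)
    next
      case 3
      then have "s + t - 1 = s + 2" "s + t + 1 = s + 4" by simp_all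
      then show ?thesis using p(3)[OF 3(2)] h by (simp add: add.commute)
    qed
    then show "P (i - 1) = h \<and> P (i + 1) = h" using nb[OF \<open>P (s + t) \<noteq> h\<close> _ t(2)] by blast
  qed
  have char: "P i \<noteq> h \<longleftrightarrow> (?a \<noteq> h \<and> L i = L (s + 1)) \<or> (?b \<noteq> h \<and> L i = L (s + 2)) \<or> (?c \<noteq> h \<and> L i = L (s + 3))" for i
  proof
    assume i: "P i \<noteq> h"
    obtain t where t: "t \<in> {0, 1, 2, 3, 4}" "L i = L (s + t)" using cover by blast
    then show "(?a \<noteq> h \<and> L i = L (s + 1)) \<or> (?b \<noteq> h \<and> L i = L (s + 2)) \<or> (?c \<noteq> h \<and> L i = L (s + 3))"
      using i h by auto
  qed auto
  \<comment> \<open>Cases 1 to 5 are spiders. In cases 6 to 8 the leaves form blocks of sizes 3 and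
    2 at two adjacent parents, which is \<open>H_7\<close>. In case 9 the middle leaf of the block
    of three has a parent of its own, which is \<open>H_8\<close>.\<close>
  consider "?a = h" "?b = h" "?c = h" | "?a \<noteq> h" "?b = h" "?c = h" | "?a = h" "?b \<noteq> h" "?c = h"
    | "?a = h" "?b = h" "?c \<noteq> h" | "?a \<noteq> h" "?b = h" "?c \<noteq> h"
    | "?a \<noteq> h" "?b = ?a" "?c = h" | "?a = h" "?b \<noteq> h" "?c = ?b" | "?a \<noteq> h" "?b = ?a" "?c = ?a"
    | "?a \<noteq> h" "?b \<noteq> h" "?b \<noteq> ?a" "?c = ?a"
    using r0 r1 by metis
  then show ?thesis
  proof cases
    case 1
    then have "P i = h" for i using char[of i] by auto
    then show ?thesis using wheel_listed[OF spid] 1 m by auto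
  next
    case 2
    have "P i \<noteq> h \<longleftrightarrow> L i = L (s + 1)" for i using char[of i] 2 by auto
    then show ?thesis using wheel1_listed[OF spid, of "s + 1"] 2 m by auto
  next
    case 3
    have "P i \<noteq> h \<longleftrightarrow> L i = L (s + 2)" for i using char[of i] 3 by auto
    then show ?thesis using wheel1_listed[OF spid, of "s + 2"] 3 m by auto
  next
    case 4
    have "P i \<noteq> h \<longleftrightarrow> L i = L (s + 3)" for i using char[of i] 4 by auto
    then show ?thesis using wheel1_listed[OF spid, of "s + 3"] 4 m by auto
  next
    case 5
    have "P i \<noteq> h \<longleftrightarrow> L i = L (s + 1) \<or> L i = L (s + 1 + int 2)" for i
      using char[of i] 5 by (auto simp: add.assoc)
    then show ?thesis using wheel2_listed[OF spid, of "s + 1" 2] 5 m by auto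
  next
    case 6
    then show ?thesis using H7[of "s + 3" h ?a] h per per' by (auto simp: add.assoc)
  next
    case 7
    then show ?thesis using H7[of "s + 4" h ?b] h per per' by (auto simp: add.assoc)
  next
    case 8
    then show ?thesis using H7[of "s + 1" ?a h] h per per' by (auto simp: add.assoc)
  next
    case 9
    then show ?thesis using H8[of "s + 1" ?a ?b h] h per per' by (auto simp: add.assoc)
  qed
qed

end

section \<open>Three or four leaves\<close>

lemma card_2_member: "card A = 2 \<Longrightarrow> a \<in> A \<Longrightarrow> \<exists>b. b \<noteq> a \<and> A = {a, b}"
  by (auto simp: card_2_iff)

lemma card_3_member:
  assumes "card A = 3" "a \<in> A" shows "\<exists>b c. distinct [a, b, c] \<and> A = {a, b, c}"
proof -
  have "card (A - {a}) = 2" using assms by (simp add: card_Diff_singleton_if)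
  then obtain b c where "A - {a} = {b, c}" "b \<noteq> c" by (auto simp: card_2_iff)
  moreover from this have "A = {a, b, c}" "a \<noteq> b" "a \<noteq> c" using assms(2) by auto
  ultimately show ?thesis by auto
qed

lemma pairs_3:
  assumes "distinct [a, b, c]"
  shows "{{u, v} | u v. u \<in> {a, b, c} \<and> v \<in> {a, b, c} \<and> u \<noteq> v} = {{a, b}, {b, c}, {c, a}}"
proof (intro equalityI subsetI)
  fix e assume "e \<in> {{a, b}, {b, c}, {c, a}}"
  then show "e \<in> {{u, v} | u v. u \<in> {a, b, c} \<and> v \<in> {a, b, c} \<and> u \<noteq> v}"
    using assms by (simp, metis)
qed (auto simp: insert_commute)

context positive_halin
begin

text \<open>Each internal vertex has nonnegative excess over degree 2, so the two chosen ones use up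
  at most the total m - 2.\<close>

lemma excess_two:
  assumes "x \<in> V" "\<not> is_leaf T x" "y \<in> V" "\<not> is_leaf T y" "x \<noteq> y"
  shows "int (deg T x) + int (deg T y) \<le> m + 2"
proof -
  have "(\<Sum>v\<in>{x, y}. int (deg T v) - 2) \<le> (\<Sum>v\<in>{v \<in> V. \<not> is_leaf T v}. int (deg T v) - 2)"
    using assms finite_V by (intro sum_mono2) (auto dest: deg_internal)
  then show ?thesis using assms degree_excess by simp
qed

lemma excess_three:
  assumes "x \<in> V" "\<not> is_leaf T x" "y \<in> V" "\<not> is_leaf T y" "z \<in> V" "\<not> is_leaf T z" "distinct [x, y, z]"
  shows "int (deg T x) + int (deg T y) + int (deg T z) \<le> m + 4"
proof -
  have "(\<Sum>v\<in>{x, y, z}. int (deg T v) - 2) \<le> (\<Sum>v\<in>{v \<in> V. \<not> is_leaf T v}. int (deg T v) - 2)"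
    using assms finite_V by (intro sum_mono2) (auto dest: deg_internal)
  then show ?thesis using assms degree_excess by simp
qed

lemma excess_one:
  assumes "x \<in> V" "\<not> is_leaf T x" and two: "\<And>v. v \<in> V \<Longrightarrow> \<not> is_leaf T v \<Longrightarrow> v \<noteq> x \<Longrightarrow> deg T v = 2"
  shows "int (deg T x) = m"
proof -
  have "(\<Sum>v\<in>{v \<in> V. \<not> is_leaf T v}. int (deg T v) - 2) = (\<Sum>v\<in>{x}. int (deg T v) - 2)"
    using assms finite_V by (intro sum.mono_neutral_right) auto
  then show ?thesis using degree_excess by simp
qed

lemma hub_obtain:
  obtains h where "h \<in> V" "\<not> is_leaf T h" "deg T h \<ge> 3"
proof -
  obtain h where "h \<in> V" "deg T h \<ge> 3" using branching by blast
  then show thesis using that[of h] by (simp add: is_leaf_def)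
qed

lemma degree2_nbrs:
  assumes "deg T y = 2" "x \<in> nbrs T y"
  obtains w where "w \<noteq> x" "nbrs T y = {x, w}"
  using assms card_2_member[of "nbrs T y" x] by (auto simp: deg_def)

lemma nbr_in: "u \<in> nbrs T v \<Longrightarrow> u \<in> V" using nbrs_subset[OF simple_T] by blast

lemma leaf_nbrs:
  assumes "is_leaf T v" "u \<in> nbrs T v" shows "nbrs T v = {u}"
  using assms by (auto simp: is_leaf_def deg_def card_1_singleton_iff)

lemma leaves_in_V: "V = S \<Longrightarrow> range L = {v \<in> S. is_leaf T v}" using leaves by simp

text \<open>A cycle through three leaves joins every pair of them, so the cyclic order carries no
  information.\<close>

lemma rim_3:
  assumes m: "m = 3" and abc: "range L = {a, b, c}" "distinct [a, b, c]"
  shows "range (\<lambda>i. {L i, L (i + 1)}) = {{a, b}, {b, c}, {c, a}}"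
proof -
  have "{0..<m} = {0, 1, 2}" using m by auto
  moreover have "L 3 = L 0" using L_period[of 0] m by simp
  ultimately have r: "range (\<lambda>i. {L i, L (i + 1)}) = {{L 0, L 1}, {L 1, L 2}, {L 2, L 0}}"
      "range L = {L 0, L 1, L 2}"
    using rim_shift[of 0] range_L[of 0] by auto
  have "L 0 \<noteq> L 1" "L 0 \<noteq> L 2" "L 1 \<noteq> L 2"
    using m L_neq[of 0 1] L_neq[of 0 2] L_neq[of 1 2] by simp_all
  then have "range (\<lambda>i. {L i, L (i + 1)}) = {{u, v} | u v. u \<in> range L \<and> v \<in> range L \<and> u \<noteq> v}"
    unfolding r by (subst pairs_3) auto
  also have "\<dots> = {{a, b}, {b, c}, {c, a}}" unfolding abc(1) using abc(2) by (rule pairs_3)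
  finally show ?thesis .
qed

lemma cover_3: "m = 3 \<Longrightarrow> L i = L s \<or> L i = L (s + 1) \<or> L i = L (s + 2)"
proof -
  assume m: "m = 3"
  obtain t where "0 \<le> t" "t < m" "L i = L (s + t)" using L_reduce by blast
  moreover from this have "t = 0 \<or> t = 1 \<or> t = 2" using m by auto
  ultimately show ?thesis by auto
qed

lemma cover_4: "m = 4 \<Longrightarrow> L i = L s \<or> L i = L (s + 1) \<or> L i = L (s + 2) \<or> L i = L (s + 3)"
proof -
  assume m: "m = 4"
  obtain t where "0 \<le> t" "t < m" "L i = L (s + t)" using L_reduce by blast
  moreover from this have "t = 0 \<or> t = 1 \<or> t = 2 \<or> t = 3" using m by auto
  ultimately show ?thesis by auto
qed

section \<open>Three leaves\<close>

lemma spider_3_listed: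
  assumes m: "m = 3" and sp: "spider h"
  shows "halin_list V E"
proof -
  have per: "L (s + 3) = L s" "L (s + 4) = L (s + 1)" for s
    using L_period[of s] L_period[of "s + 1"] m by (simp_all add: add.assoc)
  have char: "P i \<noteq> h \<longleftrightarrow> (P s \<noteq> h \<and> L i = L s) \<or> (P (s + 1) \<noteq> h \<and> L i = L (s + 1)) \<or>
      (P (s + 2) \<noteq> h \<and> L i = L (s + 2))" for i s
    using cover_3[OF m, of i s] by metis
  have one: "halin_list V E" if "P s \<noteq> h" "P (s + 1) = h" "P (s + 2) = h" for s
  proof -
    have "P i \<noteq> h \<longleftrightarrow> L i = L s" for i using char[of i s] that by blast
    then show ?thesis using wheel1_listed[OF sp, of s] m by simp
  qed
  have two: "halin_list V E" if "P s \<noteq> h" "P (s + 1) \<noteq> h" "P (s + 2) = h" for s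
  proof -
    have "P i \<noteq> h \<longleftrightarrow> L i = L s \<or> L i = L (s + int 1)" for i using char[of i s] that by simp
    then show ?thesis using wheel2_listed[OF sp, of s 1] m by simp
  qed
  have all: "halin_list V E" if p: "P 0 \<noteq> h" "P 1 \<noteq> h" "P 2 \<noteq> h"
  proof (rule halin_listI[of 1 "[h, P 0, P 1, P 2, L 0, L 1, L 2]"])
    have R: "range L = {L 0, L 1, L 2}" using cover_3[OF m, of _ 0] by auto
    have d: "L 0 \<noteq> L 1" "L 0 \<noteq> L 2" "L 1 \<noteq> L 2"
      using m L_neq[of 0 1] L_neq[of 0 2] L_neq[of 1 2] by simp_all
    have pd: "P 0 \<noteq> P 1" "P 0 \<noteq> P 2" "P 1 \<noteq> P 2"
      using spider_inj[OF sp p(1), of 1] spider_inj[OF sp p(1), of 2] spider_inj[OF sp p(2), of 2] d by auto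
    have PL: "P i \<noteq> L j" for i j by (rule P_neq)
    show "distinct [h, P 0, P 1, P 2, L 0, L 1, L 2]"
      using d pd p p[symmetric] PL hub_neq[OF sp] by simp
    have allP: "P i \<noteq> h" for i using char[of i 0] p cover_3[OF m, of i 0] by auto
    have "{P i |i. P i \<noteq> h} = leaf_parent T ` range L" using allP by auto
    then have PR: "{P i |i. P i \<noteq> h} = {P 0, P 1, P 2}" unfolding R by simp
    show "set [h, P 0, P 1, P 2, L 0, L 1, L 2] = V"
      unfolding spider_V[OF sp] PR R by auto
    show "HE 1 = mkE [(0,1),(0,2),(0,3),(1,4),(2,5),(3,6),(4,5),(5,6),(6,4)]" by (simp add: HE_def)
    have E1: "{{h, P i} | i. P i \<noteq> h} = (\<lambda>l. {h, leaf_parent T l}) ` range L" using allP by auto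
    have E2: "{{P i, L i} | i. P i \<noteq> h} = (\<lambda>l. {leaf_parent T l, l}) ` range L" using allP by auto
    have rim: "range (\<lambda>i. {L i, L (i + 1)}) = {{L 0, L 1}, {L 1, L 2}, {L 2, L 0}}"
      using d by (intro rim_3[OF m R]) simp
    show "E = set (map (\<lambda>(a, b). {[h, P 0, P 1, P 2, L 0, L 1, L 2] ! a, [h, P 0, P 1, P 2, L 0, L 1, L 2] ! b})
       [(0,1),(0,2),(0,3),(1,4),(2,5),(3,6),(4,5),(5,6),(6,4)])"
      unfolding spider_E[OF sp] E1 E2 rim R using allP by (simp add: insert_commute)
  qed (auto simp: HV_def)
  show ?thesis
  proof (cases "P 0 = h \<and> P 1 = h \<and> P 2 = h")
    case True
    then have "P i = h" for i using char[of i 0] by simp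
    then show ?thesis using wheel_listed[OF sp] m by simp
  next
    case False
    then show ?thesis
      using one[of 0] one[of 1] one[of 2] two[of 0] two[of 1] two[of 2] all per[of 0] per[of 1] by auto
  qed
qed

text \<open>The total excess is 1: one hub of degree 3, all other internal vertices of degree 2. If
  some leg is longer than 2, \<open>degree2_far_internal\<close> makes the other two legs single
  leaves and puts a leaf right after w, so the long leg has length 3 and the graph is
  \<open>H_2\<close>.\<close>

lemma listed_3:
  assumes m: "m = 3"
  shows "halin_list V E"
proof -
  obtain h where h: "h \<in> V" "\<not> is_leaf T h" "deg T h \<ge> 3" using hub_obtain .
  have d2: "deg T v = 2" if "v \<in> V" "\<not> is_leaf T v" "v \<noteq> h" for v
    using excess_two[OF h(1,2) that(1,2)] that h(3) m deg_internal[OF that(1,2)] by auto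
  have dh: "deg T h = 3" using excess_one[OF h(1,2) d2] m by simp
  show ?thesis
  proof (cases "\<exists>y w. y \<in> nbrs T h \<and> \<not> is_leaf T y \<and> nbrs T y = {h, w} \<and> w \<noteq> h \<and> \<not> is_leaf T w")
    case False
    have "\<exists>w. is_leaf T w \<and> nbrs T y = {h, w}" if y: "y \<in> nbrs T h" "\<not> is_leaf T y" for y
    proof -
      have "y \<noteq> h" using y not_in_nbrs_self[OF simple_T] by blast
      then have "deg T y = 2" using d2[OF nbr_in[OF y(1)] y(2)] by simp
      moreover have "h \<in> nbrs T y" using y by (simp add: nbrs_sym[of h])
      ultimately obtain w where "w \<noteq> h" "nbrs T y = {h, w}" using degree2_nbrs by blast
      then show ?thesis using False y by blast
    qed
    then have "spider h" using h unfolding spider_def by blast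
    then show ?thesis using spider_3_listed[OF m] by blast
  next
    case True
    then obtain y w where y: "y \<in> nbrs T h" "\<not> is_leaf T y" "nbrs T y = {h, w}" "w \<noteq> h" and w: "\<not> is_leaf T w"
      by blast
    obtain u v where uv: "distinct [y, u, v]" "nbrs T h = {y, u, v}"
      using card_3_member[of "nbrs T h" y] dh y by (auto simp: deg_def)
    have far: "is_leaf T x \<and> (\<exists>z. is_leaf T z \<and> {z, w} \<in> T \<and> {x, z} \<in> E)" if "x \<in> {u, v}" for x
      using degree2_far_internal[OF h(2) y(2,3,4) w, of x] that uv by auto
    then obtain z where z: "is_leaf T z" "{z, w} \<in> T" by blast
    have yw: "y \<in> nbrs T w" using y(3) by (simp add: nbrs_sym[of y])
    have zw: "z \<in> nbrs T w" using z by (simp add: nbrs_def)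
    have "deg T w = 2" using d2[of w] nbr_in[of w y] y(3,4) w by simp
    then obtain w' where "nbrs T w = {y, w'}" using degree2_nbrs[OF _ yw] by blast
    then have nw: "nbrs T w = {y, z}" using zw z(1) y(2) by auto
    have nz: "nbrs T z = {w}" using leaf_nbrs[OF z(1)] zw by (simp add: nbrs_sym[of w])
    have nu: "nbrs T u = {h}" "nbrs T v = {h}"
      using leaf_nbrs[of u h] leaf_nbrs[of v h] far uv by (auto simp: nbrs_sym[of h])
    have V: "V = {h, y, w, z, u, v}"
    proof
      show "V \<subseteq> {h, y, w, z, u, v}"
      proof (rule connected_graph_closed[OF connected_T h(1)])
        fix a b assume a: "a \<in> {h, y, w, z, u, v}" and "{a, b} \<in> T"
        then have "b \<in> nbrs T a" by (simp add: nbrs_def insert_commute)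
        then show "b \<in> {h, y, w, z, u, v}" using a uv(2) y(3) nw nz nu by auto
      qed simp
      show "{h, y, w, z, u, v} \<subseteq> V"
        using h(1) nbr_in[of y h] nbr_in[of u h] nbr_in[of v h] nbr_in[of w y] nbr_in[of z w] uv(2) y(3) nw by auto
    qed
    have lf: "is_leaf T u" "is_leaf T v" using far by auto
    have R: "range L = {z, u, v}" unfolding leaves_in_V[OF V] using h(2) y(2) w z(1) lf by auto
    have zu: "z \<noteq> u" "z \<noteq> v" using nz nu y(4) by auto
    have dz: "distinct [z, u, v]" using uv(1) zu by auto
    have neq: "h \<noteq> y" "y \<noteq> w" "h \<noteq> w"
      using not_in_nbrs_self[OF simple_T] uv(2) y(3,4) by (metis insertI1 insertI2)+
    have lneq: "h \<noteq> z" "h \<noteq> u" "h \<noteq> v" "y \<noteq> z" "y \<noteq> u" "y \<noteq> v" "w \<noteq> z" "w \<noteq> u" "w \<noteq> v"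
      using h(2) y(2) w z(1) lf by auto
    have T: "T = {{h, y}, {h, u}, {h, v}, {y, w}, {w, z}}"
      by (subst T_as_nbrs) (simp add: V uv(2) y(3) nw nz nu insert_commute)
    show ?thesis
    proof (rule halin_listI[of 2 "[h, y, w, z, u, v]"])
      show "distinct [h, y, w, z, u, v]" using neq lneq dz by simp
      show "set [h, y, w, z, u, v] = V" using V by simp
      show "HE 2 = mkE [(0,1),(1,2),(2,3),(0,4),(0,5),(3,4),(4,5),(5,3)]" by (simp add: HE_def)
      show "E = set (map (\<lambda>(a, b). {[h, y, w, z, u, v] ! a, [h, y, w, z, u, v] ! b})
         [(0,1),(1,2),(2,3),(0,4),(0,5),(3,4),(4,5),(5,3)])"
        unfolding E_def rim_3[OF m R dz] T by (simp add: insert_commute)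
    qed (auto simp: HV_def)
  qed
qed

section \<open>Four leaves\<close>

lemma rim_4: "m = 4 \<Longrightarrow> range (\<lambda>i. {L i, L (i + 1)}) =
    {{L s, L (s + 1)}, {L (s + 1), L (s + 2)}, {L (s + 2), L (s + 3)}, {L (s + 3), L s}}"
proof -
  assume m: "m = 4"
  then have "{0..<m} = {0, 1, 2, 3}" by auto
  moreover have "L (s + 4) = L s" using L_period[of s] m by simp
  ultimately show ?thesis using rim_shift[of s] by (simp add: add.assoc)
qed

text \<open>By \<open>nb\<close> every long leg is next to a short one, so at most two legs are
  long. Opposite long legs give the doubly subdivided wheel and neighbouring ones give
  \<open>H_6\<close>.\<close>

lemma spider_4_listed:
  assumes m: "m = 4" and sp: "spider h" and nb: "\<And>i. P i \<noteq> h \<Longrightarrow> P (i - 1) = h \<or> P (i + 1) = h"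
  shows "halin_list V E"
proof -
  have per: "L (s + 4) = L s" "L (s + 5) = L (s + 1)" "L (s + 6) = L (s + 2)" for s
    using L_period[of s] L_period[of "s + 1"] L_period[of "s + 2"] m by (simp_all add: add.assoc)
  have char: "P i \<noteq> h \<longleftrightarrow> (P s \<noteq> h \<and> L i = L s) \<or> (P (s + 1) \<noteq> h \<and> L i = L (s + 1)) \<or>
      (P (s + 2) \<noteq> h \<and> L i = L (s + 2)) \<or> (P (s + 3) \<noteq> h \<and> L i = L (s + 3))" for i s
    using cover_4[OF m, of i s] by metis
  have no: "P s = h \<or> P (s + 1) = h \<or> P (s + 2) = h" for s using nb[of "s + 1"] by (auto simp: add.assoc)
  have one: "halin_list V E" if "P s \<noteq> h" "P (s + 1) = h" "P (s + 2) = h" "P (s + 3) = h" for s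
  proof -
    have "P i \<noteq> h \<longleftrightarrow> L i = L s" for i using char[of i s] that by blast
    then show ?thesis using wheel1_listed[OF sp, of s] m by simp
  qed
  have opp: "halin_list V E" if "P s \<noteq> h" "P (s + 1) = h" "P (s + 2) \<noteq> h" "P (s + 3) = h" for s
  proof -
    have "P i \<noteq> h \<longleftrightarrow> L i = L s \<or> L i = L (s + int 2)" for i using char[of i s] that by simp
    then show ?thesis using wheel2_listed[OF sp, of s 2] m by simp
  qed
  have adj: "halin_list V E" if p: "P s \<noteq> h" "P (s + 1) \<noteq> h" "P (s + 2) = h" "P (s + 3) = h" for s
  proof (rule halin_listI[of 6 "[h, P s, P (s + 1), L s, L (s + 1), L (s + 2), L (s + 3)]"])
    have R: "range L = {L s, L (s + 1), L (s + 2), L (s + 3)}" using cover_4[OF m, of _ s] by auto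
    have d: "L s \<noteq> L (s + 1)" "L s \<noteq> L (s + 2)" "L s \<noteq> L (s + 3)" "L (s + 1) \<noteq> L (s + 2)"
       "L (s + 1) \<noteq> L (s + 3)" "L (s + 2) \<noteq> L (s + 3)"
      using m L_neq[of s "s + 1"] L_neq[of s "s + 2"] L_neq[of s "s + 3"] L_neq[of "s + 1" "s + 2"]
        L_neq[of "s + 1" "s + 3"] L_neq[of "s + 2" "s + 3"] by simp_all
    have pd: "P s \<noteq> P (s + 1)" using spider_inj[OF sp p(1), of "s + 1"] d by auto
    have PL: "P i \<noteq> L j" for i j by (rule P_neq)
    show "distinct [h, P s, P (s + 1), L s, L (s + 1), L (s + 2), L (s + 3)]"
      using d pd p(1,2) p(1,2)[symmetric] PL hub_neq[OF sp] by simp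
    have lg: "{L i |i. P i \<noteq> h} = {L s, L (s + 1)}"
      using char[of _ s] p by auto
    have sh: "{L i |i. P i = h} = {L (s + 2), L (s + 3)}"
    proof -
      have "P i = h \<longleftrightarrow> L i = L (s + 2) \<or> L i = L (s + 3)" for i
        using char[of i s] cover_4[OF m, of i s] p d by metis
      then show ?thesis by auto
    qed
    have "{P i |i. P i \<noteq> h} = leaf_parent T ` {L i |i. P i \<noteq> h}" by auto
    then have PR: "{P i |i. P i \<noteq> h} = {P s, P (s + 1)}" unfolding lg by simp
    show "set [h, P s, P (s + 1), L s, L (s + 1), L (s + 2), L (s + 3)] = V"
      unfolding spider_V[OF sp] PR R by auto
    show "HE 6 = mkE [(0,1),(1,3),(0,2),(2,4),(0,5),(0,6),(3,4),(4,5),(5,6),(6,3)]" by (simp add: HE_def)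
    have E0: "{{h, L i} | i. P i = h} = (\<lambda>l. {h, l}) ` {L i |i. P i = h}" by auto
    have E1: "{{h, P i} | i. P i \<noteq> h} = (\<lambda>l. {h, leaf_parent T l}) ` {L i |i. P i \<noteq> h}" by auto
    have E2: "{{P i, L i} | i. P i \<noteq> h} = (\<lambda>l. {leaf_parent T l, l}) ` {L i |i. P i \<noteq> h}" by auto
    show "E = set (map (\<lambda>(a, b). {[h, P s, P (s + 1), L s, L (s + 1), L (s + 2), L (s + 3)] ! a,
       [h, P s, P (s + 1), L s, L (s + 1), L (s + 2), L (s + 3)] ! b})
       [(0,1),(1,3),(0,2),(2,4),(0,5),(0,6),(3,4),(4,5),(5,6),(6,3)])"
      unfolding spider_E[OF sp] E0 E1 E2 rim_4[OF m, of s] sh lg by (simp add: insert_commute)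
  qed (auto simp: HV_def)
  show ?thesis
  proof (cases "P 0 = h \<and> P 1 = h \<and> P 2 = h \<and> P 3 = h")
    case True
    then have "P i = h" for i using char[of i 0] by simp
    then show ?thesis using wheel_listed[OF sp] m by simp
  next
    case False
    then show ?thesis
      using no[of 0] no[of 1] no[of 2] no[of 3] one[of 0] one[of 1] one[of 2] one[of 3]
        opp[of 0] opp[of 1] adj[of 0] adj[of 1] adj[of 2] adj[of 3] per[of 0] per[of 1] by auto
  qed
qed

text \<open>Of the three cycles through four leaves, the one that separates a from b by c and d is
  excluded as an alternation. Allowing two adjacent parents for a and b covers the case in which one
  of their legs is subdivided.\<close>

lemma rim_4_planar:
  assumes m: "m = 4" and R: "range L = {a, b, c, d}" "distinct [a, b, c, d]"
    and par: "{leaf_parent T a, leaf_parent T b} \<subseteq> {x, x'}" "leaf_parent T c = y" "leaf_parent T d = y"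
    and xy: "y \<notin> {x, x'}" "x = x' \<or> {x, x'} \<in> T" "\<not> is_leaf T x" "\<not> is_leaf T x'"
  shows "range (\<lambda>i. {L i, L (i + 1)}) = {{a, b}, {b, c}, {c, d}, {d, a}} \<or>
    range (\<lambda>i. {L i, L (i + 1)}) = {{a, b}, {b, d}, {d, c}, {c, a}}"
proof -
  obtain s where s: "L s = a" using R by (metis insertI1 rangeE)
  have "range L = {L s, L (s + 1), L (s + 2), L (s + 3)}" using cover_4[OF m, of _ s] by auto
  then have S: "{L s, L (s + 1), L (s + 2), L (s + 3)} = {a, b, c, d}" using R by simp
  have d: "L s \<noteq> L (s + 1)" "L s \<noteq> L (s + 2)" "L s \<noteq> L (s + 3)" "L (s + 1) \<noteq> L (s + 2)"
     "L (s + 1) \<noteq> L (s + 3)" "L (s + 2) \<noteq> L (s + 3)"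
    using m L_neq[of s "s + 1"] L_neq[of s "s + 2"] L_neq[of s "s + 3"] L_neq[of "s + 1" "s + 2"]
      L_neq[of "s + 1" "s + 3"] L_neq[of "s + 2" "s + 3"] by simp_all
  have in1: "L (s + 1) \<in> {b, c, d}" "L (s + 2) \<in> {b, c, d}" "L (s + 3) \<in> {b, c, d}"
    using S d s by (metis insertE insertI1 insertI2)+
  have nb: "L (s + 2) \<noteq> b"
  proof
    assume b: "L (s + 2) = b"
    then have cd: "L (s + 1) \<in> {c, d}" "L (s + 3) \<in> {c, d}" using in1 d by auto
    show False
    proof (rule no_alternation[of s "s + 1" "s + 2" "s + 3" x x' y])
      show "P s \<in> {x, x'}" "P (s + 2) \<in> {x, x'}" using par(1) unfolding s b by blast+
      show "P (s + 1) = y" using cd(1) par(2,3) by blast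
      show "P (s + 3) = y" using cd(2) par(2,3) by blast
    qed (use m xy in auto)
  qed
  consider "L (s + 1) = b" "L (s + 2) = c" "L (s + 3) = d" | "L (s + 1) = b" "L (s + 2) = d" "L (s + 3) = c"
    | "L (s + 1) = c" "L (s + 2) = d" "L (s + 3) = b" | "L (s + 1) = d" "L (s + 2) = c" "L (s + 3) = b"
    using in1 nb d(4-6) S s by (elim insertE emptyE; simp)
  then show ?thesis unfolding rim_4[OF m, of s] s by cases (simp_all add: insert_commute)
qed

lemma prism_listed:
  assumes V: "V = {x, y, a, b, c, d}"
    and nx: "nbrs T x = {y, a, b}" and ny: "nbrs T y = {x, c, d}"
    and lf: "is_leaf T a" "is_leaf T b" "is_leaf T c" "is_leaf T d" "\<not> is_leaf T x" "\<not> is_leaf T y"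
    and n: "nbrs T a = {x}" "nbrs T b = {x}" "nbrs T c = {y}" "nbrs T d = {y}"
    and dist: "distinct [a, b, c, d]" and rim: "range (\<lambda>i. {L i, L (i + 1)}) = {{a, b}, {b, c}, {c, d}, {d, a}}"
  shows "halin_list V E"
proof (rule halin_listI[of 3 "[x, a, b, y, c, d]"])
  have "x \<noteq> y" using nx not_in_nbrs_self[OF simple_T] by blast
  moreover have "x \<noteq> a" "x \<noteq> b" "x \<noteq> c" "x \<noteq> d" "y \<noteq> a" "y \<noteq> b" "y \<noteq> c" "y \<noteq> d" using lf by auto
  ultimately show "distinct [x, a, b, y, c, d]" using dist by auto
  show "set [x, a, b, y, c, d] = V" using V by auto
  have T: "T = {{x, y}, {x, a}, {x, b}, {y, c}, {y, d}}"
    by (subst T_as_nbrs) (simp add: V nx ny n insert_commute)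
  show "HE 3 = mkE [(0,1),(1,2),(2,0),(3,4),(4,5),(5,3),(0,3),(1,5),(2,4)]" by (simp add: HE_def)
  show "E = set (map (\<lambda>(i, j). {[x, a, b, y, c, d] ! i, [x, a, b, y, c, d] ! j})
     [(0,1),(1,2),(2,0),(3,4),(4,5),(5,3),(0,3),(1,5),(2,4)])"
    unfolding E_def rim T by (simp add: insert_commute)
qed (auto simp: HV_def)

lemma prism_triangle_subdivided_listed:
  assumes V: "V = {x, z, y, a, b, c, d}"
    and nx: "nbrs T x = {y, z, b}" and nz: "nbrs T z = {x, a}" and ny: "nbrs T y = {x, c, d}"
    and lf: "is_leaf T a" "is_leaf T b" "is_leaf T c" "is_leaf T d" "\<not> is_leaf T x" "\<not> is_leaf T y" "\<not> is_leaf T z"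
    and n: "nbrs T a = {z}" "nbrs T b = {x}" "nbrs T c = {y}" "nbrs T d = {y}"
    and dist: "distinct [a, b, c, d]" "y \<noteq> z" and rim: "range (\<lambda>i. {L i, L (i + 1)}) = {{a, b}, {b, c}, {c, d}, {d, a}}"
  shows "halin_list V E"
proof (rule halin_listI[of 4 "[x, z, a, b, y, c, d]"])
  have "x \<noteq> y" "x \<noteq> z" using nx not_in_nbrs_self[OF simple_T, of x] by auto
  moreover have "v \<noteq> a" "v \<noteq> b" "v \<noteq> c" "v \<noteq> d" if "v \<in> {x, y, z}" for v using lf that by auto
  ultimately show "distinct [x, z, a, b, y, c, d]" using dist by auto
  show "set [x, z, a, b, y, c, d] = V" using V by auto
  have T: "T = {{x, y}, {x, z}, {x, b}, {z, a}, {y, c}, {y, d}}"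
    by (subst T_as_nbrs) (simp add: V nx ny nz n insert_commute)
  show "HE 4 = mkE [(0,1),(1,2),(2,3),(3,0),(4,5),(5,6),(6,4),(0,4),(2,6),(3,5)]" by (simp add: HE_def)
  show "E = set (map (\<lambda>(i, j). {[x, z, a, b, y, c, d] ! i, [x, z, a, b, y, c, d] ! j})
     [(0,1),(1,2),(2,3),(3,0),(4,5),(5,6),(6,4),(0,4),(2,6),(3,5)])"
    unfolding E_def rim T by (simp add: insert_commute)
qed (auto simp: HV_def)

lemma prism_rung_subdivided_listed:
  assumes V: "V = {x, z, y, a, b, c, d}"
    and nx: "nbrs T x = {z, a, b}" and nz: "nbrs T z = {x, y}" and ny: "nbrs T y = {z, c, d}"
    and lf: "is_leaf T a" "is_leaf T b" "is_leaf T c" "is_leaf T d" "\<not> is_leaf T x" "\<not> is_leaf T y" "\<not> is_leaf T z"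
    and n: "nbrs T a = {x}" "nbrs T b = {x}" "nbrs T c = {y}" "nbrs T d = {y}"
    and dist: "distinct [a, b, c, d]" "x \<noteq> y" and rim: "range (\<lambda>i. {L i, L (i + 1)}) = {{a, b}, {b, c}, {c, d}, {d, a}}"
  shows "halin_list V E"
proof (rule halin_listI[of 5 "[x, z, y, a, b, c, d]"])
  have "z \<noteq> y" "x \<noteq> z" using nz not_in_nbrs_self[OF simple_T, of z] by auto
  moreover have "v \<noteq> a" "v \<noteq> b" "v \<noteq> c" "v \<noteq> d" if "v \<in> {x, y, z}" for v using lf that by auto
  ultimately show "distinct [x, z, y, a, b, c, d]" using dist by auto
  show "set [x, z, y, a, b, c, d] = V" using V by auto
  have T: "T = {{x, z}, {z, y}, {x, a}, {x, b}, {y, c}, {y, d}}"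
    by (subst T_as_nbrs) (simp add: V nx ny nz n insert_commute)
  show "HE 5 = mkE [(0,3),(3,4),(4,0),(2,5),(5,6),(6,2),(0,1),(1,2),(3,6),(4,5)]" by (simp add: HE_def)
  show "E = set (map (\<lambda>(i, j). {[x, z, y, a, b, c, d] ! i, [x, z, y, a, b, c, d] ! j})
     [(0,3),(3,4),(4,0),(2,5),(5,6),(6,2),(0,1),(1,2),(3,6),(4,5)])"
    unfolding E_def rim T by (simp add: insert_commute)
qed (auto simp: HV_def)

lemma parent_eq: "nbrs T l = {p} \<Longrightarrow> leaf_parent T l = p" by (simp add: leaf_parent_def)

lemma nbrs_closed:
  assumes "s \<in> V" "s \<in> S" "\<And>a. a \<in> S \<Longrightarrow> nbrs T a \<subseteq> S"
  shows "V \<subseteq> S"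
proof (rule connected_graph_closed[OF connected_T assms(1,2)])
  fix a b assume a: "a \<in> S" and "{a, b} \<in> T"
  then have "b \<in> nbrs T a" by (simp add: nbrs_def insert_commute)
  then show "b \<in> S" using assms(3)[OF a] by blast
qed

text \<open>If w had degree 2, \<open>degree2_far_internal\<close> would end the path right after it
  and the tree would have three leaves. So w has degree 3, and the same lemma applied from both ends
  of the path makes all four outer neighbours leaves: this is \<open>H_5\<close>.\<close>

lemma subdivided_path_4_listed:
  assumes m: "m = 4" and x: "x \<in> V" "\<not> is_leaf T x" "deg T x = 3"
    and z: "z \<in> nbrs T x" "\<not> is_leaf T z" "nbrs T z = {x, w}" "w \<noteq> x" and w: "\<not> is_leaf T w" "deg T w \<le> 3"
  shows "halin_list V E"
proof -
  have zV: "z \<in> V" "w \<in> V" using nbr_in[OF z(1)] nbr_in[of w z] z(3) by auto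
  have zw: "z \<in> nbrs T w" using z(3) by (simp add: nbrs_sym[of z])
  have dw: "deg T w \<ge> 2" using deg_internal[OF zV(2) w(1)] .
  obtain a b where ab: "distinct [z, a, b]" "nbrs T x = {z, a, b}"
    using card_3_member[of "nbrs T x" z] x(3) z(1) by (auto simp: deg_def)
  have far: "is_leaf T u \<and> (\<exists>t. is_leaf T t \<and> {t, w} \<in> T \<and> {u, t} \<in> E)" if "u \<in> {a, b}" for u
    using degree2_far_internal[OF x(2) z(2,3,4) w(1), of u] that ab by auto
  have lab: "is_leaf T a" "is_leaf T b" using far by auto
  have nab: "nbrs T a = {x}" "nbrs T b = {x}"
    using leaf_nbrs[OF lab(1), of x] leaf_nbrs[OF lab(2), of x] ab(2) by (auto simp: nbrs_sym[of x])
  obtain t where t: "is_leaf T t" "{t, w} \<in> T" using far by blast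
  have tw: "t \<in> nbrs T w" using t by (simp add: nbrs_def)
  have nt: "nbrs T t = {w}" using leaf_nbrs[OF t(1)] tw by (simp add: nbrs_sym[of w])
  show ?thesis
  proof (cases "deg T w = 2")
    case True
    then obtain w' where "nbrs T w = {z, w'}" using degree2_nbrs[OF _ zw] by blast
    then have nw: "nbrs T w = {z, t}" using tw t(1) z(2) by auto
    have "V \<subseteq> {x, z, w, t, a, b}"
      by (rule nbrs_closed[OF x(1)]) (use ab(2) z(3) nw nab nt in auto)
    then have "range L \<subseteq> {t, a, b}" using leaves x(2) z(2) w(1) by auto
    then have "card (range L) \<le> card {t, a, b}" by (intro card_mono) auto
    also have "\<dots> \<le> 3" by (simp add: card_insert_if)
    finally show ?thesis using card_leaves m by simp
  next
    case False
    then have "deg T w = 3" using w(2) dw by simp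
    then obtain c d where cd: "distinct [z, c, d]" "nbrs T w = {z, c, d}"
      using card_3_member[of "nbrs T w" z] zw by (auto simp: deg_def)
    have nz': "nbrs T z = {w, x}" using z(3) by auto
    have lcd: "is_leaf T u" if "u \<in> {c, d}" for u
      using degree2_far_internal[OF w(1) z(2) nz' z(4)[symmetric] x(2), of u] that cd by auto
    then have lcd: "is_leaf T c" "is_leaf T d" by auto
    have ncd: "nbrs T c = {w}" "nbrs T d = {w}"
      using leaf_nbrs[OF lcd(1), of w] leaf_nbrs[OF lcd(2), of w] cd(2) by (auto simp: nbrs_sym[of w])
    have V: "V = {x, z, w, a, b, c, d}"
    proof
      show "V \<subseteq> {x, z, w, a, b, c, d}"
        by (rule nbrs_closed[OF x(1)]) (use ab(2) z(3) cd(2) nab ncd in auto)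
      show "{x, z, w, a, b, c, d} \<subseteq> V"
        using x(1) zV nbr_in[of a x] nbr_in[of b x] nbr_in[of c w] nbr_in[of d w] ab(2) cd(2) by auto
    qed
    have dist: "distinct [a, b, c, d]" using ab(1) cd(1) nab ncd z(4) by auto
    have R: "range L = {a, b, c, d}" unfolding leaves_in_V[OF V] using x(2) z(2) w(1) lab lcd by auto
    have "range (\<lambda>i. {L i, L (i + 1)}) = {{a, b}, {b, c}, {c, d}, {d, a}} \<or>
      range (\<lambda>i. {L i, L (i + 1)}) = {{a, b}, {b, d}, {d, c}, {c, a}}"
      using parent_eq[OF nab(1)] parent_eq[OF nab(2)] parent_eq[OF ncd(1)] parent_eq[OF ncd(2)] z(4) x(2)
      by (intro rim_4_planar[OF m R dist, of x x w]) auto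
    then show ?thesis
    proof
      assume "range (\<lambda>i. {L i, L (i + 1)}) = {{a, b}, {b, c}, {c, d}, {d, a}}"
      then show ?thesis
        using prism_rung_subdivided_listed[OF V ab(2) z(3) cd(2) lab lcd x(2) w(1) z(2) nab ncd dist] z(4) by simp
    next
      assume r: "range (\<lambda>i. {L i, L (i + 1)}) = {{a, b}, {b, d}, {d, c}, {c, a}}"
      have "V = {x, z, w, a, b, d, c}" "nbrs T w = {z, d, c}" "distinct [a, b, d, c]" using V cd(2) dist by auto
      from prism_rung_subdivided_listed[OF this(1) ab(2) z(3) this(2) lab lcd(2,1) x(2) w(1) z(2) nab ncd(2,1) this(3)]
      show ?thesis using r z(4) by simp
    qed
  qed
qed

text \<open>The leg through u is the only one that may have length 2. The graph is the prism if it
  is short, and the prism with a subdivided triangle edge otherwise. Both planar cyclic orders give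
  the same graph after exchanging c and d.\<close>

lemma adjacent_cubic_4_listed:
  assumes m: "m = 4" and x: "\<not> is_leaf T x" "nbrs T x = {y, u, b}" "distinct [y, u, b]"
    and y: "\<not> is_leaf T y" "nbrs T y = {x, c, d}" "distinct [x, c, d]"
    and xV: "x \<in> V"
    and lf: "is_leaf T b" "is_leaf T c" "is_leaf T d"
    and u: "is_leaf T u \<or> (\<exists>a. is_leaf T a \<and> nbrs T u = {x, a})"
  shows "halin_list V E"
proof -
  have bV: "y \<in> V" "u \<in> V" "b \<in> V" "c \<in> V" "d \<in> V"
    using nbr_in[of _ x] nbr_in[of _ y] x(2) y(2) by auto
  have nb: "nbrs T b = {x}" using leaf_nbrs[OF lf(1), of x] x(2) by (auto simp: nbrs_sym[of x])
  have ncd: "nbrs T c = {y}" "nbrs T d = {y}"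
    using leaf_nbrs[OF lf(2), of y] leaf_nbrs[OF lf(3), of y] y(2) by (auto simp: nbrs_sym[of y])
  have xy: "x \<noteq> y" using x(2) not_in_nbrs_self[OF simple_T, of x] by auto
  have swap: "nbrs T y = {x, d, c}" using y(2) by auto
  show ?thesis
  proof (cases "is_leaf T u")
    case True
    have nu: "nbrs T u = {x}" using leaf_nbrs[OF True, of x] x(2) by (auto simp: nbrs_sym[of x])
    have V: "V = {x, y, u, b, c, d}"
    proof
      show "V \<subseteq> {x, y, u, b, c, d}"
        by (rule nbrs_closed[OF xV]) (use x(2) y(2) nb nu ncd in auto)
    qed (use xV bV in auto)
    have dist: "distinct [u, b, c, d]" using x(3) y(3) nb nu ncd xy by auto
    have R: "range L = {u, b, c, d}" unfolding leaves_in_V[OF V] using x(1) y(1) lf True by auto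
    have "range (\<lambda>i. {L i, L (i + 1)}) = {{u, b}, {b, c}, {c, d}, {d, u}} \<or>
      range (\<lambda>i. {L i, L (i + 1)}) = {{u, b}, {b, d}, {d, c}, {c, u}}"
      using parent_eq[OF nb] parent_eq[OF nu] parent_eq[OF ncd(1)] parent_eq[OF ncd(2)] xy x(1)
      by (intro rim_4_planar[OF m R dist, of x x y]) auto
    then show ?thesis
    proof
      assume "range (\<lambda>i. {L i, L (i + 1)}) = {{u, b}, {b, c}, {c, d}, {d, u}}"
      then show ?thesis
        using prism_listed[OF V x(2) y(2) True lf x(1) y(1) nu nb ncd dist] by simp
    next
      assume r: "range (\<lambda>i. {L i, L (i + 1)}) = {{u, b}, {b, d}, {d, c}, {c, u}}"
      have "V = {x, y, u, b, d, c}" "distinct [u, b, d, c]" using V dist by auto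
      from prism_listed[OF this(1) x(2) swap True lf(1,3,2) x(1) y(1) nu nb ncd(2,1) this(2)]
      show ?thesis using r by simp
    qed
  next
    case False
    then obtain a where a: "is_leaf T a" "nbrs T u = {x, a}" using u by blast
    have na: "nbrs T a = {u}" using leaf_nbrs[OF a(1), of u] a(2) by (auto simp: nbrs_sym[of u])
    have aV: "a \<in> V" using nbr_in[of a u] a(2) by auto
    have V: "V = {x, u, y, a, b, c, d}"
    proof
      show "V \<subseteq> {x, u, y, a, b, c, d}"
        by (rule nbrs_closed[OF xV]) (use x(2) y(2) nb na a(2) ncd in auto)
    qed (use xV bV aV in auto)
    have ux: "u \<noteq> x" using x(2) not_in_nbrs_self[OF simple_T, of x] by auto
    have dist: "distinct [a, b, c, d]" using x(3) y(3) nb na ncd xy ux by auto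
    have yu: "y \<noteq> u" using x(3) by auto
    have R: "range L = {a, b, c, d}" unfolding leaves_in_V[OF V] using x(1) y(1) lf a(1) False by auto
    have ux': "{u, x} \<in> T"
    proof -
      have "u \<in> nbrs T x" using x(2) by simp
      then show ?thesis by (simp add: nbrs_def)
    qed
    have "range (\<lambda>i. {L i, L (i + 1)}) = {{a, b}, {b, c}, {c, d}, {d, a}} \<or>
      range (\<lambda>i. {L i, L (i + 1)}) = {{a, b}, {b, d}, {d, c}, {c, a}}"
      using parent_eq[OF nb] parent_eq[OF na] parent_eq[OF ncd(1)] parent_eq[OF ncd(2)] xy x(1) False yu ux'
      by (intro rim_4_planar[OF m R dist, of u x y]) auto
    then show ?thesis
    proof
      assume "range (\<lambda>i. {L i, L (i + 1)}) = {{a, b}, {b, c}, {c, d}, {d, a}}"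
      then show ?thesis
        using prism_triangle_subdivided_listed[OF V x(2) a(2) y(2) a(1) lf x(1) y(1) False na nb ncd dist yu] by simp
    next
      assume r: "range (\<lambda>i. {L i, L (i + 1)}) = {{a, b}, {b, d}, {d, c}, {c, a}}"
      have "V = {x, u, y, a, b, d, c}" "distinct [a, b, d, c]" using V dist by auto
      from prism_triangle_subdivided_listed[OF this(1) x(2) a(2) swap a(1) lf(1,3,2) x(1) y(1) False na nb ncd(2,1) this(2) yu]
      show ?thesis using r by simp
    qed
  qed
qed

text \<open>The total excess is 2, so there is one hub of degree 4 or there are two vertices of
  degree 3; all other internal vertices have degree 2.\<close>

lemma listed_4:
  assumes m: "m = 4"
  shows "halin_list V E"
proof (cases "\<exists>h\<in>V. deg T h \<ge> 4")
  case True
  then obtain h where h: "h \<in> V" "deg T h \<ge> 4" "\<not> is_leaf T h" by (auto simp: is_leaf_def)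
  have d2: "deg T v = 2" if "v \<in> V" "\<not> is_leaf T v" "v \<noteq> h" for v
    using excess_two[OF h(1,3) that(1,2)] that h(2) m deg_internal[OF that(1,2)] by auto
  have leg: "\<exists>w. is_leaf T w \<and> nbrs T y = {h, w} \<and> (\<exists>u\<in>nbrs T h - {y}. {u, w} \<in> E \<and> is_leaf T u)"
    if y: "y \<in> nbrs T h" "\<not> is_leaf T y" for y
  proof -
    have "y \<noteq> h" using y not_in_nbrs_self[OF simple_T] by blast
    then have "deg T y = 2" using d2[OF nbr_in[OF y(1)] y(2)] by simp
    moreover have "h \<in> nbrs T y" using y by (simp add: nbrs_sym[of h])
    ultimately obtain w where w: "w \<noteq> h" "nbrs T y = {h, w}" using degree2_nbrs by blast
    then show ?thesis using degree2_large_hub[OF h(3,2) y(2) w(2,1)] by blast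
  qed
  then have sp: "spider h" using h unfolding spider_def by blast
  \<comment> \<open>\<open>degree2_large_hub\<close> provides a leaf hanging on h that is joined to
    leaf i by the rim, so it is leaf i - 1 or i + 1.\<close>
  have "P (i - 1) = h \<or> P (i + 1) = h" if i: "P i \<noteq> h" for i
  proof -
    have nP: "nbrs T (P i) = {h, L i}" using spider_nbrs[OF sp i] .
    then have "h \<in> nbrs T (P i)" by simp
    then have "P i \<in> nbrs T h" by (simp add: nbrs_sym[of "P i"])
    then obtain w u where w: "is_leaf T w" "nbrs T (P i) = {h, w}" and u: "u \<in> nbrs T h" "{u, w} \<in> E" "is_leaf T u"
      using leg[OF _ P_internal] by blast
    have "w = L i" using w nP h(3) by (auto simp: doubleton_eq_iff)
    then have "u \<in> {P i, L (i - 1), L (i + 1)}" using u(2) nbrs_E_leaf[of i] by (auto simp: nbrs_def)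
    then have "u = L (i - 1) \<or> u = L (i + 1)" using u(3) P_internal by auto
    moreover have "{h, u} \<in> T" using u(1) by (simp add: nbrs_def insert_commute)
    ultimately show ?thesis by (auto simp: leaf_edge_iff')
  qed
  then show ?thesis using spider_4_listed[OF m sp] by blast
next
  case False
  then have le3: "deg T v \<le> 3" if "v \<in> V" for v using that by force
  obtain x where x: "x \<in> V" "\<not> is_leaf T x" "deg T x = 3" using hub_obtain le3 by (metis le_antisym)
  have "\<exists>y\<in>V. \<not> is_leaf T y \<and> y \<noteq> x \<and> deg T y \<noteq> 2" using excess_one[OF x(1,2)] x(3) m by force
  then obtain y where y: "y \<in> V" "\<not> is_leaf T y" "y \<noteq> x" "deg T y \<noteq> 2" by blast
  have dy: "deg T y = 3" using le3[OF y(1)] deg_internal[OF y(1,2)] y(4) by simp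
  have d2: "deg T v = 2" if "v \<in> V" "\<not> is_leaf T v" "v \<noteq> x" "v \<noteq> y" for v
    using excess_three[OF x(1,2) y(1,2) that(1,2)] that y(3) x(3) dy m deg_internal[OF that(1,2)] by auto
  show ?thesis
  proof (cases "\<exists>p z w. p \<in> {x, y} \<and> z \<in> nbrs T p \<and> \<not> is_leaf T z \<and> nbrs T z = {p, w} \<and> w \<noteq> p \<and> \<not> is_leaf T w")
    case True
    then obtain p z w where p: "p \<in> {x, y}" "z \<in> nbrs T p" "\<not> is_leaf T z" "nbrs T z = {p, w}" "w \<noteq> p" "\<not> is_leaf T w"
      by blast
    have "p \<in> V" "\<not> is_leaf T p" "deg T p = 3" using p(1) x y dy by auto
    moreover have "deg T w \<le> 3" using le3 nbr_in[of w z] p(4) by simp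
    ultimately show ?thesis using subdivided_path_4_listed[OF m _ _ _ p(2-6)] by blast
  next
    case False
    have leg: "is_leaf T u \<or> (\<exists>a. is_leaf T a \<and> nbrs T u = {p, a})"
      if p: "p \<in> {x, y}" and u: "u \<in> nbrs T p" "u \<noteq> x" "u \<noteq> y" for p u
    proof (rule disjCI)
      assume nl: "\<not> (\<exists>a. is_leaf T a \<and> nbrs T u = {p, a})"
      show "is_leaf T u"
      proof (rule ccontr)
        assume ul: "\<not> is_leaf T u"
        have "deg T u = 2" using d2[OF nbr_in[OF u(1)] ul u(2,3)] .
        moreover have "p \<in> nbrs T u" using u by (simp add: nbrs_sym[of p])
        ultimately obtain w where "w \<noteq> p" "nbrs T u = {p, w}" using degree2_nbrs by blast
        then show False using False nl p u(1) ul by blast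
      qed
    qed
    \<comment> \<open>If x and y were not adjacent, all legs at x would end after at most two steps;
      x with its legs would then be the whole tree, leaving no place for y.\<close>
    have xy: "y \<in> nbrs T x"
    proof (rule ccontr)
      assume nxy: "y \<notin> nbrs T x"
      define S where "S = {x} \<union> nbrs T x \<union> {a. is_leaf T a \<and> (\<exists>u\<in>nbrs T x. nbrs T u = {x, a})}"
      have "V \<subseteq> S"
      proof (rule nbrs_closed[OF x(1)])
        show "x \<in> S" by (simp add: S_def)
        fix v assume "v \<in> S"
        then consider "v = x" | "v \<in> nbrs T x" | u where "is_leaf T v" "u \<in> nbrs T x" "nbrs T u = {x, v}"
          by (auto simp: S_def)
        then show "nbrs T v \<subseteq> S"
        proof cases
          case 1 then show ?thesis by (auto simp: S_def)
        next
          case 2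
          have xv: "x \<in> nbrs T v" using 2 by (simp add: nbrs_sym[of x])
          have "v \<noteq> x" "v \<noteq> y" using 2 not_in_nbrs_self[OF simple_T, of x] nxy by auto
          then consider "is_leaf T v" | a where "is_leaf T a" "nbrs T v = {x, a}" using leg[of x v] 2 by auto
          then show ?thesis
          proof cases
            case 1 then show ?thesis using leaf_nbrs[OF _ xv] by (simp add: S_def)
          next
            case (2 a)
            then have "a \<in> S" using \<open>v \<in> nbrs T x\<close> by (auto simp: S_def)
            then show ?thesis using 2 by (simp add: S_def)
          qed
        next
          case (3 u)
          have "v \<in> nbrs T u" using 3 by simp
          then have "u \<in> nbrs T v" by (simp add: nbrs_sym[of u])
          then have "nbrs T v = {u}" using leaf_nbrs[OF 3(1)] by simp
          then show ?thesis using 3(2) by (simp add: S_def)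
        qed
      qed
      then show False using y nxy by (auto simp: S_def)
    qed
    have yx: "x \<in> nbrs T y" using xy by (simp add: nbrs_sym[of x])
    obtain u1 u2 where u: "distinct [y, u1, u2]" "nbrs T x = {y, u1, u2}"
      using card_3_member[of "nbrs T x" y] x(3) xy by (auto simp: deg_def)
    obtain w1 w2 where w: "distinct [x, w1, w2]" "nbrs T y = {x, w1, w2}"
      using card_3_member[of "nbrs T y" x] dy yx by (auto simp: deg_def)
    have u': "nbrs T x = {y, u2, u1}" "distinct [y, u2, u1]" and w': "nbrs T y = {x, w2, w1}" "distinct [x, w2, w1]"
      using u w by auto
    have ux: "u1 \<noteq> x" "u2 \<noteq> x" "w1 \<noteq> y" "w2 \<noteq> y"
      using not_in_nbrs_self[OF simple_T, of x] not_in_nbrs_self[OF simple_T, of y] u(2) w(2) by auto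
    have lu: "is_leaf T u1 \<or> (\<exists>a. is_leaf T a \<and> nbrs T u1 = {x, a})"
      "is_leaf T u2 \<or> (\<exists>a. is_leaf T a \<and> nbrs T u2 = {x, a})"
      using leg[of x u1] leg[of x u2] u ux by auto
    have lw: "is_leaf T w1 \<or> (\<exists>a. is_leaf T a \<and> nbrs T w1 = {y, a})"
      "is_leaf T w2 \<or> (\<exists>a. is_leaf T a \<and> nbrs T w2 = {y, a})"
      using leg[of y w1] leg[of y w2] w ux by auto
    \<comment> \<open>The edge provided by \<open>cubic_edge\<close> joins vertices at tree distance
      3, so it is a rim edge and both its ends are leaves.\<close>
    have pair: "(is_leaf T u1 \<or> is_leaf T u2) \<and> (is_leaf T w1 \<or> is_leaf T w2)"
    proof -
      obtain p q where pq: "p \<in> {u1, u2}" "q \<in> {w1, w2}" "{p, q} \<in> E"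
        using cubic_edge(1)[OF x(2) u(2,1) y(2) w(2,1)] by blast
      have "{x, p} \<in> T" "{y, q} \<in> T" "{x, y} \<in> T" "q \<noteq> x" "p \<noteq> y"
        using pq(1,2) u w xy by (auto simp: nbrs_def insert_commute)
      then have "{p, q} \<notin> T" using tree_path4(2)[of x y q p] by blast
      then have "is_leaf T p" "is_leaf T q" using E_edge_cases[OF pq(3)] by auto
      then show ?thesis using pq(1,2) by auto
    qed
    have c22: "is_leaf T u2 \<or> is_leaf T w2" using cubic_edge(2)[OF x(2) u(2,1) y(2) w(2,1)] .
    have c12: "is_leaf T u1 \<or> is_leaf T w2" using cubic_edge(2)[OF x(2) u' y(2) w(2,1)] .
    have c21: "is_leaf T u2 \<or> is_leaf T w1" using cubic_edge(2)[OF x(2) u(2,1) y(2) w'] .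
    have c11: "is_leaf T u1 \<or> is_leaf T w1" using cubic_edge(2)[OF x(2) u' y(2) w'] .
    \<comment> \<open>\<open>pair\<close> allows at most one internal outer neighbour on each side,
      and the four instances of \<open>cubic_edge\<close> forbid having one on both sides. Hence at
      least three of the four are leaves.\<close>
    consider "is_leaf T u2" "is_leaf T w1" "is_leaf T w2" | "is_leaf T u1" "is_leaf T w1" "is_leaf T w2"
      | "is_leaf T w2" "is_leaf T u1" "is_leaf T u2" | "is_leaf T w1" "is_leaf T u1" "is_leaf T u2"
      using pair c22 c12 c21 c11 by blast
    then show ?thesis
    proof cases
      case 1
      then show ?thesis by (intro adjacent_cubic_4_listed[OF m x(2) u(2,1) y(2) w(2,1) x(1) _ _ _ lu(1)])
    next
      case 2
      then show ?thesis by (intro adjacent_cubic_4_listed[OF m x(2) u' y(2) w(2,1) x(1) _ _ _ lu(2)])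
    next
      case 3
      then show ?thesis by (intro adjacent_cubic_4_listed[OF m y(2) w(2,1) x(2) u(2,1) y(1) _ _ _ lw(1)])
    next
      case 4
      then show ?thesis by (intro adjacent_cubic_4_listed[OF m y(2) w' x(2) u(2,1) y(1) _ _ _ lw(2)])
    qed
  qed
qed

lemma listed: "halin_list V E"
proof -
  consider "m = 3" | "m = 4" | "m = 5" | "m \<ge> 6" using m_ge by linarith
  then show ?thesis by cases (simp_all add: listed_3 listed_4 listed_5 listed_ge6)
qed

end

theorem theorem1p3:
  fixes V :: "'a set" and E :: "'a set set"
  assumes "gen_halin V E"
    and "\<forall>u\<in>V. \<forall>v\<in>V. {u, v} \<in> E \<longrightarrow> kappa_LLY V E u v > 0"
  shows "card V \<le> 12 \<and>
    ((\<exists>n. 4 \<le> n \<and> n \<le> 12 \<and> graph_iso V E (wheelV n) (wheelE n)) \<or>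
     (\<exists>n. 5 \<le> n \<and> n \<le> 9 \<and> graph_iso V E (wheel1V n) (wheel1E n)) \<or>
     (\<exists>n. 6 \<le> n \<and> n \<le> 10 \<and> graph_iso V E (wheel2V n) (wheel2E n)) \<or>
     (\<exists>i. 1 \<le> i \<and> i \<le> 8 \<and> graph_iso V E (HV i) (HE i)))"
proof -
  obtain T L m where lc: "leaf_cycle V T E L m" using gen_halin_leaf_cycle[OF assms(1)] .
  have "kappa_LLY V E u v > 0" if "{u, v} \<in> E" for u v
    using assms(2) that edge_verts[OF leaf_cycle.simple_E[OF lc] that] by blast
  then have "positive_halin V T E L m"
    using lc by (simp add: positive_halin_def positive_halin_axioms_def)
  then have "halin_list V E" by (rule positive_halin.listed)
  then show ?thesis using halin_list_card unfolding halin_list_def by blast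
qed

end
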